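(* Let $\lambda>0$ and $s\in[0,1]$. The following propositions are equivalent: (i) There exists a one-sided test for deciding $\mathbb{P}_{0,d}$ versus $\mathbb{P}_{1,d}$. (ii) $\lim_{d\to\infty}\mathrm{KL}_d=+\infty$ and $\lambda s>1$. (iii) There exists a sequence $(a_d)_{d\ge 0}$ with $a_d\to\infty$ such that $\mathbb{P}_{0,d}(\mathbf{L}_d>a_d)\to 0$ and $\liminf_{d\to\infty}\mathbb{P}_{1,d}(\mathbf{L}_d>a_d)>0$. (iv) The martingale $(\mathbf{L}_d)_{d\ge0}$ under $\mathbb{P}_0$ (with respect to the filtration $\mathcal{F}_d=\sigma(p_d(\mathbf{t}),p_d(\mathbf{t}'))$) is not uniformly integrable. (v) $\lambda s>1$ and $\mathbb{P}_1\left(\liminf_{d\to\infty}(\lambda s)^{-d}\log \mathbf{L}_d>0\right)\ge 1-p_{\mathrm{ext}}(\lambda s)$.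
   Context: Rooted trees are canonically labeled: the root has label $\varnothing$, and if a node has label $m$ and $c$ children, its children have labels $\{m,1\},\dots,\{m,c\}$. $\mathcal{X}_n$ is the set of canonically labeled rooted trees of depth at most $n$; $p_n(t)$ is the pruning of $t$ at depth $n$ (nodes at distance $>n$ from the root are removed). For $\mu>0$, $\pi_\mu(k)=e^{-\mu}\mu^k/k!$, $\mathrm{GW}_\mu$ is the law of a labeled Galton–Watson tree with $\mathrm{Poisson}(\mu)$ offspring, and $\mathrm{GW}_{\mu,n}$ the law of its pruning at depth $n$. A uniform random relabeling of a labeled tree is obtained by independently, at every node, permuting its children by a uniformly random permutation, then relabeling canonically. Write $\bar s=1-s$. A $(\lambda,s)$-augmentation of a tree $\tau$ is obtained by attaching to each node of $\tau$ an independent $\mathrm{Poisson}(\lambda\bar s)$ number of new children, and attaching to each new child an independent $\mathrm{GW}_\lambda$ tree. Under $\mathbb{P}_0$, $(\mathbf{t},\mathbf{t}')$ are two independent $\mathrm{GW}_\lambda$ trees. Under $\mathbb{P}_1$: $\boldsymbol{\tau}^*\sim\mathrm{GW}_{\lambda s}$, $\boldsymbol\tau,\boldsymbol\tau'$ are two independent $(\lambda,s)$-augmentations of $\boldsymbol\tau^*$, and $\mathbf{t},\mathbf{t}'$ are independent uniform random relabelings of $\boldsymbol\tau,\boldsymbol\tau'$. $\mathbb{P}_{i,n}$ is the law of $(p_n(\mathbf t),p_n(\mathbf t'))$ under $\mathbb{P}_i$, $i\in\{0,1\}$. For $t,t'\in\mathcal X_n$, $L_n(t,t')=\mathbb{P}_{1,n}(t,t')/\mathbb{P}_{0,n}(t,t')$,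 and $\mathbf{L}_n:=L_n(p_n(\mathbf t),p_n(\mathbf t'))$. A one-sided test is a sequence of maps $\mathcal{T}_n:\mathcal X_n\times\mathcal X_n\to\{0,1\}$ with $\mathbb{P}_{0,n}(\mathcal T_n=1)\to0$ and $\liminf_n\mathbb{P}_{1,n}(\mathcal T_n=1)>0$. $\mathrm{KL}_d:=\mathrm{KL}(\mathbb{P}_{1,d}\Vert\mathbb{P}_{0,d})=\mathbb{E}_1[\log\mathbf{L}_d]$. $p_{\mathrm{ext}}(\mu)$ is the extinction probability of a Galton–Watson tree with $\mathrm{Poisson}(\mu)$ offspring. *)

theory Defs
  imports "HOL-Probability.Probability"
begin

section \<open>Canonically labeled rooted trees\<close>

text \<open>
  A canonically labeled tree is identified with the set of the labels of its nodes: the label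
  \<open>{\<dots>{{\<emptyset>, i\<^sub>1}, i\<^sub>2}\<dots>, i\<^sub>k}\<close> is the list \<open>[i\<^sub>1, \<dots>, i\<^sub>k]\<close>. Trees may be infinite, but
  every node has finitely many children.
\<close>

type_synonym ltree = "nat list set"

definition ltrees :: "ltree set" where
  "ltrees = {t. [] \<in> t \<and> (\<forall>m i. m @ [i] \<in> t \<longrightarrow> m \<in> t) \<and>
                (\<forall>m\<in>t. \<exists>c. {i. m @ [i] \<in> t} = {1..c})}"

definition nchildren :: "ltree \<Rightarrow> nat list \<Rightarrow> nat" where
  "nchildren t m = card {i. m @ [i] \<in> t}"

definition ltrees_upto :: "nat \<Rightarrow> ltree set" where
  "ltrees_upto n = {t \<in> ltrees. \<forall>m\<in>t. length m \<le> n}"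

definition prune :: "nat \<Rightarrow> ltree \<Rightarrow> ltree" where
  "prune n t = {m \<in> t. length m \<le> n}"

definition prune2 :: "nat \<Rightarrow> ltree \<times> ltree \<Rightarrow> ltree \<times> ltree" where
  "prune2 n = (\<lambda>(t, t'). (prune n t, prune n t'))"

text \<open>The \<open>\<sigma>\<close>-algebra below is also the one generated by all prunings \<open>prune n\<close>.\<close>

definition tree_space :: "ltree measure" where
  "tree_space = sigma ltrees {{t \<in> ltrees. m \<in> t} | m. True}"

section \<open>Random trees\<close>

text \<open>The library's Poisson distribution is only specified for a positive rate; rate \<open>0\<close> (point
  mass at \<open>0\<close>) is needed when \<open>s = 0\<close> or \<open>s = 1\<close>.\<close>

definition Poisson :: "real \<Rightarrow> nat pmf" where
  "Poisson \<mu> = (if \<mu> > 0 then poisson_pmf \<mu> else return_pmf 0)"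

inductive_set tree_of_offspring :: "(nat list \<Rightarrow> nat) \<Rightarrow> ltree" for \<omega> where
  root: "[] \<in> tree_of_offspring \<omega>"
| child: "m \<in> tree_of_offspring \<omega> \<Longrightarrow> i \<in> {1..\<omega> m} \<Longrightarrow> m @ [i] \<in> tree_of_offspring \<omega>"

definition GW :: "real \<Rightarrow> ltree measure" where
  "GW \<mu> = distr (\<Pi>\<^sub>M m\<in>UNIV. measure_pmf (Poisson \<mu>)) tree_space tree_of_offspring"

definition p_ext :: "real \<Rightarrow> real" where
  "p_ext \<mu> = measure (GW \<mu>) {t \<in> ltrees. \<exists>n. \<forall>m\<in>t. length m \<noteq> n}"

text \<open>If the children of every node \<open>m\<close> are permuted by \<open>\<sigma> m\<close>, the \<open>i\<close>-th child of \<open>m\<close> becomes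
  the \<open>\<sigma> m i\<close>-th child of the relabeled \<open>m\<close>.\<close>

definition new_label :: "(nat list \<Rightarrow> nat \<Rightarrow> nat) \<Rightarrow> nat list \<Rightarrow> nat list" where
  "new_label \<sigma> m = map (\<lambda>k. \<sigma> (take k m) (m ! k)) [0..<length m]"

definition uniform_relabeling :: "ltree \<Rightarrow> ltree measure" where
  "uniform_relabeling t =
     distr (\<Pi>\<^sub>M m\<in>UNIV. uniform_count_measure {\<pi>. \<pi> permutes {1..nchildren t m}})
       tree_space (\<lambda>\<sigma>. new_label \<sigma> ` t)"

text \<open>Node \<open>m\<close> receives \<open>K m\<close> new children, labeled after its existing ones, and the tree
  \<open>G (m, j)\<close> is grafted at the \<open>j\<close>-th of them.\<close>

definition attach :: "ltree \<Rightarrow> (nat list \<Rightarrow> nat) \<Rightarrow> (nat list \<times> nat \<Rightarrow> ltree) \<Rightarrow> ltree" where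
  "attach t K G =
     t \<union> {m @ [nchildren t m + j] @ u | m j u. m \<in> t \<and> j \<in> {1..K m} \<and> u \<in> G (m, j)}"

definition augmentation :: "real \<Rightarrow> real \<Rightarrow> ltree \<Rightarrow> ltree measure" where
  "augmentation lam s t =
     distr ((\<Pi>\<^sub>M m\<in>UNIV. measure_pmf (Poisson (lam * (1 - s)))) \<Otimes>\<^sub>M (\<Pi>\<^sub>M mj\<in>UNIV. GW lam))
       tree_space (\<lambda>(K, G). attach t K G)"

section \<open>The two hypotheses and the likelihood ratio\<close>

definition P0 :: "real \<Rightarrow> (ltree \<times> ltree) measure" where
  "P0 lam = GW lam \<Otimes>\<^sub>M GW lam"

text \<open>Conditionally on \<open>\<tau>\<close>, the two relabeled augmentations are independent.\<close>

definition P1 :: "real \<Rightarrow> real \<Rightarrow> (ltree \<times> ltree) measure" where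
  "P1 lam s = GW (lam * s) \<bind> (\<lambda>\<tau>.
     (augmentation lam s \<tau> \<bind> uniform_relabeling) \<Otimes>\<^sub>M
     (augmentation lam s \<tau> \<bind> uniform_relabeling))"

definition pruned_law :: "(ltree \<times> ltree) measure \<Rightarrow> nat \<Rightarrow> (ltree \<times> ltree) measure" where
  "pruned_law P n = distr P (count_space (ltrees_upto n \<times> ltrees_upto n)) (prune2 n)"

text \<open>For \<open>s = 1\<close> the ratio vanishes on pairs of non-isomorphic trees, but always with
  \<open>P1\<close>-probability \<open>0\<close>, so the convention \<open>ln 0 = 0\<close> does not matter under \<open>P1\<close>.\<close>

definition L :: "real \<Rightarrow> real \<Rightarrow> nat \<Rightarrow> ltree \<times> ltree \<Rightarrow> real" where
  "L lam s n x = measure (pruned_law (P1 lam s) n) {x} / measure (pruned_law (P0 lam) n) {x}"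

text \<open>\<open>KL_divergence b M N\<close> is the divergence of \<open>N\<close> relative to \<open>M\<close>, so the reference measure
  comes first. The integral defining it is finite here: the divergence is the mutual information
  of two pruned trees of law \<open>GW lam\<close>, hence at most the (finite) entropy of one of them.\<close>

definition KL :: "real \<Rightarrow> real \<Rightarrow> nat \<Rightarrow> real" where
  "KL lam s d = KL_divergence (exp 1) (pruned_law (P0 lam) d) (pruned_law (P1 lam s) d)"

definition pruned_filtration :: "nat \<Rightarrow> (ltree \<times> ltree) measure" where
  "pruned_filtration d =
     vimage_algebra (ltrees \<times> ltrees) (prune2 d) (count_space (ltrees_upto d \<times> ltrees_upto d))"

section \<open>Tests, martingales, uniform integrability\<close>

definition one_sided_test ::
  "(nat \<Rightarrow> (ltree \<times> ltree) measure) \<Rightarrow> (nat \<Rightarrow> (ltree \<times> ltree) measure) \<Rightarrow>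
   (nat \<Rightarrow> ltree \<times> ltree \<Rightarrow> nat) \<Rightarrow> bool" where
  "one_sided_test Q0 Q1 T \<longleftrightarrow>
     (\<forall>n. T n \<in> ltrees_upto n \<times> ltrees_upto n \<rightarrow> {0, 1}) \<and>
     (\<lambda>n. measure (Q0 n) {x \<in> ltrees_upto n \<times> ltrees_upto n. T n x = 1}) \<longlonglongrightarrow> 0 \<and>
     liminf (\<lambda>n. ereal (measure (Q1 n) {x \<in> ltrees_upto n \<times> ltrees_upto n. T n x = 1})) > 0"

definition martingale :: "'a measure \<Rightarrow> (nat \<Rightarrow> 'a measure) \<Rightarrow> (nat \<Rightarrow> 'a \<Rightarrow> real) \<Rightarrow> bool" where
  "martingale M F X \<longleftrightarrow>
     filtration (space M) F \<and> (\<forall>n. subalgebra M (F n)) \<and>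
     (\<forall>n. X n \<in> borel_measurable (F n)) \<and> (\<forall>n. integrable M (X n)) \<and>
     (\<forall>m n. m \<le> n \<longrightarrow> (AE x in M. real_cond_exp M (F m) (X n) x = X m x))"

definition uniformly_integrable :: "'a measure \<Rightarrow> (nat \<Rightarrow> 'a \<Rightarrow> real) \<Rightarrow> bool" where
  "uniformly_integrable M X \<longleftrightarrow>
     (\<forall>n. X n \<in> borel_measurable M) \<and>
     ((\<lambda>K::real. SUP n. \<integral>\<^sup>+x. ennreal \<bar>X n x\<bar> * indicator {x. \<bar>X n x\<bar> > K} x \<partial>M)
        \<longlongrightarrow> 0) at_top"

end

theory Submission
  imports Defs
begin

text \<open>
  Cut at a finite depth, all laws are discrete, and the correlated law has a branching recursion:
  the root has \<open>Poisson (lam * s)\<close> common children carrying independent correlated pairs,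
  \<open>Poisson (lam * (1 - s))\<close> further children on either side carrying independent Galton--Watson
  trees, and both sides are shuffled. Keeping one outcome of this experiment bounds the likelihood
  ratio at a node below by a weight depending on the root degrees, times the product of the ratios
  at the common children.

  If the relative entropy diverges and \<open>\<mu> = lam * s > 1\<close>, then at some depth the truncated log-ratio
  has a mean that outweighs the accumulated log-weights; a second-moment argument for the resulting
  branching sums gives growth of order \<open>\<mu> ^ d\<close> with positive probability. A single growing common
  child makes the root grow, since log-ratios are rarely very negative under the correlated law, so
  the probability \<open>\<eta>\<close> of no growth satisfies \<open>\<eta> \<le> exp (\<mu> * (\<eta> - 1))\<close>, which together with
  \<open>\<eta> < 1\<close> forces \<open>\<eta> \<le> p_ext \<mu>\<close>.

  If \<open>\<mu> \<le> 1\<close>, the common tree is almost surely finite. A Galton--Watson tree is a relabeled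
  augmentation of the common tree, so given a common tree of probability \<open>p > 0\<close> the law of
  either side has a density of at most \<open>1 / p\<close> with respect to the Galton--Watson law, at every
  depth. Hence the correlated law is uniformly absolutely continuous and no test exists. The other
  implications are changes of measure.
\<close>

declare One_nat_def [simp del]

section \<open>Trees as roots with subtrees\<close>

definition node :: "nat \<Rightarrow> (nat \<Rightarrow> ltree) \<Rightarrow> ltree" where
  "node c f = insert [] {i # u | i u. i \<in> {1..c} \<and> u \<in> f i}"

definition subtree :: "ltree \<Rightarrow> nat \<Rightarrow> ltree" where
  "subtree t i = {m. i # m \<in> t}"

lemma Nil_in_node [simp]: "[] \<in> node c f"
  and Cons_in_node [simp]: "i # u \<in> node c f \<longleftrightarrow> i \<in> {1..c} \<and> u \<in> f i"
  by (auto simp: node_def)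

lemma in_subtree_iff [simp]: "m \<in> subtree t i \<longleftrightarrow> i # m \<in> t"
  by (simp add: subtree_def)

lemma ltree_eqI:
  assumes "[] \<in> t \<longleftrightarrow> [] \<in> t'" "\<And>i m. i # m \<in> t \<longleftrightarrow> i # m \<in> t'"
  shows "t = (t' :: ltree)"
proof (rule set_eqI)
  fix m show "m \<in> t \<longleftrightarrow> m \<in> t'" using assms by (cases m) auto
qed

lemma Nil_in_ltrees: "t \<in> ltrees \<Longrightarrow> [] \<in> t"
  by (simp add: ltrees_def)

lemma ltrees_snocD: "t \<in> ltrees \<Longrightarrow> m @ [i] \<in> t \<Longrightarrow> m \<in> t"
  unfolding ltrees_def by blast

lemma ltrees_children: "t \<in> ltrees \<Longrightarrow> m \<in> t \<Longrightarrow> {i. m @ [i] \<in> t} = {1..nchildren t m}"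
  unfolding ltrees_def nchildren_def by force

lemma ltrees_prefix: "t \<in> ltrees \<Longrightarrow> m @ m' \<in> t \<Longrightarrow> m \<in> t"
proof (induction m' rule: rev_induct)
  case (snoc i m')
  then have "(m @ m') @ [i] \<in> t" by simp
  with snoc show ?case using ltrees_snocD by blast
qed simp

lemma ltrees_root_child: "t \<in> ltrees \<Longrightarrow> [i] \<in> t \<longleftrightarrow> i \<in> {1..nchildren t []}"
  using ltrees_children[of t "[]"] Nil_in_ltrees[of t] by auto

lemma ltrees_ConsD: "t \<in> ltrees \<Longrightarrow> i # m \<in> t \<Longrightarrow> i \<in> {1..nchildren t []}"
  using ltrees_prefix[of t "[i]" m] ltrees_root_child by simp

lemma nchildren_subtree: "nchildren (subtree t i) m = nchildren t (i # m)"
  by (simp add: nchildren_def)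

lemma subtree_in_ltrees:
  assumes "t \<in> ltrees" "i \<in> {1..nchildren t []}" shows "subtree t i \<in> ltrees"
proof -
  have "[i] \<in> t" using assms ltrees_root_child by blast
  moreover have "i # m \<in> t" if "i # (m @ [j]) \<in> t" for m j
    using ltrees_snocD[OF assms(1), of "i # m" j] that by simp
  moreover have "\<exists>c. {j. i # (m @ [j]) \<in> t} = {1..c}" if "i # m \<in> t" for m
    using ltrees_children[OF assms(1) that] by auto
  ultimately show ?thesis by (auto simp: ltrees_def)
qed

lemma node_subtree: "t \<in> ltrees \<Longrightarrow> node (nchildren t []) (subtree t) = t"
  by (rule ltree_eqI) (auto simp: Nil_in_ltrees dest: ltrees_ConsD)

lemma nchildren_node:
  assumes "\<And>i. i \<in> {1..c} \<Longrightarrow> [] \<in> f i" shows "nchildren (node c f) [] = c"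
proof -
  have "{i. [] @ [i] \<in> node c f} = {1..c}" using assms by auto
  then show ?thesis by (simp add: nchildren_def)
qed

lemma subtree_node: "i \<in> {1..c} \<Longrightarrow> subtree (node c f) i = f i"
  by auto

lemma node_cong: "c = c' \<Longrightarrow> (\<And>i. i \<in> {1..c'} \<Longrightarrow> f i = f' i) \<Longrightarrow> node c f = node c' f'"
  by (rule ltree_eqI) auto

lemma node_eq_iff:
  assumes "\<And>i. i \<in> {1..c} \<Longrightarrow> [] \<in> f i" "\<And>i. i \<in> {1..c'} \<Longrightarrow> [] \<in> f' i"
  shows "node c f = node c' f' \<longleftrightarrow> c = c' \<and> (\<forall>i\<in>{1..c}. f i = f' i)"
proof
  assume eq: "node c f = node c' f'"
  then have "nchildren (node c f) [] = nchildren (node c' f') []" by simp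
  then have same_degree: "c = c'"
    using nchildren_node[OF assms(1)] nchildren_node[OF assms(2)] by simp
  moreover have "f i = f' i" if "i \<in> {1..c}" for i
    using that eq same_degree subtree_node[of i c f] subtree_node[of i c' f'] by simp
  ultimately show "c = c' \<and> (\<forall>i\<in>{1..c}. f i = f' i)" by blast
qed (auto intro!: node_cong)

lemma node_in_ltrees:
  assumes "\<And>i. i \<in> {1..c} \<Longrightarrow> f i \<in> ltrees" shows "node c f \<in> ltrees"
  unfolding ltrees_def mem_Collect_eq
proof (intro conjI allI ballI impI)
  fix m i assume "m @ [i] \<in> node c f"
  then show "m \<in> node c f" using assms by (cases m) (auto dest: ltrees_snocD)
next
  fix m assume m: "m \<in> node c f"
  show "\<exists>k. {i. m @ [i] \<in> node c f} = {1..k}"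
  proof (cases m)
    case Nil
    then have "{i. m @ [i] \<in> node c f} = {1..c}" using assms by (auto simp: Nil_in_ltrees)
    then show ?thesis by blast
  next
    case (Cons j u)
    then have "{i. m @ [i] \<in> node c f} = {1..nchildren (f j) u}"
      using m ltrees_children[OF assms, of j u] by auto
    then show ?thesis by blast
  qed
qed simp

subsection \<open>Pruning\<close>

lemma prune_node: "prune (Suc n) (node c f) = node c (\<lambda>i. prune n (f i))"
  by (rule ltree_eqI) (auto simp: prune_def)

lemma prune_0: "[] \<in> t \<Longrightarrow> prune 0 t = {[]}"
  by (auto simp: prune_def)

lemma prune_prune: "m \<le> n \<Longrightarrow> prune m (prune n t) = prune m t"
  by (auto simp: prune_def)

lemma Nil_in_prune [simp]: "[] \<in> prune n t \<longleftrightarrow> [] \<in> t"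
  by (simp add: prune_def)

lemma nchildren_prune: "nchildren (prune (Suc n) t) [] = nchildren t []"
  by (auto simp: nchildren_def prune_def)

lemma subtree_prune: "subtree (prune (Suc n) t) i = prune n (subtree t i)"
  by (auto simp: prune_def)

lemma ltrees_upto_0: "ltrees_upto 0 = {{[]}}"
proof -
  have "{[]} = node 0 (\<lambda>_. {})" by (auto simp: node_def)
  then have "{[]} \<in> ltrees" using node_in_ltrees[of 0] by simp
  then show ?thesis by (force simp: ltrees_upto_def ltrees_def)
qed

lemma leaf_in_ltrees_upto: "{[]} \<in> ltrees_upto n"
  using ltrees_upto_0 by (auto simp: ltrees_upto_def)

lemma ltrees_upto_imp_ltrees: "t \<in> ltrees_upto n \<Longrightarrow> t \<in> ltrees"
  by (simp add: ltrees_upto_def)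

lemma Nil_in_ltrees_upto: "t \<in> ltrees_upto n \<Longrightarrow> [] \<in> t"
  by (simp add: ltrees_upto_imp_ltrees Nil_in_ltrees)

lemma node_in_ltrees_upto:
  assumes "\<And>i. i \<in> {1..c} \<Longrightarrow> f i \<in> ltrees_upto n" shows "node c f \<in> ltrees_upto (Suc n)"
  using assms node_in_ltrees[of c f] by (auto simp: ltrees_upto_def node_def)

lemma subtree_in_ltrees_upto:
  "t \<in> ltrees_upto (Suc n) \<Longrightarrow> i \<in> {1..nchildren t []} \<Longrightarrow> subtree t i \<in> ltrees_upto n"
  using subtree_in_ltrees[of t i] by (fastforce simp: ltrees_upto_def)

lemma ltrees_upto_SucE:
  assumes "t \<in> ltrees_upto (Suc n)"
  obtains c f where "t = node c f" "\<And>i. f i \<in> ltrees_upto n"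
proof
  let ?f = "\<lambda>i. if i \<in> {1..nchildren t []} then subtree t i else {[]}"
  show "t = node (nchildren t []) ?f"
    by (subst (1) node_subtree[OF ltrees_upto_imp_ltrees[OF assms], symmetric])
       (auto intro!: node_cong)
  show "?f i \<in> ltrees_upto n" for i
    using assms by (auto simp: leaf_in_ltrees_upto intro!: subtree_in_ltrees_upto)
qed

lemma prune_in_ltrees_upto: "t \<in> ltrees \<Longrightarrow> prune n t \<in> ltrees_upto n"
proof (induction n arbitrary: t)
  case 0 then show ?case by (simp add: prune_0 ltrees_upto_0 Nil_in_ltrees)
next
  case (Suc n)
  have "prune (Suc n) t = node (nchildren t []) (\<lambda>i. prune n (subtree t i))"
    using prune_node node_subtree[OF Suc.prems] by metis
  then show ?case using Suc by (auto intro!: node_in_ltrees_upto subtree_in_ltrees)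
qed

lemma prune_ident: "t \<in> ltrees_upto n \<Longrightarrow> prune n t = t"
  by (auto simp: prune_def ltrees_upto_def)

lemma ltreesI_prune:
  assumes "\<And>n. prune n t \<in> ltrees" shows "t \<in> ltrees"
  unfolding ltrees_def mem_Collect_eq
proof (intro conjI allI ballI impI)
  show "[] \<in> t" using Nil_in_ltrees[OF assms[of 0]] by simp
next
  fix m i assume "m @ [i] \<in> t"
  then have "m @ [i] \<in> prune (Suc (length m)) t" by (simp add: prune_def)
  then show "m \<in> t" using ltrees_snocD[OF assms] by (auto simp: prune_def)
next
  fix m assume "m \<in> t"
  then have "m \<in> prune (Suc (length m)) t" by (simp add: prune_def)
  from ltrees_children[OF assms this] show "\<exists>c. {i. m @ [i] \<in> t} = {1..c}"
    by (auto simp: prune_def)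
qed

lemma ltrees_coinduct [consumes 1, case_names node]:
  assumes "X t"
    and step: "\<And>x. X x \<Longrightarrow> \<exists>c f. x = node c f \<and> (\<forall>i\<in>{1..c}. X (f i) \<or> f i \<in> ltrees)"
  shows "t \<in> ltrees"
proof (rule ltreesI_prune)
  have "prune n t \<in> ltrees" if "X t \<or> t \<in> ltrees" for n t
    using that
  proof (induction n arbitrary: t)
    case 0
    then have "[] \<in> t" using step[of t] Nil_in_ltrees by auto
    then show ?case using leaf_in_ltrees_upto by (auto simp: prune_0 ltrees_upto_def)
  next
    case (Suc n)
    show ?case
    proof (cases "X t")
      case True
      from step[OF this] obtain c f
        where "t = node c f" "\<forall>i\<in>{1..c}. X (f i) \<or> f i \<in> ltrees" by blast
      then show ?thesis using Suc.IH by (auto simp: prune_node intro!: node_in_ltrees)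
    next
      case False
      then show ?thesis
        using Suc.prems prune_in_ltrees_upto ltrees_upto_imp_ltrees by blast
    qed
  qed
  then show "prune n t \<in> ltrees" for n using \<open>X t\<close> by blast
qed

lemma finite_ltrees_upto_member: "t \<in> ltrees_upto n \<Longrightarrow> finite t"
proof (induction n arbitrary: t)
  case 0 then show ?case by (simp add: ltrees_upto_0)
next
  case (Suc n)
  then obtain c f where t: "t = node c f" "\<And>i. f i \<in> ltrees_upto n"
    by (blast elim: ltrees_upto_SucE)
  have "node c f = insert [] (\<Union>i\<in>{1..c}. (#) i ` f i)" by (auto simp: node_def)
  then show ?case using t Suc.IH by simp
qed

lemma countable_ltrees_upto [simp]: "countable (ltrees_upto n)"
proof (rule countable_subset)
  show "ltrees_upto n \<subseteq> {A. finite A}" using finite_ltrees_upto_member by blast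
  show "countable {A :: ltree. finite A}" by (rule countable_Collect_finite)
qed

subsection \<open>The branching structure of random trees, relabelings and attachments\<close>

lemma tree_of_offspring_snoc:
  "m @ [i] \<in> tree_of_offspring \<omega> \<longleftrightarrow> m \<in> tree_of_offspring \<omega> \<and> i \<in> {1..\<omega> m}"
  by (subst tree_of_offspring.simps) auto

lemma tree_of_offspring_Cons:
  "i # m \<in> tree_of_offspring \<omega> \<longleftrightarrow>
    i \<in> {1..\<omega> []} \<and> m \<in> tree_of_offspring (\<lambda>u. \<omega> (i # u))"
proof (induction m rule: rev_induct)
  case Nil
  show ?case using tree_of_offspring_snoc[of "[]" i \<omega>] by (auto intro: tree_of_offspring.root)
next
  case (snoc j m)
  have "i # m @ [j] \<in> tree_of_offspring \<omega> \<longleftrightarrow> i # m \<in> tree_of_offspring \<omega> \<and> j \<in> {1..\<omega> (i # m)}"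
    using tree_of_offspring_snoc[of "i # m" j \<omega>] by simp
  then show ?case using snoc by (simp add: tree_of_offspring_snoc)
qed

lemma tree_of_offspring_eq_node:
  "tree_of_offspring \<omega> = node (\<omega> []) (\<lambda>i. tree_of_offspring (\<lambda>m. \<omega> (i # m)))"
  by (rule ltree_eqI) (auto simp: tree_of_offspring_Cons intro: tree_of_offspring.root)

lemma tree_of_offspring_in_ltrees: "tree_of_offspring \<omega> \<in> ltrees"
proof (coinduction arbitrary: \<omega> rule: ltrees_coinduct)
  case node
  show ?case using tree_of_offspring_eq_node by blast
qed

lemma new_label_Nil [simp]: "new_label \<sigma> [] = []"
  by (simp add: new_label_def)

lemma new_label_Cons [simp]:
  "new_label \<sigma> (i # m) = \<sigma> [] i # new_label (\<lambda>u. \<sigma> (i # u)) m"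
  by (simp add: new_label_def upt_conv_Cons map_Suc_upt[symmetric] del: upt_Suc)

lemma inv_permutes_in:
  "\<pi> permutes {1..c} \<Longrightarrow> j \<in> {1..c::nat} \<Longrightarrow> inv \<pi> j \<in> {1..c}"
  using permutes_in_image[OF permutes_inv] by metis

lemma new_label_image_eq_node:
  assumes t: "t \<in> ltrees" and \<sigma>: "\<sigma> [] permutes {1..nchildren t []}"
  shows "new_label \<sigma> ` t = node (nchildren t [])
     (\<lambda>j. let i = inv (\<sigma> []) j in new_label (\<lambda>m. \<sigma> (i # m)) ` subtree t i)"
    (is "_ = node ?c ?f")
proof (rule ltree_eqI)
  show "[] \<in> new_label \<sigma> ` t \<longleftrightarrow> [] \<in> node ?c ?f"
    using Nil_in_ltrees[OF t] new_label_Nil by (metis Nil_in_node image_eqI)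
next
  fix j m
  show "j # m \<in> new_label \<sigma> ` t \<longleftrightarrow> j # m \<in> node ?c ?f"
  proof
    assume "j # m \<in> new_label \<sigma> ` t"
    then obtain u where u: "u \<in> t" "new_label \<sigma> u = j # m" by auto
    then obtain i v where v: "u = i # v" by (cases u) auto
    with u have j: "j = \<sigma> [] i" "m = new_label (\<lambda>u. \<sigma> (i # u)) v" by auto
    have "i \<in> {1..?c}" using u v t ltrees_ConsD by blast
    then have "j \<in> {1..?c}" using j permutes_in_image[OF \<sigma>] by blast
    moreover have "inv (\<sigma> []) j = i" using j \<sigma> by (simp add: permutes_inverses)
    ultimately show "j # m \<in> node ?c ?f" using u v j by (auto simp: Let_def)
  next
    assume "j # m \<in> node ?c ?f"
    then obtain v where v: "v \<in> subtree t (inv (\<sigma> []) j)"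
      "m = new_label (\<lambda>u. \<sigma> (inv (\<sigma> []) j # u)) v" by (auto simp: Let_def)
    then have "j # m = new_label \<sigma> (inv (\<sigma> []) j # v)" using \<sigma> by (simp add: permutes_inverses)
    moreover have "inv (\<sigma> []) j # v \<in> t" using v by simp
    ultimately show "j # m \<in> new_label \<sigma> ` t" by blast
  qed
qed

lemma new_label_image_in_ltrees:
  assumes "t \<in> ltrees" "\<And>m. \<sigma> m permutes {1..nchildren t m}"
  shows "new_label \<sigma> ` t \<in> ltrees"
  using assms
proof (coinduction arbitrary: t \<sigma> rule: ltrees_coinduct)
  case (node t \<sigma>)
  have "\<exists>t' \<sigma>'. new_label (\<lambda>m. \<sigma> (i # m)) ` subtree t i = new_label \<sigma>' ` t' \<and> t' \<in> ltrees \<and>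
      (\<forall>m. \<sigma>' m permutes {1..nchildren t' m})"
    if "j \<in> {1..nchildren t []}" and i: "i = inv (\<sigma> []) j" for i j
  proof -
    have "i \<in> {1..nchildren t []}" using inv_permutes_in[of "\<sigma> []"] node(2) that by blast
    then show ?thesis
      using node by (intro exI[of _ "subtree t i"] exI[of _ "\<lambda>m. \<sigma> (i # m)"])
        (auto simp: nchildren_subtree intro: subtree_in_ltrees)
  qed
  then show ?case
    using new_label_image_eq_node[of t \<sigma>] node unfolding Let_def by (intro exI conjI) auto
qed

lemma Cons_in_attach_iff:
  assumes "t \<in> ltrees"
  shows "i # u \<in> attach t K G \<longleftrightarrow> i # u \<in> t \<or>
     (\<exists>j\<in>{1..K []}. i = nchildren t [] + j \<and> u \<in> G ([], j)) \<or>
     (\<exists>m j v. i # m \<in> t \<and> j \<in> {1..K (i # m)} \<and> v \<in> G (i # m, j) \<and>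
        u = m @ [nchildren t (i # m) + j] @ v)" (is "?lhs \<longleftrightarrow> ?rhs")
proof
  assume ?lhs
  then consider (old) "i # u \<in> t" | (new) m j v where "i # u = m @ [nchildren t m + j] @ v"
    "m \<in> t" "j \<in> {1..K m}" "v \<in> G (m, j)" unfolding attach_def by auto
  then show ?rhs
  proof cases
    case (new m) then show ?thesis by (cases m) auto
  qed simp
next
  assume ?rhs
  then consider (old) "i # u \<in> t"
    | (at_root) j where "j \<in> {1..K []}" "i = nchildren t [] + j" "u \<in> G ([], j)"
    | (below) m j v where "i # m \<in> t" "j \<in> {1..K (i # m)}" "v \<in> G (i # m, j)"
      "u = m @ [nchildren t (i # m) + j] @ v" by blast
  then show ?lhs
  proof cases
    case old then show ?thesis by (simp add: attach_def)
  next
    case at_root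
    then have "i # u = [] @ [nchildren t [] + j] @ u" by simp
    then show ?thesis unfolding attach_def using at_root Nil_in_ltrees[OF assms] by blast
  next
    case below
    then have "i # u = (i # m) @ [nchildren t (i # m) + j] @ v" by simp
    then show ?thesis unfolding attach_def using below by blast
  qed
qed

lemma attach_eq_node:
  assumes t: "t \<in> ltrees"
  shows "attach t K G = node (nchildren t [] + K [])
    (\<lambda>i. if i \<le> nchildren t []
      then attach (subtree t i) (\<lambda>m. K (i # m)) (\<lambda>(m, j). G (i # m, j))
      else G ([], i - nchildren t []))" (is "_ = node ?c ?f")
proof (rule ltree_eqI)
  show "[] \<in> attach t K G \<longleftrightarrow> [] \<in> node ?c ?f"
    using Nil_in_ltrees[OF t] by (simp add: attach_def)
next
  fix i u
  let ?k = "nchildren t []"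
  show "i # u \<in> attach t K G \<longleftrightarrow> i # u \<in> node ?c ?f"
  proof (cases "i \<in> {1..?k}")
    case True
    then have "i # u \<in> node ?c ?f \<longleftrightarrow>
      u \<in> attach (subtree t i) (\<lambda>m. K (i # m)) (\<lambda>(m, j). G (i # m, j))" by auto
    also have "\<dots> \<longleftrightarrow> i # u \<in> attach t K G"
      unfolding Cons_in_attach_iff[OF t] using True by (auto simp: attach_def nchildren_subtree)
    finally show ?thesis by simp
  next
    case False
    then have "i # m \<notin> t" for m using ltrees_ConsD[OF t] by blast
    moreover have "(\<exists>j\<in>{1..K []}. i = ?k + j \<and> u \<in> G ([], j)) \<longleftrightarrow> i # u \<in> node ?c ?f"
      using False by (cases "i = 0") (auto intro!: bexI[of _ "i - ?k"])
    ultimately show ?thesis unfolding Cons_in_attach_iff[OF t] by blast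
  qed
qed

lemma attach_in_ltrees:
  assumes "t \<in> ltrees" "\<And>x. G x \<in> ltrees"
  shows "attach t K G \<in> ltrees"
  using assms
proof (coinduction arbitrary: t K G rule: ltrees_coinduct)
  case (node t K G)
  have "\<exists>t' K' G'. attach (subtree t i) (\<lambda>m. K (i # m)) (\<lambda>(m, j). G (i # m, j)) = attach t' K' G' \<and>
      t' \<in> ltrees \<and> (\<forall>x. G' x \<in> ltrees)" if "i \<in> {1..nchildren t []}" for i
    using node that
    by (intro exI[of _ "subtree t i"] exI[of _ "\<lambda>m. K (i # m)"]
        exI[of _ "\<lambda>(m, j). G (i # m, j)"]) (auto intro: subtree_in_ltrees)
  then show ?case using attach_eq_node[OF node(1)] node(2) by (intro exI conjI) auto
qed

section \<open>Independent blocks of coordinates in product measures\<close>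

lemma nn_integral_PiM_prod_blocks:
  fixes M :: "'i \<Rightarrow> 'a measure" and h :: "'j \<Rightarrow> ('i \<Rightarrow> 'a) \<Rightarrow> ennreal"
  assumes M: "\<And>i. prob_space (M i)" and J: "finite J" "disjoint_family_on K J"
    and h: "\<And>j. j \<in> J \<Longrightarrow> h j \<in> borel_measurable (PiM UNIV M)"
    and dep: "\<And>j \<omega> \<omega>'. j \<in> J \<Longrightarrow> \<omega> \<in> space (PiM UNIV M) \<Longrightarrow> \<omega>' \<in> space (PiM UNIV M) \<Longrightarrow>
      (\<And>i. i \<in> K j \<Longrightarrow> \<omega> i = \<omega>' i) \<Longrightarrow> h j \<omega> = h j \<omega>'"
  shows "(\<integral>\<^sup>+\<omega>. (\<Prod>j\<in>J. h j \<omega>) \<partial>PiM UNIV M) = (\<Prod>j\<in>J. \<integral>\<^sup>+\<omega>. h j \<omega> \<partial>PiM UNIV M)"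
proof -
  interpret P: prob_space "PiM UNIV M" by (rule prob_space_PiM) (rule M)
  obtain x0 where x0: "x0 \<in> space (PiM UNIV M)" using P.not_empty by blast
  define e where "e j y = (\<lambda>i. if i \<in> K j then y i else x0 i)" for j and y :: "'i \<Rightarrow> 'a"
  have e [measurable]: "e j \<in> PiM (K j) M \<rightarrow>\<^sub>M PiM UNIV M" for j
  proof (rule measurable_PiM_single')
    fix i
    have "x0 i \<in> space (M i)" using x0 by (auto simp: space_PiM PiE_def Pi_def)
    then show "(\<lambda>y. e j y i) \<in> PiM (K j) M \<rightarrow>\<^sub>M M i"
      by (cases "i \<in> K j") (auto simp: e_def)
  qed (use x0 in \<open>auto simp: e_def space_PiM PiE_def Pi_def extensional_def\<close>)
  have "P.indep_vars M (\<lambda>i \<omega>. \<omega> i) UNIV"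
    by (subst P.indep_vars_iff_distr_eq_PiM)
       (auto simp: distr_PiM_component M restrict_UNIV intro!: distr_id2 PiM_cong)
  then have "P.indep_vars (\<lambda>j. PiM (K j) M) (\<lambda>j \<omega>. restrict (\<lambda>i. \<omega> i) (K j)) J"
    by (rule P.indep_vars_restrict) (use J in auto)
  then have "P.indep_vars (\<lambda>_. borel) (\<lambda>j \<omega>. h j (e j (restrict \<omega> (K j)))) J"
    by (rule P.indep_vars_compose2) (use h e in \<open>auto intro: measurable_compose\<close>)
  then have "(\<integral>\<^sup>+\<omega>. (\<Prod>j\<in>J. h j (e j (restrict \<omega> (K j)))) \<partial>PiM UNIV M) =
     (\<Prod>j\<in>J. \<integral>\<^sup>+\<omega>. h j (e j (restrict \<omega> (K j))) \<partial>PiM UNIV M)"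
    by (intro P.indep_vars_nn_integral) (use J in auto)
  moreover have "h j (e j (restrict \<omega> (K j))) = h j \<omega>"
    if "j \<in> J" "\<omega> \<in> space (PiM UNIV M)" for j \<omega>
    using that x0 by (intro dep) (auto simp: e_def space_PiM PiE_def Pi_def)
  ultimately show ?thesis by (simp cong: nn_integral_cong prod.cong)
qed

lemma measurable_PiM_reindex: "(\<lambda>\<omega> k. \<omega> (f k)) \<in> PiM UNIV M \<rightarrow>\<^sub>M PiM UNIV (\<lambda>k. M (f k))"
  by (rule measurable_PiM_single') (auto simp: space_PiM PiE_def Pi_def)

lemma nn_integral_PiM_reindex:
  fixes M :: "'i \<Rightarrow> 'a measure" and f :: "'k \<Rightarrow> 'i"
  assumes M: "\<And>i. prob_space (M i)" and f: "inj f"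
    and h: "h \<in> borel_measurable (PiM UNIV (\<lambda>k. M (f k)))"
  shows "(\<integral>\<^sup>+\<omega>. h (\<lambda>k. \<omega> (f k)) \<partial>PiM UNIV M) = (\<integral>\<^sup>+\<omega>. h \<omega> \<partial>PiM UNIV (\<lambda>k. M (f k)))"
proof -
  let ?N = "PiM UNIV (\<lambda>k. M (f k))"
  have "distr (PiM UNIV M) ?N (\<lambda>\<omega>. \<lambda>n\<in>UNIV. \<omega> (f n)) = ?N"
    by (rule distr_PiM_reindex) (use M f in auto)
  then have "(\<integral>\<^sup>+\<omega>. h \<omega> \<partial>?N) = (\<integral>\<^sup>+\<omega>. h \<omega> \<partial>distr (PiM UNIV M) ?N (\<lambda>\<omega> n. \<omega> (f n)))"
    by (simp add: restrict_UNIV)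
  also have "\<dots> = (\<integral>\<^sup>+\<omega>. h (\<lambda>k. \<omega> (f k)) \<partial>PiM UNIV M)"
    using h by (intro nn_integral_distr measurable_PiM_reindex) simp
  finally show ?thesis by simp
qed

lemma nn_integral_PiM_component:
  assumes M: "\<And>i. prob_space (M i)" and h: "h \<in> borel_measurable (M i)"
  shows "(\<integral>\<^sup>+\<omega>. h (\<omega> i) \<partial>PiM UNIV M) = (\<integral>\<^sup>+x. h x \<partial>M i)"
  using nn_integral_distr[of "\<lambda>\<omega>. \<omega> i" "PiM UNIV M" "M i" h] distr_PiM_component[of UNIV M i] M h
  by simp

lemma nn_integral_PiM_prod_coords_reindex:
  fixes M :: "'i \<Rightarrow> 'a measure" and f :: "'j \<Rightarrow> 'k \<Rightarrow> 'i"
  assumes M: "\<And>i. prob_space (M i)" and fin: "finite A" "finite J"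
    and f: "\<And>j. inj (f j)" "\<And>j j'. j \<noteq> j' \<Longrightarrow> range (f j) \<inter> range (f j') = {}"
      "\<And>j. A \<inter> range (f j) = {}"
    and g: "\<And>i. i \<in> A \<Longrightarrow> g i \<in> borel_measurable (M i)"
    and h: "\<And>j. j \<in> J \<Longrightarrow> h j \<in> borel_measurable (PiM UNIV (\<lambda>k. M (f j k)))"
  shows "(\<integral>\<^sup>+\<omega>. (\<Prod>i\<in>A. g i (\<omega> i)) * (\<Prod>j\<in>J. h j (\<lambda>k. \<omega> (f j k))) \<partial>PiM UNIV M) =
    (\<Prod>i\<in>A. \<integral>\<^sup>+x. g i x \<partial>M i) * (\<Prod>j\<in>J. \<integral>\<^sup>+\<omega>. h j \<omega> \<partial>PiM UNIV (\<lambda>k. M (f j k)))"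
proof -
  define H where "H = case_sum (\<lambda>i \<omega>. g i (\<omega> i)) (\<lambda>j \<omega>. h j (\<lambda>k. \<omega> (f j k)))"
  define K where "K = case_sum (\<lambda>i. {i}) (\<lambda>j. range (f j))"
  have coord: "(\<lambda>\<omega>. g i (\<omega> i)) \<in> borel_measurable (PiM UNIV M)" if "i \<in> A" for i
    using g[OF that] by measurable
  have block: "(\<lambda>\<omega>. h j (\<lambda>k. \<omega> (f j k))) \<in> borel_measurable (PiM UNIV M)" if "j \<in> J" for j
    by (rule measurable_compose[OF measurable_PiM_reindex[of "f j"] h[OF that]])
  have "(\<integral>\<^sup>+\<omega>. (\<Prod>x\<in>A <+> J. H x \<omega>) \<partial>PiM UNIV M) = (\<Prod>x\<in>A <+> J. \<integral>\<^sup>+\<omega>. H x \<omega> \<partial>PiM UNIV M)"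
  proof (rule nn_integral_PiM_prod_blocks)
    show "disjoint_family_on K (A <+> J)"
      using f(2,3) by (fastforce simp: disjoint_family_on_def K_def)
    show "H x \<in> borel_measurable (PiM UNIV M)" if "x \<in> A <+> J" for x
      using that coord block by (auto simp: H_def)
    show "H x \<omega> = H x \<omega>'" if "\<And>i. i \<in> K x \<Longrightarrow> \<omega> i = \<omega>' i" for x \<omega> \<omega>'
      using that by (cases x) (auto simp: H_def K_def)
  qed (use M fin in auto)
  also have "\<dots> = (\<Prod>i\<in>A. \<integral>\<^sup>+\<omega>. H (Inl i) \<omega> \<partial>PiM UNIV M) * (\<Prod>j\<in>J. \<integral>\<^sup>+\<omega>. H (Inr j) \<omega> \<partial>PiM UNIV M)"
    using fin by (simp add: prod.Plus)
  also have "(\<Prod>i\<in>A. \<integral>\<^sup>+\<omega>. H (Inl i) \<omega> \<partial>PiM UNIV M) = (\<Prod>i\<in>A. \<integral>\<^sup>+x. g i x \<partial>M i)"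
    using nn_integral_PiM_component[of M, OF M g] by (simp add: H_def)
  also have "(\<Prod>j\<in>J. \<integral>\<^sup>+\<omega>. H (Inr j) \<omega> \<partial>PiM UNIV M) =
      (\<Prod>j\<in>J. \<integral>\<^sup>+\<omega>. h j \<omega> \<partial>PiM UNIV (\<lambda>k. M (f j k)))"
    using nn_integral_PiM_reindex[of M, OF M f(1) h] by (simp add: H_def)
  finally show ?thesis using fin by (simp add: prod.Plus H_def)
qed

section \<open>Measurability\<close>

lemma space_tree_space [simp]: "space tree_space = ltrees"
  unfolding tree_space_def by (rule space_measure_of) auto

lemma pred_mem_tree_space [measurable]: "Measurable.pred tree_space (\<lambda>t. m \<in> t)"
proof -
  have "{t \<in> ltrees. m \<in> t} \<in> sets tree_space"
    unfolding tree_space_def by (rule in_measure_of) auto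
  then show ?thesis by (simp add: pred_def)
qed

lemma measurable_tree_spaceI:
  assumes "\<And>x. x \<in> space M \<Longrightarrow> f x \<in> ltrees" "\<And>m. Measurable.pred M (\<lambda>x. m \<in> f x)"
  shows "f \<in> M \<rightarrow>\<^sub>M tree_space"
  unfolding tree_space_def
proof (rule measurable_measure_of)
  fix A assume "A \<in> {{t \<in> ltrees. m \<in> t} | m. True}"
  then obtain m where "A = {t \<in> ltrees. m \<in> t}" by blast
  then have "f -` A \<inter> space M = {x \<in> space M. m \<in> f x}" using assms(1) by auto
  then show "f -` A \<inter> space M \<in> sets M" using assms(2)[of m] by (simp add: pred_def)
qed (use assms in auto)

lemma pred_prune_eq [measurable]: "Measurable.pred tree_space (\<lambda>t. prune n t = x)"
proof -
  have "prune n t = x \<longleftrightarrow> (\<forall>m. (m \<in> x) = (m \<in> t \<and> length m \<le> n))" for t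
    by (auto simp: prune_def)
  then show ?thesis by (simp only:) measurable
qed

abbreviation cylinder :: "nat \<Rightarrow> ltree \<Rightarrow> ltree set" where
  "cylinder n x \<equiv> {t \<in> ltrees. prune n t = x}"

lemma sets_cylinder [measurable]: "cylinder n x \<in> sets tree_space"
  using pred_prune_eq[of n x] by (simp add: pred_def)

lemma measurable_prune: "prune n \<in> tree_space \<rightarrow>\<^sub>M count_space (ltrees_upto n)"
proof (subst measurable_count_space_eq_countable, simp, safe)
  fix x
  have "prune n -` {x} \<inter> space tree_space = cylinder n x" by auto
  then show "prune n -` {x} \<inter> space tree_space \<in> sets tree_space" by (simp add: sets_cylinder)
qed (auto intro: prune_in_ltrees_upto)

lemma measurable_prune_UNIV: "prune n \<in> tree_space \<rightarrow>\<^sub>M count_space UNIV"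
  by (rule measurable_compose[OF measurable_prune]) simp

lemma measurable_tree_of_offspring [measurable]:
  "tree_of_offspring \<in> (\<Pi>\<^sub>M m\<in>UNIV. measure_pmf (p m)) \<rightarrow>\<^sub>M tree_space"
proof (rule measurable_tree_spaceI)
  show "Measurable.pred (\<Pi>\<^sub>M m\<in>UNIV. measure_pmf (p m)) (\<lambda>\<omega>. m \<in> tree_of_offspring \<omega>)" for m
  proof (induction m rule: rev_induct)
    case Nil show ?case by (simp add: tree_of_offspring.root)
  next
    case (snoc i m)
    note [measurable] = snoc
    have [measurable]: "(\<lambda>\<omega>. \<omega> m) \<in> (\<Pi>\<^sub>M m\<in>UNIV. measure_pmf (p m)) \<rightarrow>\<^sub>M count_space UNIV"
      using measurable_component_singleton[of m UNIV "\<lambda>m. measure_pmf (p m)"] by simp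
    show ?case unfolding tree_of_offspring_snoc by measurable
  qed
qed (rule tree_of_offspring_in_ltrees)

lemma prob_space_GW: "prob_space (GW \<mu>)"
  unfolding GW_def
  by (intro prob_space.prob_space_distr prob_space_PiM prob_space_measure_pmf
      measurable_tree_of_offspring)

lemma sets_GW [simp, measurable_cong]: "sets (GW \<mu>) = sets tree_space"
  and space_GW [simp]: "space (GW \<mu>) = ltrees"
  by (simp_all add: GW_def)

lemma measurable_attach [measurable]:
  assumes "t \<in> ltrees"
  shows "(\<lambda>(K, G). attach t K G) \<in>
    (\<Pi>\<^sub>M m\<in>UNIV. measure_pmf p) \<Otimes>\<^sub>M (\<Pi>\<^sub>M mj\<in>UNIV. GW \<mu>) \<rightarrow>\<^sub>M tree_space"
    (is "_ \<in> ?A \<Otimes>\<^sub>M ?B \<rightarrow>\<^sub>M _")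
proof (rule measurable_tree_spaceI)
  fix x assume "x \<in> space (?A \<Otimes>\<^sub>M ?B)"
  then show "(case x of (K, G) \<Rightarrow> attach t K G) \<in> ltrees"
    using assms
    by (auto simp: space_pair_measure space_PiM PiE_def Pi_def intro!: attach_in_ltrees)
next
  fix x
  have [measurable]: "(\<lambda>\<omega>. fst \<omega> m) \<in> ?A \<Otimes>\<^sub>M ?B \<rightarrow>\<^sub>M count_space UNIV" for m
    using measurable_compose[OF measurable_fst
        measurable_component_singleton[of m UNIV "\<lambda>m. measure_pmf p"]] by simp
  have [measurable]: "Measurable.pred (?A \<Otimes>\<^sub>M ?B) (\<lambda>\<omega>. u \<in> snd \<omega> m)" for m u
    by (rule measurable_compose[OF _ pred_mem_tree_space]) measurable
  have "(case \<omega> of (K, G) \<Rightarrow> x \<in> attach t K G) \<longleftrightarrow>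
      x \<in> t \<or> (\<exists>m j u. x = m @ [nchildren t m + j] @ u \<and>
      m \<in> t \<and> j \<in> {1..fst \<omega> m} \<and> u \<in> snd \<omega> (m, j))" for \<omega>
    by (cases \<omega>) (auto simp: attach_def)
  moreover have "Measurable.pred (?A \<Otimes>\<^sub>M ?B)
    (\<lambda>\<omega>. x \<in> t \<or> (\<exists>m j u. x = m @ [nchildren t m + j] @ u \<and>
      m \<in> t \<and> j \<in> {1..fst \<omega> m} \<and> u \<in> snd \<omega> (m, j)))" by measurable
  ultimately show "Measurable.pred (?A \<Otimes>\<^sub>M ?B) (\<lambda>\<omega>. x \<in> (case \<omega> of (K, G) \<Rightarrow> attach t K G))"
    by (simp add: case_prod_unfold)
qed

abbreviation perms :: "nat \<Rightarrow> (nat \<Rightarrow> nat) set" where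
  "perms c \<equiv> {\<pi>. \<pi> permutes {1..c}}"

lemma finite_perms: "finite (perms c)" and perms_nonempty: "perms c \<noteq> {}"
  and card_perms: "card (perms c) = fact c"
proof -
  have "id \<in> perms c" by (simp add: permutes_id)
  then show "perms c \<noteq> {}" by blast
qed (use card_permutations[of "{1..c}" c] in \<open>auto simp: finite_permutations\<close>)

lemma measurable_new_label [measurable]:
  assumes t: "t \<in> ltrees"
  shows "(\<lambda>\<sigma>. new_label \<sigma> ` t) \<in>
    (\<Pi>\<^sub>M m\<in>UNIV. uniform_count_measure (perms (nchildren t m))) \<rightarrow>\<^sub>M tree_space"
    (is "_ \<in> ?A \<rightarrow>\<^sub>M _")
proof (rule measurable_tree_spaceI)
  fix \<sigma> assume "\<sigma> \<in> space ?A"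
  then show "new_label \<sigma> ` t \<in> ltrees"
    using t by (auto simp: space_PiM PiE_def Pi_def space_uniform_count_measure
        intro!: new_label_image_in_ltrees)
next
  fix y
  have [measurable]: "(\<lambda>\<sigma>. \<sigma> m i) \<in> ?A \<rightarrow>\<^sub>M count_space UNIV" for m i
  proof (rule measurable_compose[OF measurable_component_singleton])
    show "(\<lambda>\<pi>. \<pi> i) \<in> uniform_count_measure (perms (nchildren t m)) \<rightarrow>\<^sub>M count_space UNIV"
      by (auto simp: measurable_def sets_uniform_count_measure space_uniform_count_measure)
  qed simp
  have "new_label \<sigma> m = y \<longleftrightarrow>
      length y = length m \<and> (\<forall>k. k < length m \<longrightarrow> \<sigma> (take k m) (m ! k) = y ! k)" for \<sigma> m
    by (subst list_eq_iff_nth_eq) (auto simp: new_label_def)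
  then have "y \<in> new_label \<sigma> ` t \<longleftrightarrow> (\<exists>m. m \<in> t \<and> length y = length m \<and>
      (\<forall>k. k < length m \<longrightarrow> \<sigma> (take k m) (m ! k) = y ! k))" for \<sigma>
    unfolding image_iff Bex_def by metis
  then show "Measurable.pred ?A (\<lambda>\<sigma>. y \<in> new_label \<sigma> ` t)" by (simp only:) measurable
qed

section \<open>The pruned laws as recursively defined discrete distributions\<close>

definition node_pmf :: "nat \<Rightarrow> (nat \<Rightarrow> ltree pmf) \<Rightarrow> ltree pmf" where
  "node_pmf c P = map_pmf (node c) (Pi_pmf {1..c} {[]} P)"

definition shuffle_pmf :: "nat \<Rightarrow> (nat \<Rightarrow> ltree pmf) \<Rightarrow> ltree pmf" where
  "shuffle_pmf c P = pmf_of_set (perms c) \<bind> (\<lambda>\<pi>. node_pmf c (\<lambda>j. P (inv \<pi> j)))"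

primrec GW_pmf :: "real \<Rightarrow> nat \<Rightarrow> ltree pmf" where
  "GW_pmf \<mu> 0 = return_pmf {[]}"
| "GW_pmf \<mu> (Suc n) = Poisson \<mu> \<bind> (\<lambda>c. node_pmf c (\<lambda>_. GW_pmf \<mu> n))"

primrec augmentation_pmf :: "real \<Rightarrow> real \<Rightarrow> nat \<Rightarrow> ltree \<Rightarrow> ltree pmf" where
  "augmentation_pmf lam s 0 t = return_pmf {[]}"
| "augmentation_pmf lam s (Suc n) t = Poisson (lam * (1 - s)) \<bind> (\<lambda>a.
     node_pmf (nchildren t [] + a)
       (\<lambda>i. if i \<le> nchildren t [] then augmentation_pmf lam s n (subtree t i)
            else GW_pmf lam n))"

primrec relabeling_pmf :: "nat \<Rightarrow> ltree \<Rightarrow> ltree pmf" where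
  "relabeling_pmf 0 t = return_pmf {[]}"
| "relabeling_pmf (Suc n) t =
     shuffle_pmf (nchildren t []) (\<lambda>i. relabeling_pmf n (subtree t i))"

lemma set_Pi_pmf_in:
  "F \<in> set_pmf (Pi_pmf A d P) \<Longrightarrow> finite A \<Longrightarrow> i \<in> A \<Longrightarrow> F i \<in> set_pmf (P i)"
  by (auto simp: set_Pi_pmf PiE_dflt_def)

lemma set_pmf_of_perms [simp]: "set_pmf (pmf_of_set (perms c)) = perms c"
  by (rule set_pmf_of_set) (rule perms_nonempty, rule finite_perms)

lemma node_pmf_cong: "(\<And>i. i \<in> {1..c} \<Longrightarrow> P i = Q i) \<Longrightarrow> node_pmf c P = node_pmf c Q"
  unfolding node_pmf_def by (intro arg_cong[where f = "map_pmf _"] Pi_pmf_cong) auto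

lemma shuffle_pmf_cong: "(\<And>i. i \<in> {1..c} \<Longrightarrow> P i = Q i) \<Longrightarrow> shuffle_pmf c P = shuffle_pmf c Q"
  unfolding shuffle_pmf_def
  by (intro bind_pmf_cong refl node_pmf_cong) (use inv_permutes_in in auto)

lemma set_node_pmfE:
  assumes "x \<in> set_pmf (node_pmf c P)"
  obtains F where "x = node c F" "\<And>i. i \<in> {1..c} \<Longrightarrow> F i \<in> set_pmf (P i)"
proof -
  from assms obtain F where "F \<in> set_pmf (Pi_pmf {1..c} {[]} P)" "x = node c F"
    by (auto simp: node_pmf_def)
  then show ?thesis by (intro that[of F]) (auto intro: set_Pi_pmf_in)
qed

lemma set_shuffle_pmfE:
  assumes "x \<in> set_pmf (shuffle_pmf c P)"
  obtains \<pi> F where "\<pi> permutes {1..c}" "x = node c (\<lambda>j. F (inv \<pi> j))"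
    "\<And>i. i \<in> {1..c} \<Longrightarrow> F i \<in> set_pmf (P i)"
proof -
  from assms obtain \<pi> where \<pi>: "\<pi> permutes {1..c}"
    and x: "x \<in> set_pmf (node_pmf c (\<lambda>j. P (inv \<pi> j)))" by (auto simp: shuffle_pmf_def)
  from x obtain F where F: "x = node c F" "\<And>j. j \<in> {1..c} \<Longrightarrow> F j \<in> set_pmf (P (inv \<pi> j))"
    by (rule set_node_pmfE) blast
  show ?thesis
  proof (rule that[OF \<pi>])
    show "x = node c (\<lambda>j. (F \<circ> \<pi>) (inv \<pi> j))" using F(1) \<pi> by (simp add: permutes_inverses)
    show "(F \<circ> \<pi>) i \<in> set_pmf (P i)" if "i \<in> {1..c}" for i
    proof -
      have "\<pi> i \<in> {1..c}" using \<pi> that by (simp only: permutes_in_image)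
      then show ?thesis using F(2)[of "\<pi> i"] \<pi> by (simp add: permutes_inverses)
    qed
  qed
qed

lemma set_node_pmf_subset:
  assumes "\<And>i. i \<in> {1..c} \<Longrightarrow> set_pmf (P i) \<subseteq> ltrees_upto n"
  shows "set_pmf (node_pmf c P) \<subseteq> ltrees_upto (Suc n)"
proof
  fix x assume "x \<in> set_pmf (node_pmf c P)"
  then obtain F where F: "x = node c F" "\<And>i. i \<in> {1..c} \<Longrightarrow> F i \<in> set_pmf (P i)"
    by (rule set_node_pmfE) blast
  show "x \<in> ltrees_upto (Suc n)"
    unfolding F(1) by (rule node_in_ltrees_upto) (use F(2) assms in blast)
qed

lemma set_shuffle_pmf_subset:
  assumes "\<And>i. i \<in> {1..c} \<Longrightarrow> set_pmf (P i) \<subseteq> ltrees_upto n"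
  shows "set_pmf (shuffle_pmf c P) \<subseteq> ltrees_upto (Suc n)"
  using assms set_node_pmf_subset[OF assms[OF inv_permutes_in]]
  by (fastforce simp: shuffle_pmf_def)

lemma set_GW_pmf: "set_pmf (GW_pmf \<mu> n) \<subseteq> ltrees_upto n"
proof (induction n)
  case (Suc n)
  then show ?case using set_node_pmf_subset[of _ "\<lambda>_. GW_pmf \<mu> n" n] by auto
qed (simp add: ltrees_upto_0)

lemma set_augmentation_pmf: "set_pmf (augmentation_pmf lam s n t) \<subseteq> ltrees_upto n"
proof (induction n arbitrary: t)
  case (Suc n)
  have "set_pmf (node_pmf (nchildren t [] + a) (\<lambda>i. if i \<le> nchildren t []
      then augmentation_pmf lam s n (subtree t i) else GW_pmf lam n)) \<subseteq> ltrees_upto (Suc n)" for a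
    by (rule set_node_pmf_subset) (use Suc.IH set_GW_pmf in auto)
  then show ?case by auto
qed (simp add: ltrees_upto_0)

lemma set_relabeling_pmf: "set_pmf (relabeling_pmf n t) \<subseteq> ltrees_upto n"
proof (induction n arbitrary: t)
  case (Suc n)
  show ?case unfolding relabeling_pmf.simps by (rule set_shuffle_pmf_subset) (rule Suc.IH)
qed (simp add: ltrees_upto_0)

lemma pmf_eq_0_outside: "set_pmf p \<subseteq> A \<Longrightarrow> x \<notin> A \<Longrightarrow> pmf p x = 0"
  by (auto simp: set_pmf_eq)

lemma pmf_node_pmf:
  assumes P: "\<And>i. i \<in> {1..c} \<Longrightarrow> set_pmf (P i) \<subseteq> ltrees_upto n"
    and f: "\<And>i. i \<in> {1..c'} \<Longrightarrow> f i \<in> ltrees_upto n"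
  shows "pmf (node_pmf c P) (node c' f) = (if c = c' then \<Prod>i\<in>{1..c}. pmf (P i) (f i) else 0)"
proof -
  let ?Pi = "Pi_pmf {1..c} {[]} P"
  have eq: "node c F = node c' f \<longleftrightarrow> c = c' \<and> F \<in> Pi {1..c} (\<lambda>i. {f i})"
    if "F \<in> set_pmf ?Pi" for F
    using P set_Pi_pmf_in[OF that] f
    by (subst node_eq_iff) (auto simp: Pi_def intro!: Nil_in_ltrees_upto)
  have "pmf (node_pmf c P) (node c' f) = measure_pmf.prob ?Pi (node c -` {node c' f})"
    unfolding node_pmf_def by (rule pmf_map)
  also have "\<dots> = measure_pmf.prob ?Pi {F. c = c' \<and> F \<in> Pi {1..c} (\<lambda>i. {f i})}"
    by (rule measure_pmf.finite_measure_eq_AE) (use eq in \<open>auto simp: AE_measure_pmf_iff\<close>)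
  also have "\<dots> = (if c = c' then \<Prod>i\<in>{1..c}. pmf (P i) (f i) else 0)"
    by (simp add: measure_Pi_pmf_Pi measure_pmf_single)
  finally show ?thesis .
qed

lemma pmf_bind_single:
  assumes "\<And>b. b \<noteq> a \<Longrightarrow> pmf (f b) y = 0"
  shows "pmf (p \<bind> f) y = pmf p a * pmf (f a) y"
proof -
  have "pmf (p \<bind> f) y = (\<integral>b. pmf (f a) y * indicator {a} b \<partial>p)"
    unfolding pmf_bind using assms
    by (intro Bochner_Integration.integral_cong) (auto simp: indicator_def)
  then show ?thesis by (simp add: measure_pmf_single)
qed

lemma pmf_GW_pmf_node:
  assumes "\<And>i. i \<in> {1..c} \<Longrightarrow> f i \<in> ltrees_upto n"
  shows "pmf (GW_pmf \<mu> (Suc n)) (node c f) =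
    pmf (Poisson \<mu>) c * (\<Prod>i\<in>{1..c}. pmf (GW_pmf \<mu> n) (f i))"
proof -
  have node: "pmf (node_pmf b (\<lambda>_. GW_pmf \<mu> n)) (node c f) =
      (if b = c then \<Prod>i\<in>{1..c}. pmf (GW_pmf \<mu> n) (f i) else 0)" for b
    using pmf_node_pmf[of b "\<lambda>_. GW_pmf \<mu> n" n c f] set_GW_pmf assms by auto
  then show ?thesis by (simp add: pmf_bind_single[where a = c])
qed

lemma prod_atLeast1_add:
  "(\<Prod>i\<in>{1..k + a}. g i) = (\<Prod>i\<in>{1..k}. g i) * (\<Prod>j\<in>{1..a}. g (k + j))"
  for g :: "nat \<Rightarrow> 'a :: comm_monoid_mult"
proof -
  have "(\<Prod>i\<in>{1..k + a}. g i) = (\<Prod>i\<in>{1..k}. g i) * (\<Prod>i\<in>{1 + k..a + k}. g i)"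
    by (subst prod.union_disjoint[symmetric]) (auto intro!: prod.cong)
  then show ?thesis unfolding prod.shift_bounds_cl_nat_ivl by (simp add: add.commute)
qed

lemma pmf_augmentation_pmf_node:
  assumes "\<And>i. i \<in> {1..nchildren t [] + a} \<Longrightarrow> f i \<in> ltrees_upto n"
  shows "pmf (augmentation_pmf lam s (Suc n) t) (node (nchildren t [] + a) f) =
    pmf (Poisson (lam * (1 - s))) a *
    ((\<Prod>i\<in>{1..nchildren t []}. pmf (augmentation_pmf lam s n (subtree t i)) (f i)) *
     (\<Prod>j\<in>{1..a}. pmf (GW_pmf lam n) (f (nchildren t [] + j))))"
proof -
  let ?k = "nchildren t []"
  let ?P = "\<lambda>i. if i \<le> ?k then augmentation_pmf lam s n (subtree t i) else GW_pmf lam n"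
  have "pmf (node_pmf (?k + b) ?P) (node (?k + a) f) =
      (if b = a then \<Prod>i\<in>{1..?k + a}. pmf (?P i) (f i) else 0)" for b
    using pmf_node_pmf[of "?k + b" ?P n "?k + a" f] set_GW_pmf set_augmentation_pmf assms by auto
  then have "pmf (augmentation_pmf lam s (Suc n) t) (node (?k + a) f) =
      pmf (Poisson (lam * (1 - s))) a * (\<Prod>i\<in>{1..?k + a}. pmf (?P i) (f i))"
    by (simp add: pmf_bind_single[where a = a])
  then show ?thesis by (simp add: prod_atLeast1_add)
qed

lemma augmentation_pmf_degree_ge:
  assumes "c < nchildren t []" "\<And>i. f i \<in> ltrees_upto n"
  shows "pmf (augmentation_pmf lam s (Suc n) t) (node c f) = 0"
proof -
  let ?k = "nchildren t []"
  have "pmf (node_pmf (?k + b) (\<lambda>i. if i \<le> ?k then augmentation_pmf lam s n (subtree t i)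
      else GW_pmf lam n)) (node c f) = 0" for b
    by (subst pmf_node_pmf[where n = n]) (use assms set_GW_pmf set_augmentation_pmf in auto)
  then show ?thesis by (simp add: pmf_bind)
qed

lemma pmf_shuffle_pmf:
  assumes P: "\<And>i. i \<in> {1..c} \<Longrightarrow> set_pmf (P i) \<subseteq> ltrees_upto n"
    and f: "\<And>i. i \<in> {1..c'} \<Longrightarrow> f i \<in> ltrees_upto n"
  shows "pmf (shuffle_pmf c P) (node c' f) =
    (if c = c' then (\<Sum>\<pi>\<in>perms c. \<Prod>i\<in>{1..c}. pmf (P i) (f (\<pi> i))) / fact c else 0)"
proof -
  have "pmf (node_pmf c (\<lambda>j. P (inv \<pi> j))) (node c' f) =
      (if c = c' then \<Prod>i\<in>{1..c}. pmf (P i) (f (\<pi> i)) else 0)" if \<pi>: "\<pi> permutes {1..c}" for \<pi>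
  proof -
    have "(\<Prod>j\<in>{1..c}. pmf (P (inv \<pi> j)) (f j)) = (\<Prod>i\<in>{1..c}. pmf (P i) (f (\<pi> i)))"
      using prod.permute[OF \<pi>, of "\<lambda>j. pmf (P (inv \<pi> j)) (f j)"] \<pi>
      by (simp add: permutes_inverses)
    then show ?thesis by (subst pmf_node_pmf[OF P[OF inv_permutes_in[OF \<pi>]] f]) auto
  qed
  then show ?thesis
    unfolding shuffle_pmf_def
    by (simp add: pmf_bind_pmf_of_set[OF perms_nonempty finite_perms] card_perms)
qed

lemma augmentation_pmf_prune:
  "t \<in> ltrees \<Longrightarrow> augmentation_pmf lam s n (prune n t) = augmentation_pmf lam s n t"
proof (induction n arbitrary: t)
  case (Suc n)
  show ?case
    unfolding augmentation_pmf.simps nchildren_prune subtree_prune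
    using Suc.IH[OF subtree_in_ltrees[OF Suc.prems]]
    by (intro bind_pmf_cong refl node_pmf_cong) auto
qed simp

lemma relabeling_pmf_prune: "t \<in> ltrees \<Longrightarrow> relabeling_pmf n (prune n t) = relabeling_pmf n t"
proof (induction n arbitrary: t)
  case (Suc n)
  show ?case
    unfolding relabeling_pmf.simps nchildren_prune subtree_prune
    using Suc.IH[OF subtree_in_ltrees[OF Suc.prems]] by (intro shuffle_pmf_cong) auto
qed simp

section \<open>Probabilities of cylinders\<close>

lemma prod_indicator:
  "finite A \<Longrightarrow>
    (\<Prod>i\<in>A. indicator (B i) (g i)) = (if \<forall>i\<in>A. g i \<in> B i then 1 else 0 :: 'a :: comm_semiring_1)"
  by (induction A rule: finite_induct) (auto simp: indicator_def)

lemma node_in_cylinder_iff: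
  assumes g: "\<And>i. i \<in> {1..c} \<Longrightarrow> g i \<in> ltrees" and f: "\<And>i. i \<in> {1..c'} \<Longrightarrow> [] \<in> f i"
  shows "node c g \<in> cylinder (Suc n) (node c' f) \<longleftrightarrow> c = c' \<and> (\<forall>i\<in>{1..c}. g i \<in> cylinder n (f i))"
proof -
  have "node c (\<lambda>i. prune n (g i)) = node c' f \<longleftrightarrow> c = c' \<and> (\<forall>i\<in>{1..c}. prune n (g i) = f i)"
    using Nil_in_ltrees[OF g] f by (subst node_eq_iff) simp_all
  then show ?thesis using g node_in_ltrees[of c g] by (auto simp: prune_node)
qed

lemma emeasure_distr_eq_nn_integral:
  assumes "f \<in> M \<rightarrow>\<^sub>M N" "A \<in> sets N"
  shows "emeasure (distr M N f) A = (\<integral>\<^sup>+x. indicator A (f x) \<partial>M)"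
  using assms nn_integral_distr[of f M N "indicator A"] by simp

lemma emeasure_cylinder_0:
  assumes "prob_space M" "sets M = sets tree_space"
  shows "emeasure M (cylinder 0 x) = ennreal (pmf (return_pmf {[]}) x)"
proof -
  have "emeasure M ltrees = 1"
    using prob_space.emeasure_space_1[OF assms(1)] sets_eq_imp_space_eq[OF assms(2)] by simp
  moreover have "cylinder 0 x = (if x = {[]} then ltrees else {})"
    by (auto simp: prune_0 Nil_in_ltrees)
  ultimately show ?thesis by simp
qed

lemma emeasure_cylinder_SucI:
  assumes "set_pmf p \<subseteq> ltrees_upto (Suc n)"
    and "\<And>c f. (\<And>i. f i \<in> ltrees_upto n) \<Longrightarrow>
      emeasure M (cylinder (Suc n) (node c f)) = ennreal (pmf p (node c f))"
  shows "emeasure M (cylinder (Suc n) x) = ennreal (pmf p x)"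
proof (cases "x \<in> ltrees_upto (Suc n)")
  case True
  then show ?thesis using assms(2) by (metis ltrees_upto_SucE)
next
  case False
  then have "cylinder (Suc n) x = {}" using prune_in_ltrees_upto by blast
  then show ?thesis by (simp only: emeasure_empty pmf_eq_0_outside[OF assms(1) False] ennreal_0)
qed

subsection \<open>Galton--Watson trees\<close>

lemma tree_of_offspring_in_cylinder_iff:
  assumes "\<And>i. i \<in> {1..c} \<Longrightarrow> [] \<in> f i"
  shows "tree_of_offspring \<omega> \<in> cylinder (Suc n) (node c f) \<longleftrightarrow>
    \<omega> [] = c \<and> (\<forall>i\<in>{1..c}. tree_of_offspring (\<lambda>m. \<omega> (i # m)) \<in> cylinder n (f i))"
  by (subst tree_of_offspring_eq_node, subst node_in_cylinder_iff)
     (use assms tree_of_offspring_in_ltrees in auto)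

lemma emeasure_GW_cylinder_node:
  assumes "\<And>i. i \<in> {1..c} \<Longrightarrow> [] \<in> f i"
  shows "emeasure (GW \<mu>) (cylinder (Suc n) (node c f)) =
    ennreal (pmf (Poisson \<mu>) c) * (\<Prod>i\<in>{1..c}. emeasure (GW \<mu>) (cylinder n (f i)))"
proof -
  let ?P = "\<Pi>\<^sub>M m\<in>(UNIV :: nat list set). measure_pmf (Poisson \<mu>)"
  have cyl: "emeasure (GW \<mu>) (cylinder m x) =
      (\<integral>\<^sup>+\<omega>. indicator (cylinder m x) (tree_of_offspring \<omega>) \<partial>?P)" for m x
    unfolding GW_def by (rule emeasure_distr_eq_nn_integral) measurable
  have in_cylinder: "tree_of_offspring \<omega> \<in> cylinder (Suc n) (node c f) \<longleftrightarrow>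
      \<omega> [] = c \<and> (\<forall>i\<in>{1..c}. tree_of_offspring (\<lambda>m. \<omega> (i # m)) \<in> cylinder n (f i))" for \<omega>
    by (rule tree_of_offspring_in_cylinder_iff[OF assms])
  have "emeasure (GW \<mu>) (cylinder (Suc n) (node c f)) =
    (\<integral>\<^sup>+\<omega>. (\<Prod>m\<in>{[]}. indicator {c} (\<omega> m)) *
      (\<Prod>i\<in>{1..c}. indicator (cylinder n (f i)) (tree_of_offspring (\<lambda>m. \<omega> (i # m)))) \<partial>?P)"
    unfolding cyl indicator_def[of "cylinder (Suc n) (node c f)"] in_cylinder
    by (intro nn_integral_cong)
       (simp add: prod_indicator indicator_def[of "{c}"] del: mem_Collect_eq)
  also have "\<dots> = (\<Prod>m\<in>{[] :: nat list}. \<integral>\<^sup>+k. indicator {c} k \<partial>Poisson \<mu>) *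
    (\<Prod>i\<in>{1..c}. \<integral>\<^sup>+\<omega>. indicator (cylinder n (f i)) (tree_of_offspring \<omega>) \<partial>?P)"
    by (intro nn_integral_PiM_prod_coords_reindex[where f = "\<lambda>i m. i # m"])
       (auto simp: prob_space_measure_pmf inj_def)
  also have "\<dots> = ennreal (pmf (Poisson \<mu>) c) *
      (\<Prod>i\<in>{1..c}. emeasure (GW \<mu>) (cylinder n (f i)))"
    unfolding cyl by (simp add: emeasure_pmf_single)
  finally show ?thesis .
qed

lemma emeasure_GW_cylinder: "emeasure (GW \<mu>) (cylinder n x) = ennreal (pmf (GW_pmf \<mu> n) x)"
proof (induction n arbitrary: x)
  case 0
  show ?case unfolding GW_pmf.simps by (intro emeasure_cylinder_0 prob_space_GW sets_GW)
next
  case (Suc n)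
  show ?case
  proof (rule emeasure_cylinder_SucI[OF set_GW_pmf])
    fix c and f :: "nat \<Rightarrow> ltree" assume f: "\<And>i. f i \<in> ltrees_upto n"
    show "emeasure (GW \<mu>) (cylinder (Suc n) (node c f)) = pmf (GW_pmf \<mu> (Suc n)) (node c f)"
      unfolding pmf_GW_pmf_node[OF f]
      by (subst emeasure_GW_cylinder_node)
         (auto simp: Suc prod_ennreal ennreal_mult' prod_nonneg Nil_in_ltrees_upto[OF f])
  qed
qed

subsection \<open>Augmentations\<close>

lemma sets_augmentation [simp, measurable_cong]:
  "sets (augmentation lam s t) = sets tree_space"
  by (simp add: augmentation_def)

lemma prob_space_augmentation: "t \<in> ltrees \<Longrightarrow> prob_space (augmentation lam s t)"
  unfolding augmentation_def
  by (intro prob_space.prob_space_distr prob_space_pair prob_space_PiM prob_space_measure_pmf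
      prob_space_GW measurable_attach)

abbreviation new_degrees :: "real \<Rightarrow> (nat list \<Rightarrow> nat) measure" where
  "new_degrees \<nu> \<equiv> \<Pi>\<^sub>M m\<in>UNIV. measure_pmf (Poisson \<nu>)"

abbreviation grafts :: "real \<Rightarrow> (nat list \<times> nat \<Rightarrow> ltree) measure" where
  "grafts lam \<equiv> \<Pi>\<^sub>M mj\<in>UNIV. GW lam"

lemma grafts_in_ltrees: "G \<in> space (grafts lam) \<Longrightarrow> G y \<in> ltrees"
  by (cases y) (auto simp: space_PiM PiE_def Pi_def)

lemma measurable_attach_graft:
  assumes "t \<in> ltrees" shows "attach t K \<in> grafts lam \<rightarrow>\<^sub>M tree_space"
  using measurable_compose[OF measurable_Pair1' measurable_attach[OF assms, of "Poisson 0" lam],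
      of K]
  by (simp add: space_PiM)

lemma measurable_attach_degrees:
  assumes "t \<in> ltrees" "C \<in> sets tree_space"
  shows "(\<lambda>K. \<integral>\<^sup>+G. indicator C (attach t K G) \<partial>grafts lam) \<in> borel_measurable (new_degrees \<nu>)"
proof -
  interpret prob_space "grafts lam" by (intro prob_space_PiM prob_space_GW)
  note [measurable] = assms(2) measurable_attach[OF assms(1)]
  have "(\<lambda>K. \<integral>\<^sup>+G. indicator C (case (K, G) of (K, G) \<Rightarrow> attach t K G) \<partial>grafts lam)
      \<in> borel_measurable (new_degrees \<nu>)" by measurable
  then show ?thesis by simp
qed

lemma emeasure_augmentation:
  assumes "t \<in> ltrees" "C \<in> sets tree_space"
  shows "emeasure (augmentation lam s t) C =
    (\<integral>\<^sup>+K. \<integral>\<^sup>+G. indicator C (attach t K G) \<partial>grafts lam \<partial>new_degrees (lam * (1 - s)))"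
proof -
  interpret B: prob_space "grafts lam" by (intro prob_space_PiM prob_space_GW)
  note [measurable] = assms(2) measurable_attach[OF assms(1)]
  have "emeasure (augmentation lam s t) C =
    (\<integral>\<^sup>+y. indicator C (case y of (K, G) \<Rightarrow> attach t K G)
      \<partial>(new_degrees (lam * (1 - s)) \<Otimes>\<^sub>M grafts lam))"
    unfolding augmentation_def by (rule emeasure_distr_eq_nn_integral) measurable
  also have "\<dots> = (\<integral>\<^sup>+K. \<integral>\<^sup>+G. indicator C (case (K, G) of (K, G) \<Rightarrow> attach t K G)
      \<partial>grafts lam \<partial>new_degrees (lam * (1 - s)))"
    by (rule B.nn_integral_fst[symmetric]) measurable
  finally show ?thesis by simp
qed

lemma attach_in_cylinder_iff:
  assumes t: "t \<in> ltrees" and G: "\<And>y. G y \<in> ltrees" and f: "\<And>i. i \<in> {1..c} \<Longrightarrow> [] \<in> f i"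
  shows "attach t K G \<in> cylinder (Suc n) (node c f) \<longleftrightarrow> nchildren t [] + K [] = c \<and>
    (\<forall>i\<in>{1..c}. (if i \<le> nchildren t []
       then attach (subtree t i) (\<lambda>m. K (i # m)) (\<lambda>(m, j). G (i # m, j))
       else G ([], i - nchildren t [])) \<in> cylinder n (f i))"
proof -
  let ?k = "nchildren t []"
  have child: "(if i \<le> ?k then attach (subtree t i) (\<lambda>m. K (i # m)) (\<lambda>(m, j). G (i # m, j))
      else G ([], i - ?k)) \<in> ltrees" if "i \<in> {1..?k + K []}" for i
    using that G by (auto intro!: attach_in_ltrees subtree_in_ltrees t)
  show ?thesis
    unfolding attach_eq_node[OF t] by (subst node_in_cylinder_iff[OF child f]) auto
qed

lemma ball_atLeast1_add:
  "(\<forall>i\<in>{1..k + a :: nat}. Q i) \<longleftrightarrow> (\<forall>j\<in>{1..a}. Q (k + j)) \<and> (\<forall>i\<in>{1..k}. Q i)"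
proof -
  have "{1..k + a} = {1..k} \<union> (+) k ` {1..a}" by (auto simp: image_iff)
  then show ?thesis unfolding \<open>{1..k + a} = _\<close> ball_Un by blast
qed

lemma nn_integral_attach_cylinder:
  assumes t: "t \<in> ltrees" and f: "\<And>i. i \<in> {1..nchildren t [] + a} \<Longrightarrow> [] \<in> f i"
  shows "(\<integral>\<^sup>+G. indicator (cylinder (Suc n) (node (nchildren t [] + a) f)) (attach t K G)
      \<partial>grafts lam) =
    (\<Prod>j\<in>{1..a}. emeasure (GW lam) (cylinder n (f (nchildren t [] + j)))) *
      (indicator {a} (K []) *
       (\<Prod>i\<in>{1..nchildren t []}. \<integral>\<^sup>+G. indicator (cylinder n (f i))
          (attach (subtree t i) (\<lambda>m. K (i # m)) G) \<partial>grafts lam))"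
proof -
  let ?k = "nchildren t []"
  let ?old = "\<lambda>i G.
      indicator (cylinder n (f i)) (attach (subtree t i) (\<lambda>m. K (i # m)) G) :: ennreal"
  let ?new = "\<lambda>y x. indicator (cylinder n (f (?k + snd y))) x :: ennreal"
  let ?ys = "Pair [] ` {1..a} :: (nat list \<times> nat) set"
  have prod_ys: "(\<Prod>y\<in>?ys. g y) = (\<Prod>j\<in>{1..a}. g ([], j))" for g :: "_ \<Rightarrow> ennreal"
    by (subst prod.reindex) (auto simp: inj_on_def)
  have old: "?old i \<in> borel_measurable (grafts lam)" if "i \<in> {1..?k}" for i
    using measurable_attach_graft[OF subtree_in_ltrees[OF t that]] by measurable
  have split: "indicator (cylinder (Suc n) (node (?k + a) f)) (attach t K G) =
      indicator {a} (K []) * ((\<Prod>y\<in>?ys. ?new y (G y)) *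
        (\<Prod>i\<in>{1..?k}. ?old i (\<lambda>(m, j). G (i # m, j))))" if "G \<in> space (grafts lam)" for G
  proof -
    have "attach t K G \<in> cylinder (Suc n) (node (?k + a) f) \<longleftrightarrow> K [] = a \<and>
        (\<forall>j\<in>{1..a}. G ([], j) \<in> cylinder n (f (?k + j))) \<and>
        (\<forall>i\<in>{1..?k}. attach (subtree t i) (\<lambda>m. K (i # m)) (\<lambda>(m, j). G (i # m, j))
          \<in> cylinder n (f i))"
      by (subst attach_in_cylinder_iff[OF t grafts_in_ltrees[OF that] f])
         (simp_all add: ball_atLeast1_add del: mem_Collect_eq)
    then show ?thesis
      unfolding indicator_def[of "cylinder (Suc n) _"] prod_ys
      by (simp add: prod_indicator indicator_def[of "{a}"] del: mem_Collect_eq)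
  qed
  have "(\<integral>\<^sup>+G. (\<Prod>y\<in>?ys. ?new y (G y)) * (\<Prod>i\<in>{1..?k}. ?old i (\<lambda>(m, j). G (i # m, j))) \<partial>grafts lam) =
    (\<Prod>y\<in>?ys. \<integral>\<^sup>+x. ?new y x \<partial>GW lam) * (\<Prod>i\<in>{1..?k}. \<integral>\<^sup>+G. ?old i G \<partial>grafts lam)"
    using nn_integral_PiM_prod_coords_reindex[where M = "\<lambda>_. GW lam" and A = ?ys and J = "{1..?k}"
        and f = "\<lambda>i (m, j). (i # m, j)" and g = ?new and h = ?old] old
    by (auto simp: prob_space_GW inj_def case_prod_unfold)
  then show ?thesis
    by (simp add: split prod_ys cong: nn_integral_cong) (simp add: indicator_def)
qed

lemma emeasure_augmentation_cylinder_node: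
  assumes t: "t \<in> ltrees" and f: "\<And>i. i \<in> {1..nchildren t [] + a} \<Longrightarrow> [] \<in> f i"
  shows "emeasure (augmentation lam s t) (cylinder (Suc n) (node (nchildren t [] + a) f)) =
    ennreal (pmf (Poisson (lam * (1 - s))) a) *
    ((\<Prod>j\<in>{1..a}. emeasure (GW lam) (cylinder n (f (nchildren t [] + j)))) *
     (\<Prod>i\<in>{1..nchildren t []}. emeasure (augmentation lam s (subtree t i)) (cylinder n (f i))))"
proof -
  let ?k = "nchildren t []" and ?D = "new_degrees (lam * (1 - s))"
  let ?new = "\<Prod>j\<in>{1..a}. emeasure (GW lam) (cylinder n (f (?k + j)))"
  let ?\<Phi> = "\<lambda>i K. \<integral>\<^sup>+G. indicator (cylinder n (f i)) (attach (subtree t i) K G) \<partial>grafts lam"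
  have meas: "?\<Phi> i \<in> borel_measurable ?D" if "i \<in> {1..?k}" for i
    by (rule measurable_attach_degrees[OF subtree_in_ltrees[OF t that] sets_cylinder])
  have reindex: "(\<lambda>K. ?\<Phi> i (\<lambda>m. K (i # m))) \<in> borel_measurable ?D" if "i \<in> {1..?k}" for i
    by (rule measurable_compose[OF measurable_PiM_reindex[of "(#) i"
          "\<lambda>_. measure_pmf (Poisson (lam * (1 - s)))"] meas[OF that]])
  have root: "(\<lambda>K. indicator {a} (K []) :: ennreal) \<in> borel_measurable ?D"
    using measurable_compose[OF measurable_component_singleton[of "[]" UNIV
          "\<lambda>_. measure_pmf (Poisson (lam * (1 - s)))"], of "indicator {a}" borel] by simp
  have "emeasure (augmentation lam s t) (cylinder (Suc n) (node (?k + a) f)) =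
    (\<integral>\<^sup>+K. ?new * ((\<Prod>m\<in>{[]}. indicator {a} (K m)) * (\<Prod>i\<in>{1..?k}. ?\<Phi> i (\<lambda>m. K (i # m)))) \<partial>?D)"
    unfolding emeasure_augmentation[OF t sets_cylinder]
    by (intro nn_integral_cong) (subst nn_integral_attach_cylinder[OF t f], simp_all)
  also have "\<dots> = ?new * (\<integral>\<^sup>+K. (\<Prod>m\<in>{[]}. indicator {a} (K m)) *
      (\<Prod>i\<in>{1..?k}. ?\<Phi> i (\<lambda>m. K (i # m))) \<partial>?D)"
    by (rule nn_integral_cmult)
       (intro borel_measurable_times_ennreal borel_measurable_prod_ennreal reindex,
         auto intro: root)
  also have "(\<integral>\<^sup>+K. (\<Prod>m\<in>{[]}. indicator {a} (K m)) *
      (\<Prod>i\<in>{1..?k}. ?\<Phi> i (\<lambda>m. K (i # m))) \<partial>?D) =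
    (\<Prod>m\<in>{[] :: nat list}. \<integral>\<^sup>+b. indicator {a} b \<partial>Poisson (lam * (1 - s))) *
    (\<Prod>i\<in>{1..?k}. \<integral>\<^sup>+K. ?\<Phi> i K \<partial>?D)"
    using meas by (intro nn_integral_PiM_prod_coords_reindex[where f = "\<lambda>i m. i # m"])
      (auto simp: prob_space_measure_pmf inj_def)
  also have "(\<Prod>i\<in>{1..?k}. \<integral>\<^sup>+K. ?\<Phi> i K \<partial>?D) =
      (\<Prod>i\<in>{1..?k}. emeasure (augmentation lam s (subtree t i)) (cylinder n (f i)))"
    by (intro prod.cong refl emeasure_augmentation[symmetric] subtree_in_ltrees t sets_cylinder)
  finally show ?thesis by (simp add: emeasure_pmf_single ac_simps)
qed

lemma emeasure_augmentation_cylinder_degree: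
  assumes t: "t \<in> ltrees" and c: "c < nchildren t []" and f: "\<And>i. i \<in> {1..c} \<Longrightarrow> [] \<in> f i"
  shows "emeasure (augmentation lam s t) (cylinder (Suc n) (node c f)) = 0"
proof -
  have "attach t K G \<notin> cylinder (Suc n) (node c f)" if "G \<in> space (grafts lam)" for K G
    by (subst attach_in_cylinder_iff[OF t grafts_in_ltrees[OF that] f]) (use c in auto)
  then have "(\<integral>\<^sup>+G. indicator (cylinder (Suc n) (node c f)) (attach t K G) \<partial>grafts lam) =
      (\<integral>\<^sup>+G. 0 \<partial>grafts lam)" for K
    by (intro nn_integral_cong) (simp del: mem_Collect_eq)
  then show ?thesis unfolding emeasure_augmentation[OF t sets_cylinder] by simp
qed

lemma emeasure_augmentation_cylinder:
  "t \<in> ltrees \<Longrightarrow>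
    emeasure (augmentation lam s t) (cylinder n x) = ennreal (pmf (augmentation_pmf lam s n t) x)"
proof (induction n arbitrary: x t)
  case 0
  then show ?case
    unfolding augmentation_pmf.simps
    by (intro emeasure_cylinder_0 prob_space_augmentation sets_augmentation)
next
  case (Suc n)
  let ?k = "nchildren t []"
  show ?case
  proof (rule emeasure_cylinder_SucI[OF set_augmentation_pmf])
    fix c and f :: "nat \<Rightarrow> ltree" assume f: "\<And>i. f i \<in> ltrees_upto n"
    show "emeasure (augmentation lam s t) (cylinder (Suc n) (node c f)) =
      pmf (augmentation_pmf lam s (Suc n) t) (node c f)"
    proof (cases "c < ?k")
      case True
      then show ?thesis
        using emeasure_augmentation_cylinder_degree[OF Suc.prems True Nil_in_ltrees_upto[OF f]]
          augmentation_pmf_degree_ge[OF True f] by simp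
    next
      case False
      then obtain a where c: "c = ?k + a" using le_Suc_ex not_less by metis
      show ?thesis
        unfolding c pmf_augmentation_pmf_node[OF f]
          emeasure_augmentation_cylinder_node[OF Suc.prems Nil_in_ltrees_upto[OF f]]
        using Suc.IH[OF subtree_in_ltrees[OF Suc.prems]]
        by (simp add: emeasure_GW_cylinder prod_ennreal ennreal_mult' prod_nonneg ac_simps)
    qed
  qed
qed

subsection \<open>Uniform relabelings\<close>

lemma sets_uniform_relabeling [simp, measurable_cong]:
  "sets (uniform_relabeling t) = sets tree_space"
  by (simp add: uniform_relabeling_def)

lemma prob_space_uniform_relabeling: "t \<in> ltrees \<Longrightarrow> prob_space (uniform_relabeling t)"
  unfolding uniform_relabeling_def
  by (intro prob_space.prob_space_distr prob_space_PiM prob_space_uniform_count_measure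
      finite_perms perms_nonempty measurable_new_label)

abbreviation uniform_perm :: "nat \<Rightarrow> (nat \<Rightarrow> nat) measure" where
  "uniform_perm c \<equiv> uniform_count_measure (perms c)"

abbreviation uniform_perms :: "ltree \<Rightarrow> (nat list \<Rightarrow> nat \<Rightarrow> nat) measure" where
  "uniform_perms t \<equiv> \<Pi>\<^sub>M m\<in>UNIV. uniform_perm (nchildren t m)"

lemma prob_space_uniform_perm: "prob_space (uniform_perm c)"
  by (intro prob_space_uniform_count_measure finite_perms perms_nonempty)

lemma uniform_perms_permutes: "\<sigma> \<in> space (uniform_perms t) \<Longrightarrow> \<sigma> m permutes {1..nchildren t m}"
  by (auto simp: space_PiM PiE_def Pi_def space_uniform_count_measure)

lemma emeasure_uniform_relabeling:
  assumes "t \<in> ltrees" "C \<in> sets tree_space"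
  shows "emeasure (uniform_relabeling t) C =
    (\<integral>\<^sup>+\<sigma>. indicator C (new_label \<sigma> ` t) \<partial>uniform_perms t)"
  unfolding uniform_relabeling_def
  by (rule emeasure_distr_eq_nn_integral[OF measurable_new_label[OF assms(1)] assms(2)])

lemma new_label_image_in_cylinder_iff:
  assumes t: "t \<in> ltrees" and \<sigma>: "\<And>m. \<sigma> m permutes {1..nchildren t m}"
    and f: "\<And>i. i \<in> {1..c} \<Longrightarrow> [] \<in> f i"
  shows "new_label \<sigma> ` t \<in> cylinder (Suc n) (node c f) \<longleftrightarrow> c = nchildren t [] \<and>
    (\<forall>i\<in>{1..c}. new_label (\<lambda>m. \<sigma> (i # m)) ` subtree t i \<in> cylinder n (f (\<sigma> [] i)))"
proof -
  let ?c = "nchildren t []" and ?N = "\<lambda>i. new_label (\<lambda>m. \<sigma> (i # m)) ` subtree t i"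
  have N: "?N i \<in> ltrees" if "i \<in> {1..?c}" for i
    using that by (intro new_label_image_in_ltrees subtree_in_ltrees t)
      (auto simp: nchildren_subtree \<sigma>)
  have "new_label \<sigma> ` t \<in> cylinder (Suc n) (node c f) \<longleftrightarrow>
      ?c = c \<and> (\<forall>j\<in>{1..?c}. ?N (inv (\<sigma> []) j) \<in> cylinder n (f j))"
    unfolding new_label_image_eq_node[of t \<sigma>, OF t \<sigma>] Let_def
    by (rule node_in_cylinder_iff[OF N[OF inv_permutes_in[OF \<sigma>]] f])
  also have "(\<forall>j\<in>{1..?c}. ?N (inv (\<sigma> []) j) \<in> cylinder n (f j)) \<longleftrightarrow>
      (\<forall>j\<in>\<sigma> [] ` {1..?c}. ?N (inv (\<sigma> []) j) \<in> cylinder n (f j))"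
    using permutes_image[OF \<sigma>[of "[]"]] by simp
  also have "\<dots> \<longleftrightarrow> (\<forall>i\<in>{1..?c}. ?N i \<in> cylinder n (f (\<sigma> [] i)))"
    using permutes_inverses[OF \<sigma>[of "[]"]] by auto
  finally show ?thesis by auto
qed

abbreviation root_children_indicator ::
    "ltree \<Rightarrow> (nat \<Rightarrow> nat) \<Rightarrow> (nat \<Rightarrow> ltree set) \<Rightarrow> (nat list \<Rightarrow> nat \<Rightarrow> nat) \<Rightarrow> ennreal" where
  "root_children_indicator t \<pi> C \<sigma> \<equiv> indicator {\<pi>} (\<sigma> []) *
    (\<Prod>i\<in>{1..nchildren t []}. indicator (C i) (new_label (\<lambda>m. \<sigma> (i # m)) ` subtree t i))"

lemma measurable_indicator_uniform_perm:
  "indicator {\<pi>} \<in> borel_measurable (uniform_perm c)" for \<pi> :: "nat \<Rightarrow> nat"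
  by (auto simp: measurable_def sets_uniform_count_measure space_uniform_count_measure)

lemma measurable_indicator_new_label_subtree:
  assumes "t \<in> ltrees" "i \<in> {1..nchildren t []}" "C \<in> sets tree_space"
  shows "(\<lambda>\<sigma>. indicator C (new_label \<sigma> ` subtree t i) :: ennreal) \<in>
    borel_measurable (\<Pi>\<^sub>M m\<in>UNIV. uniform_perm (nchildren t (i # m)))"
  using measurable_new_label[OF subtree_in_ltrees[OF assms(1,2)]] assms(3)
  unfolding nchildren_subtree by measurable

lemma measurable_root_children_indicator:
  assumes "t \<in> ltrees" "\<And>i. C i \<in> sets tree_space"
  shows "root_children_indicator t \<pi> C \<in> borel_measurable (uniform_perms t)"
  using measurable_compose[OF measurable_component_singleton[of "[]" UNIV
        "\<lambda>m. uniform_perm (nchildren t m)"] measurable_indicator_uniform_perm]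
    measurable_compose[OF measurable_PiM_reindex[of "(#) _" "\<lambda>m. uniform_perm (nchildren t m)"]
      measurable_indicator_new_label_subtree[OF assms(1) _ assms(2)]]
  by (intro borel_measurable_times_ennreal borel_measurable_prod_ennreal) auto

lemma nn_integral_root_children_indicator:
  assumes t: "t \<in> ltrees" and C: "\<And>i. C i \<in> sets tree_space" and \<pi>: "\<pi> \<in> perms (nchildren t [])"
  shows "(\<integral>\<^sup>+\<sigma>. root_children_indicator t \<pi> C \<sigma> \<partial>uniform_perms t) =
      ennreal (1 / fact (nchildren t [])) *
    (\<Prod>i\<in>{1..nchildren t []}. emeasure (uniform_relabeling (subtree t i)) (C i))"
proof -
  let ?c = "nchildren t []"
  let ?h = "\<lambda>i \<sigma>. indicator (C i) (new_label \<sigma> ` subtree t i) :: ennreal"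
  have "(\<integral>\<^sup>+\<sigma>. (\<Prod>m\<in>{[]}. indicator {\<pi>} (\<sigma> m)) * (\<Prod>i\<in>{1..?c}. ?h i (\<lambda>m. \<sigma> (i # m)))
      \<partial>uniform_perms t) =
    (\<Prod>m\<in>{[]}. \<integral>\<^sup>+\<rho>. indicator {\<pi>} \<rho> \<partial>uniform_perm (nchildren t m)) *
      (\<Prod>i\<in>{1..?c}. \<integral>\<^sup>+\<sigma>. ?h i \<sigma> \<partial>(\<Pi>\<^sub>M m\<in>UNIV. uniform_perm (nchildren t (i # m))))"
    by (intro nn_integral_PiM_prod_coords_reindex[where f = "\<lambda>i m. i # m"])
       (use measurable_indicator_new_label_subtree[OF t _ C] measurable_indicator_uniform_perm in
         \<open>auto simp: prob_space_uniform_perm inj_def\<close>)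
  moreover have "(\<integral>\<^sup>+\<rho>. indicator {\<pi>} \<rho> \<partial>uniform_perm ?c) = ennreal (1 / fact ?c)"
    using \<pi>
    by (subst nn_integral_indicator)
       (auto simp: sets_uniform_count_measure emeasure_uniform_count_measure finite_perms
         card_perms)
  moreover have
    "(\<Prod>i\<in>{1..?c}. \<integral>\<^sup>+\<sigma>. ?h i \<sigma> \<partial>(\<Pi>\<^sub>M m\<in>UNIV. uniform_perm (nchildren t (i # m)))) =
      (\<Prod>i\<in>{1..?c}. emeasure (uniform_relabeling (subtree t i)) (C i))"
    using emeasure_uniform_relabeling[OF subtree_in_ltrees[OF t] C]
    by (intro prod.cong refl) (simp add: nchildren_subtree)
  ultimately show ?thesis by simp
qed

lemma emeasure_uniform_relabeling_cylinder_node: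
  assumes t: "t \<in> ltrees" and f: "\<And>i. i \<in> {1..nchildren t []} \<Longrightarrow> [] \<in> f i"
  shows "emeasure (uniform_relabeling t) (cylinder (Suc n) (node (nchildren t []) f)) =
    (\<Sum>\<pi>\<in>perms (nchildren t []). ennreal (1 / fact (nchildren t [])) *
      (\<Prod>i\<in>{1..nchildren t []}. emeasure (uniform_relabeling (subtree t i)) (cylinder n (f (\<pi> i)))))"
proof -
  let ?c = "nchildren t []" and ?P = "uniform_perms t"
  let ?J = "\<lambda>\<pi>. root_children_indicator t \<pi> (\<lambda>i. cylinder n (f (\<pi> i)))"
  have "emeasure (uniform_relabeling t) (cylinder (Suc n) (node ?c f)) =
      (\<integral>\<^sup>+\<sigma>. (\<Sum>\<pi>\<in>perms ?c. ?J \<pi> \<sigma>) \<partial>?P)"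
    unfolding emeasure_uniform_relabeling[OF t sets_cylinder]
  proof (rule nn_integral_cong)
    fix \<sigma> assume "\<sigma> \<in> space ?P"
    note \<sigma> = uniform_perms_permutes[OF this]
    have in_cylinder: "new_label \<sigma> ` t \<in> cylinder (Suc n) (node ?c f) \<longleftrightarrow>
        (\<forall>i\<in>{1..?c}. new_label (\<lambda>m. \<sigma> (i # m)) ` subtree t i \<in> cylinder n (f (\<sigma> [] i)))"
      by (subst new_label_image_in_cylinder_iff[OF t \<sigma> f]) simp_all
    have "(\<Sum>\<pi>\<in>perms ?c. ?J \<pi> \<sigma>) = (\<Sum>\<pi>\<in>{\<sigma> []}. ?J \<pi> \<sigma>)"
      using \<sigma> by (intro sum.mono_neutral_right) (auto simp: finite_perms)
    also have "\<dots> = indicator (cylinder (Suc n) (node ?c f)) (new_label \<sigma> ` t)"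
      unfolding indicator_def[of "cylinder (Suc n) (node ?c f)"] in_cylinder
      by (simp add: prod_indicator del: mem_Collect_eq)
    finally show "indicator (cylinder (Suc n) (node ?c f)) (new_label \<sigma> ` t) =
      (\<Sum>\<pi>\<in>perms ?c. ?J \<pi> \<sigma>)" ..
  qed
  also have "\<dots> = (\<Sum>\<pi>\<in>perms ?c. \<integral>\<^sup>+\<sigma>. ?J \<pi> \<sigma> \<partial>?P)"
    by (rule nn_integral_sum) (rule measurable_root_children_indicator[OF t sets_cylinder])
  also have "\<dots> = (\<Sum>\<pi>\<in>perms ?c. ennreal (1 / fact ?c) *
      (\<Prod>i\<in>{1..?c}. emeasure (uniform_relabeling (subtree t i)) (cylinder n (f (\<pi> i)))))"
    by (intro sum.cong refl nn_integral_root_children_indicator[OF t sets_cylinder])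
  finally show ?thesis .
qed

lemma emeasure_uniform_relabeling_cylinder_degree:
  assumes t: "t \<in> ltrees" and "c \<noteq> nchildren t []" and f: "\<And>i. i \<in> {1..c} \<Longrightarrow> [] \<in> f i"
  shows "emeasure (uniform_relabeling t) (cylinder (Suc n) (node c f)) = 0"
proof -
  have "new_label \<sigma> ` t \<notin> cylinder (Suc n) (node c f)" if "\<sigma> \<in> space (uniform_perms t)" for \<sigma>
    by (subst new_label_image_in_cylinder_iff[OF t uniform_perms_permutes[OF that] f])
       (use assms(2) in auto)
  then have "(\<integral>\<^sup>+\<sigma>. indicator (cylinder (Suc n) (node c f)) (new_label \<sigma> ` t) \<partial>uniform_perms t) =
      (\<integral>\<^sup>+\<sigma>. 0 \<partial>uniform_perms t)"
    by (intro nn_integral_cong) (simp del: mem_Collect_eq)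
  then show ?thesis unfolding emeasure_uniform_relabeling[OF t sets_cylinder] by simp
qed

lemma emeasure_uniform_relabeling_cylinder:
  "t \<in> ltrees \<Longrightarrow>
    emeasure (uniform_relabeling t) (cylinder n x) = ennreal (pmf (relabeling_pmf n t) x)"
proof (induction n arbitrary: x t)
  case 0
  then show ?case
    unfolding relabeling_pmf.simps
    by (intro emeasure_cylinder_0 prob_space_uniform_relabeling sets_uniform_relabeling)
next
  case (Suc n)
  show ?case
  proof (rule emeasure_cylinder_SucI[OF set_relabeling_pmf])
    fix c and f :: "nat \<Rightarrow> ltree" assume f: "\<And>i. f i \<in> ltrees_upto n"
    show "emeasure (uniform_relabeling t) (cylinder (Suc n) (node c f)) =
      pmf (relabeling_pmf (Suc n) t) (node c f)"
    proof (cases "c = nchildren t []")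
      case True
      show ?thesis
        unfolding True relabeling_pmf.simps pmf_shuffle_pmf[OF set_relabeling_pmf f]
          emeasure_uniform_relabeling_cylinder_node[OF Suc.prems Nil_in_ltrees_upto[OF f]]
        using Suc.IH[OF subtree_in_ltrees[OF Suc.prems]]
        by (simp add: prod_ennreal ennreal_mult'[symmetric] prod_nonneg sum_ennreal
          sum_divide_distrib)
    next
      case False
      then show ?thesis
        unfolding relabeling_pmf.simps pmf_shuffle_pmf[OF set_relabeling_pmf f]
        using emeasure_uniform_relabeling_cylinder_degree[OF Suc.prems False
            Nil_in_ltrees_upto[OF f]]
        by simp
    qed
  qed
qed

section \<open>The pruned laws of the two hypotheses\<close>

subsection \<open>Kernels between tree spaces\<close>

lemma sets_tree_space_cylinder:
  "sets tree_space = sigma_sets ltrees (insert {} {cylinder n x | n x. True})"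
proof -
  let ?G = "insert {} {cylinder n x | n x. True}"
  have "sets tree_space = sigma_sets ltrees {{t \<in> ltrees. m \<in> t} | m. True}"
    unfolding tree_space_def by (rule sets_measure_of) auto
  also have "\<dots> = sigma_sets ltrees ?G"
  proof (rule sigma_sets_eqI)
    fix A assume "A \<in> {{t \<in> ltrees. m \<in> t} | m. True}"
    then obtain m where A: "A = {t \<in> ltrees. m \<in> t}" by blast
    have "A = (\<Union>x\<in>{x \<in> ltrees_upto (length m). m \<in> x}. cylinder (length m) x)"
      unfolding A using prune_in_ltrees_upto by (auto simp: prune_def)
    also have "\<dots> \<in> sigma_sets ltrees ?G"
      by (rule sigma_sets_UNION)
         (auto intro!: countable_subset[OF _ countable_ltrees_upto[of "length m"]] sigma_sets.Basic)
    finally show "A \<in> sigma_sets ltrees ?G" .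
  next
    fix A assume "A \<in> ?G"
    then have "A \<in> sets tree_space" by (auto simp: sets_cylinder)
    then show "A \<in> sigma_sets ltrees {{t \<in> ltrees. m \<in> t} | m. True}"
      unfolding \<open>sets tree_space = _\<close> .
  qed
  finally show ?thesis .
qed

lemma cylinder_Int_cylinder:
  assumes "n \<le> m"
  shows "cylinder n x \<inter> cylinder m y = (if prune n y = x then cylinder m y else {})"
  using prune_prune[OF assms] by auto

lemma Int_stable_cylinder: "Int_stable (insert {} {cylinder n x | n x. True})"
proof (rule Int_stableI)
  fix A B :: "ltree set"
  assume "A \<in> insert {} {cylinder n x | n x. True}" "B \<in> insert {} {cylinder n x | n x. True}"
  then consider (empty) "A = {} \<or> B = {}"
    | (cylinders) n x m y where "A = cylinder n x" "B = cylinder m y" by blast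
  then show "A \<inter> B \<in> insert {} {cylinder n x | n x. True}"
  proof cases
    case (cylinders n x m y)
    show ?thesis
    proof (cases "n \<le> m")
      case True
      then have "A \<inter> B \<in> {{}, B}" unfolding cylinders by (simp add: cylinder_Int_cylinder)
      then show ?thesis using cylinders by blast
    next
      case False
      then have "B \<inter> A \<in> {{}, A}" unfolding cylinders by (simp add: cylinder_Int_cylinder)
      then show ?thesis using cylinders by (subst Int_commute) blast
    qed
  qed auto
qed

lemma measurable_tree_kernelI:
  assumes "\<And>t. t \<in> ltrees \<Longrightarrow> prob_space (K t)" "\<And>t. t \<in> ltrees \<Longrightarrow> sets (K t) = sets tree_space"
    and "\<And>n x t. t \<in> ltrees \<Longrightarrow> emeasure (K t) (cylinder n x) = g n x (prune n t)"
  shows "K \<in> tree_space \<rightarrow>\<^sub>M prob_algebra tree_space"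
proof (rule measurable_prob_algebra_generated[OF sets_tree_space_cylinder Int_stable_cylinder])
  fix A assume "A \<in> insert {} {cylinder n x | n x. True}"
  then consider (empty) "A = {}" | (cylinder) n x where "A = cylinder n x" by blast
  then show "(\<lambda>t. emeasure (K t) A) \<in> borel_measurable tree_space"
  proof cases
    case (cylinder n x)
    have "(\<lambda>t. g n x (prune n t)) \<in> borel_measurable tree_space"
      by (rule measurable_compose[OF measurable_prune_UNIV]) simp
    then show ?thesis unfolding cylinder by (subst measurable_cong) (auto simp: assms)
  qed simp
qed (use assms in auto)

lemma measurable_augmentation: "augmentation lam s \<in> tree_space \<rightarrow>\<^sub>M prob_algebra tree_space"
  by (rule measurable_tree_kernelI[where
        g = "\<lambda>n x t. ennreal (pmf (augmentation_pmf lam s n t) x)"])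
     (auto simp: prob_space_augmentation emeasure_augmentation_cylinder augmentation_pmf_prune)

lemma measurable_uniform_relabeling: "uniform_relabeling \<in> tree_space \<rightarrow>\<^sub>M prob_algebra tree_space"
  by (rule measurable_tree_kernelI[where g = "\<lambda>n x t. ennreal (pmf (relabeling_pmf n t) x)"])
     (auto simp: prob_space_uniform_relabeling emeasure_uniform_relabeling_cylinder
       relabeling_pmf_prune)

lemma distr_eq_measure_pmf:
  assumes "T \<in> M \<rightarrow>\<^sub>M count_space UNIV" "\<And>x. x \<in> space M \<Longrightarrow> T x \<in> A" "set_pmf p \<subseteq> A" "countable A"
    and "\<And>y. y \<in> A \<Longrightarrow> emeasure M (T -` {y} \<inter> space M) = ennreal (pmf p y)"
  shows "distr M (count_space UNIV) T = measure_pmf p"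
proof (rule measure_eqI_countable_AE[where \<Omega> = A])
  show "AE x in distr M (count_space UNIV) T. x \<in> A"
    using assms by (subst AE_distr_iff) auto
  show "AE x in measure_pmf p. x \<in> A" using assms(3) by (auto simp: AE_measure_pmf_iff)
qed (use assms in \<open>auto simp: emeasure_distr emeasure_pmf_single\<close>)

lemma distr_prune_eq_measure_pmf:
  assumes M: "sets M = sets tree_space" and p: "set_pmf p \<subseteq> ltrees_upto n"
    and eq: "\<And>x. emeasure M (cylinder n x) = ennreal (pmf p x)"
  shows "distr M (count_space UNIV) (prune n) = measure_pmf p"
proof -
  have space: "space M = ltrees" using sets_eq_imp_space_eq[OF M] by simp
  show ?thesis
  proof (rule distr_eq_measure_pmf[where A = "ltrees_upto n"])
    show "prune n \<in> M \<rightarrow>\<^sub>M count_space UNIV"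
      using measurable_prune_UNIV measurable_cong_sets[OF M refl] by blast
    fix y
    have "prune n -` {y} \<inter> space M = cylinder n y" by (auto simp: space)
    then show "emeasure M (prune n -` {y} \<inter> space M) = ennreal (pmf p y)" using eq by simp
  qed (use space p in \<open>auto intro: prune_in_ltrees_upto\<close>)
qed

lemma nn_integral_prune:
  assumes M: "sets M = sets tree_space"
    and D: "distr M (count_space UNIV) (prune n) = measure_pmf p"
  shows "(\<integral>\<^sup>+t. g (prune n t) \<partial>M) = (\<integral>\<^sup>+x. g x \<partial>measure_pmf p)"
  unfolding D[symmetric]
  by (rule nn_integral_distr[symmetric])
     (use measurable_prune_UNIV measurable_cong_sets[OF M refl] in \<open>auto\<close>)

lemma distr_GW: "distr (GW \<mu>) (count_space UNIV) (prune n) = measure_pmf (GW_pmf \<mu> n)"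
  by (rule distr_prune_eq_measure_pmf) (auto simp: emeasure_GW_cylinder set_GW_pmf)

lemma map_prune_GW_pmf:
  assumes "m \<le> n" shows "map_pmf (prune m) (GW_pmf \<mu> n) = GW_pmf \<mu> m"
proof -
  have "measure_pmf (map_pmf (prune m) (GW_pmf \<mu> n)) =
      distr (distr (GW \<mu>) (count_space UNIV) (prune n)) (count_space UNIV) (prune m)"
    by (simp add: distr_GW map_pmf_rep_eq)
  also have "\<dots> = distr (GW \<mu>) (count_space UNIV) (prune m \<circ> prune n)"
    using measurable_prune_UNIV measurable_cong_sets[OF sets_GW refl] by (subst distr_distr) auto
  also have "prune m \<circ> prune n = prune m" using assms by (auto simp: prune_prune)
  finally show ?thesis by (simp add: distr_GW measure_pmf_inject)
qed

subsection \<open>Laws of pairs of trees with discrete prunings\<close>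

abbreviation tree_pairs :: "nat \<Rightarrow> (ltree \<times> ltree) set" where
  "tree_pairs n \<equiv> ltrees_upto n \<times> ltrees_upto n"

lemma measurable_prune2: "prune2 n \<in> tree_space \<Otimes>\<^sub>M tree_space \<rightarrow>\<^sub>M count_space (tree_pairs n)"
proof (subst measurable_count_space_eq_countable, simp, safe)
  fix x y
  have "prune2 n -` {(x, y)} \<inter> space (tree_space \<Otimes>\<^sub>M tree_space) = cylinder n x \<times> cylinder n y"
    by (auto simp: prune2_def space_pair_measure)
  also have "\<dots> \<in> sets (tree_space \<Otimes>\<^sub>M tree_space)" by (intro pair_measureI sets_cylinder)
  finally show "prune2 n -` {(x, y)} \<inter> space (tree_space \<Otimes>\<^sub>M tree_space)
      \<in> sets (tree_space \<Otimes>\<^sub>M tree_space)" .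
qed (auto simp: prune2_def space_pair_measure intro: prune_in_ltrees_upto)

lemma measurable_prune2_UNIV: "prune2 n \<in> tree_space \<Otimes>\<^sub>M tree_space \<rightarrow>\<^sub>M count_space UNIV"
  by (rule measurable_compose[OF measurable_prune2]) simp

lemma prune2_in_tree_pairs: "x \<in> ltrees \<times> ltrees \<Longrightarrow> prune2 n x \<in> tree_pairs n"
  by (auto simp: prune2_def intro: prune_in_ltrees_upto)

lemma prune2_prune2: "m \<le> n \<Longrightarrow> prune2 m (prune2 n x) = prune2 m x"
  by (auto simp: prune2_def prune_prune split: prod.splits)

lemma prune2_ident: "z \<in> tree_pairs n \<Longrightarrow> prune2 n z = z"
  by (auto simp: prune2_def prune_ident)

locale tree_pair_law =
  fixes M :: "(ltree \<times> ltree) measure" and p :: "nat \<Rightarrow> (ltree \<times> ltree) pmf"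
  assumes sets_M: "sets M = sets (tree_space \<Otimes>\<^sub>M tree_space)"
    and distr_prune2: "distr M (count_space UNIV) (prune2 n) = measure_pmf (p n)"
begin

lemma space_M: "space M = ltrees \<times> ltrees"
  using sets_eq_imp_space_eq[OF sets_M] by (simp add: space_pair_measure)

lemma measurable_prune2_M: "prune2 n \<in> M \<rightarrow>\<^sub>M count_space UNIV"
  using measurable_prune2_UNIV measurable_cong_sets[OF sets_M refl] by blast

lemma measurable_prune2_M_tree_pairs: "prune2 n \<in> M \<rightarrow>\<^sub>M count_space (tree_pairs n)"
  using measurable_prune2 measurable_cong_sets[OF sets_M refl] by blast

lemma sets_vimage_prune2: "prune2 n -` A \<inter> (ltrees \<times> ltrees) \<in> sets M"
  using measurable_sets[OF measurable_prune2_M, of A n] by (simp add: space_M)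

lemma measure_vimage_prune2:
  "measure M (prune2 n -` A \<inter> (ltrees \<times> ltrees)) = measure_pmf.prob (p n) A"
  using measure_distr[OF measurable_prune2_M, of A n] by (simp add: distr_prune2 space_M)

lemma set_p: "set_pmf (p n) \<subseteq> tree_pairs n"
proof -
  have "AE z in distr M (count_space UNIV) (prune2 n). z \<in> tree_pairs n"
    using measurable_prune2_M prune2_in_tree_pairs by (subst AE_distr_iff) (auto simp: space_M)
  then show ?thesis unfolding distr_prune2 AE_measure_pmf_iff by blast
qed

lemma prob_p_Int_tree_pairs:
  "measure_pmf.prob (p n) {x \<in> tree_pairs n. Q x} = measure_pmf.prob (p n) {x. Q x}"
  using set_p by (intro measure_prob_cong_0) (auto simp: set_pmf_eq)

lemma map_prune2:
  assumes "m \<le> n" shows "map_pmf (prune2 m) (p n) = p m"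
proof -
  have "measure_pmf (map_pmf (prune2 m) (p n)) =
      distr (distr M (count_space UNIV) (prune2 n)) (count_space UNIV) (prune2 m)"
    by (simp add: distr_prune2 map_pmf_rep_eq)
  also have "\<dots> = distr M (count_space UNIV) (prune2 m \<circ> prune2 n)"
    using measurable_prune2_M by (subst distr_distr) auto
  also have "prune2 m \<circ> prune2 n = prune2 m" using assms by (auto simp: prune2_prune2)
  finally show ?thesis by (simp add: distr_prune2 measure_pmf_inject)
qed

lemma measure_pruned_law:
  assumes "A \<subseteq> tree_pairs n" shows "measure (pruned_law M n) A = measure_pmf.prob (p n) A"
  using assms measurable_prune2_M_tree_pairs
  by (simp add: pruned_law_def measure_distr space_M measure_vimage_prune2)

lemma nn_integral_prune2: "(\<integral>\<^sup>+x. f (prune2 n x) \<partial>M) = (\<integral>\<^sup>+x. f x \<partial>p n)"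
  unfolding distr_prune2[symmetric] using measurable_prune2_M by (subst nn_integral_distr) auto

lemma nn_integral_pruned_law: "(\<integral>\<^sup>+x. f x \<partial>pruned_law M n) = (\<integral>\<^sup>+x. f x \<partial>p n)"
  unfolding pruned_law_def nn_integral_prune2[symmetric]
  using measurable_prune2_M_tree_pairs by (subst nn_integral_distr) auto

lemma integral_prune2: "(\<integral>x. f (prune2 n x) \<partial>M) = (\<integral>x. f x \<partial>p n)" for f :: "_ \<Rightarrow> real"
  unfolding distr_prune2[symmetric] using measurable_prune2_M by (subst integral_distr) auto

lemma integrable_prune2: "integrable M (\<lambda>x. f (prune2 n x)) \<longleftrightarrow> integrable (p n) f"
  for f :: "_ \<Rightarrow> real"
  unfolding distr_prune2[symmetric] using measurable_prune2_M by (subst integrable_distr_eq) auto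

lemma integral_pruned_law: "(\<integral>x. f x \<partial>pruned_law M n) = (\<integral>x. f x \<partial>p n)" for f :: "_ \<Rightarrow> real"
  unfolding pruned_law_def integral_prune2[symmetric]
  using measurable_prune2_M_tree_pairs by (subst integral_distr) auto

end

lemma tree_pair_lawI:
  assumes M: "sets M = sets (tree_space \<Otimes>\<^sub>M tree_space)" and p: "\<And>n. set_pmf (p n) \<subseteq> tree_pairs n"
    and eq: "\<And>n x y. emeasure M (cylinder n x \<times> cylinder n y) = ennreal (pmf (p n) (x, y))"
  shows "tree_pair_law M p"
proof
  fix n
  have space: "space M = ltrees \<times> ltrees"
    using sets_eq_imp_space_eq[OF M] by (simp add: space_pair_measure)
  show "distr M (count_space UNIV) (prune2 n) = measure_pmf (p n)"
  proof (rule distr_eq_measure_pmf[where A = "tree_pairs n"])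
    show "prune2 n \<in> M \<rightarrow>\<^sub>M count_space UNIV"
      using measurable_prune2_UNIV measurable_cong_sets[OF M refl] by blast
    fix z :: "ltree \<times> ltree"
    have "prune2 n -` {z} \<inter> space M = cylinder n (fst z) \<times> cylinder n (snd z)"
      by (auto simp: space prune2_def)
    then show "emeasure M (prune2 n -` {z} \<inter> space M) = ennreal (pmf (p n) z)" using eq by simp
  qed (use space p prune2_in_tree_pairs in auto)
qed (rule M)

subsection \<open>The independent and the correlated pair\<close>

definition relabeled_augmentation_pmf :: "real \<Rightarrow> real \<Rightarrow> nat \<Rightarrow> ltree \<Rightarrow> ltree pmf" where
  "relabeled_augmentation_pmf lam s n t = augmentation_pmf lam s n t \<bind> relabeling_pmf n"

definition P0_pmf :: "real \<Rightarrow> nat \<Rightarrow> (ltree \<times> ltree) pmf" where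
  "P0_pmf lam n = pair_pmf (GW_pmf lam n) (GW_pmf lam n)"

definition P1_pmf :: "real \<Rightarrow> real \<Rightarrow> nat \<Rightarrow> (ltree \<times> ltree) pmf" where
  "P1_pmf lam s n = GW_pmf (lam * s) n \<bind>
     (\<lambda>t. pair_pmf (relabeled_augmentation_pmf lam s n t) (relabeled_augmentation_pmf lam s n t))"

lemma set_relabeled_augmentation_pmf:
  "set_pmf (relabeled_augmentation_pmf lam s n t) \<subseteq> ltrees_upto n"
  using set_relabeling_pmf by (auto simp: relabeled_augmentation_pmf_def)

lemma relabeled_augmentation_pmf_prune:
  "t \<in> ltrees \<Longrightarrow>
    relabeled_augmentation_pmf lam s n (prune n t) = relabeled_augmentation_pmf lam s n t"
  by (simp add: relabeled_augmentation_pmf_def augmentation_pmf_prune)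

abbreviation relabeled_augmentation :: "real \<Rightarrow> real \<Rightarrow> ltree \<Rightarrow> ltree measure" where
  "relabeled_augmentation lam s t \<equiv> augmentation lam s t \<bind> uniform_relabeling"

lemma measurable_relabeled_augmentation:
  "relabeled_augmentation lam s \<in> tree_space \<rightarrow>\<^sub>M prob_algebra tree_space"
  by (rule measurable_bind_prob_space[OF measurable_augmentation measurable_uniform_relabeling])

lemma sets_relabeled_augmentation:
    "t \<in> ltrees \<Longrightarrow> sets (relabeled_augmentation lam s t) = sets tree_space"
  and prob_space_relabeled_augmentation: "t \<in> ltrees \<Longrightarrow> prob_space (relabeled_augmentation lam s t)"
  using measurable_space[OF measurable_relabeled_augmentation, of t lam s]
  by (simp_all add: space_prob_algebra)

lemma emeasure_relabeled_augmentation_cylinder: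
  assumes t: "t \<in> ltrees"
  shows "emeasure (relabeled_augmentation lam s t) (cylinder n y) =
    ennreal (pmf (relabeled_augmentation_pmf lam s n t) y)"
proof -
  have space: "space (augmentation lam s t) = ltrees" by (simp add: augmentation_def)
  have distr: "distr (augmentation lam s t) (count_space UNIV) (prune n) =
      measure_pmf (augmentation_pmf lam s n t)"
    by (rule distr_prune_eq_measure_pmf)
       (auto simp: emeasure_augmentation_cylinder t set_augmentation_pmf)
  have "emeasure (relabeled_augmentation lam s t) (cylinder n y) =
      (\<integral>\<^sup>+x. emeasure (uniform_relabeling x) (cylinder n y) \<partial>augmentation lam s t)"
    by (rule emeasure_bind_prob_algebra[OF _ measurable_uniform_relabeling sets_cylinder])
       (simp add: space_prob_algebra prob_space_augmentation[OF t])
  also have "\<dots> = (\<integral>\<^sup>+x. ennreal (pmf (relabeling_pmf n (prune n x)) y) \<partial>augmentation lam s t)"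
    by (intro nn_integral_cong)
       (simp add: space emeasure_uniform_relabeling_cylinder relabeling_pmf_prune)
  also have "\<dots> = (\<integral>\<^sup>+x. ennreal (pmf (relabeling_pmf n x) y) \<partial>augmentation_pmf lam s n t)"
    by (rule nn_integral_prune[OF _ distr]) simp
  also have "\<dots> = ennreal (pmf (relabeled_augmentation_pmf lam s n t) y)"
    by (simp add: relabeled_augmentation_pmf_def ennreal_pmf_bind)
  finally show ?thesis .
qed

lemma measurable_P1_kernel:
  "(\<lambda>t. relabeled_augmentation lam s t \<Otimes>\<^sub>M relabeled_augmentation lam s t)
    \<in> tree_space \<rightarrow>\<^sub>M prob_algebra (tree_space \<Otimes>\<^sub>M tree_space)"
  by (intro measurable_pair_prob measurable_relabeled_augmentation)

lemma GW_in_prob_algebra: "GW \<mu> \<in> space (prob_algebra tree_space)"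
  by (simp add: space_prob_algebra prob_space_GW)

lemma sets_P1: "sets (P1 lam s) = sets (tree_space \<Otimes>\<^sub>M tree_space)"
  and prob_space_P1: "prob_space (P1 lam s)"
  unfolding P1_def
  using sets_bind'[OF GW_in_prob_algebra measurable_P1_kernel]
    prob_space_bind'[OF GW_in_prob_algebra measurable_P1_kernel] by auto

lemma prob_space_P0: "prob_space (P0 lam)"
  unfolding P0_def by (intro prob_space_pair prob_space_GW)

interpretation P0: tree_pair_law "P0 lam" "P0_pmf lam" for lam
proof (rule tree_pair_lawI)
  show "sets (P0 lam) = sets (tree_space \<Otimes>\<^sub>M tree_space)"
    unfolding P0_def by (rule sets_pair_measure_cong) auto
  show "set_pmf (P0_pmf lam n) \<subseteq> tree_pairs n" for n
    using set_GW_pmf by (auto simp: P0_pmf_def)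
  interpret GW: prob_space "GW lam" by (rule prob_space_GW)
  show "emeasure (P0 lam) (cylinder n x \<times> cylinder n y) = ennreal (pmf (P0_pmf lam n) (x, y))"
      for n x y
    unfolding P0_def by (subst GW.emeasure_pair_measure_Times)
      (auto simp: emeasure_GW_cylinder P0_pmf_def pmf_pair ennreal_mult')
qed

interpretation P1: tree_pair_law "P1 lam s" "P1_pmf lam s" for lam s
proof (rule tree_pair_lawI[OF sets_P1])
  show "set_pmf (P1_pmf lam s n) \<subseteq> tree_pairs n" for n
    using set_relabeled_augmentation_pmf by (fastforce simp: P1_pmf_def)
  fix n x y
  let ?K = "relabeled_augmentation lam s" and ?k = "relabeled_augmentation_pmf lam s n"
  have "emeasure (P1 lam s) (cylinder n x \<times> cylinder n y) =
      (\<integral>\<^sup>+t. emeasure (?K t \<Otimes>\<^sub>M ?K t) (cylinder n x \<times> cylinder n y) \<partial>GW (lam * s))"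
    unfolding P1_def
    by (rule emeasure_bind_prob_algebra[OF GW_in_prob_algebra measurable_P1_kernel])
       (intro pair_measureI sets_cylinder)
  also have "\<dots> = (\<integral>\<^sup>+t. ennreal (pmf (pair_pmf (?k (prune n t)) (?k (prune n t))) (x, y))
      \<partial>GW (lam * s))"
  proof (intro nn_integral_cong)
    fix t assume "t \<in> space (GW (lam * s))"
    then have t: "t \<in> ltrees" by simp
    interpret K: prob_space "?K t" using t by (rule prob_space_relabeled_augmentation)
    show "emeasure (?K t \<Otimes>\<^sub>M ?K t) (cylinder n x \<times> cylinder n y) =
       ennreal (pmf (pair_pmf (?k (prune n t)) (?k (prune n t))) (x, y))"
      using t by (subst K.emeasure_pair_measure_Times)
        (auto simp: emeasure_relabeled_augmentation_cylinder sets_relabeled_augmentation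
          relabeled_augmentation_pmf_prune pmf_pair ennreal_mult')
  qed
  also have "\<dots> = (\<integral>\<^sup>+t. ennreal (pmf (pair_pmf (?k t) (?k t)) (x, y)) \<partial>GW_pmf (lam * s) n)"
    by (rule nn_integral_prune[OF _ distr_GW]) simp
  also have "\<dots> = ennreal (pmf (P1_pmf lam s n) (x, y))" by (simp add: P1_pmf_def ennreal_pmf_bind)
  finally show "emeasure (P1 lam s) (cylinder n x \<times> cylinder n y) =
      ennreal (pmf (P1_pmf lam s n) (x, y))" .
qed

lemma L_eq_pmf_quotient: "L lam s n x = pmf (P1_pmf lam s n) x / pmf (P0_pmf lam n) x"
proof (cases "x \<in> tree_pairs n")
  case True
  then show ?thesis
    by (simp add: L_def P0.measure_pruned_law P1.measure_pruned_law measure_pmf_single)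
next
  case False
  then have "pmf (P1_pmf lam s n) x = 0" by (rule pmf_eq_0_outside[OF P1.set_p])
  moreover have "{x} \<notin> sets (pruned_law (P1 lam s) n)" using False by (auto simp: pruned_law_def)
  ultimately show ?thesis by (simp add: L_def measure_notin_sets)
qed

section \<open>The recursive structure of the correlated law\<close>

subsection \<open>Products and Poisson laws\<close>

lemma Pi_pmf_permute:
  assumes \<pi>: "\<pi> permutes A" and A: "finite A"
  shows "map_pmf (\<lambda>F. F \<circ> \<pi>) (Pi_pmf A d P) = Pi_pmf A d (P \<circ> \<pi>)"
proof (rule pmf_eqI)
  fix g
  have "pmf (map_pmf (\<lambda>F. F \<circ> \<pi>) (Pi_pmf A d P)) ((g \<circ> inv \<pi>) \<circ> \<pi>) = pmf (Pi_pmf A d P) (g \<circ> inv \<pi>)"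
    using permutes_surj[OF \<pi>]
    by (intro pmf_map_inj') (auto simp: inj_def fun_eq_iff surj_def, metis)
  moreover have "(\<Prod>x\<in>A. pmf (P x) (g (inv \<pi> x))) = (\<Prod>x\<in>A. pmf (P (\<pi> x)) (g x))"
    using prod.permute[OF \<pi>, of "\<lambda>x. pmf (P x) (g (inv \<pi> x))"] \<pi>
    by (simp add: permutes_inverses o_def)
  moreover have "inv \<pi> x = x" if "x \<notin> A" for x
    using permutes_not_in[OF permutes_inv[OF \<pi>] that] .
  moreover have "(g \<circ> inv \<pi>) \<circ> \<pi> = g" using permutes_inv_o[OF \<pi>] by (simp add: o_assoc[symmetric])
  ultimately show "pmf (map_pmf (\<lambda>F. F \<circ> \<pi>) (Pi_pmf A d P)) g = pmf (Pi_pmf A d (P \<circ> \<pi>)) g"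
    using A by (auto simp: pmf_Pi)
qed

lemma Pi_pmf_pair:
  assumes "finite A"
  shows "Pi_pmf A (d, d') (\<lambda>i. pair_pmf (p i) (q i)) =
    map_pmf (\<lambda>(f, f') i. (f i, f' i)) (pair_pmf (Pi_pmf A d p) (Pi_pmf A d' q))"
proof (rule pmf_eqI)
  fix g
  have "pmf (map_pmf (\<lambda>(f, f') i. (f i, f' i)) (pair_pmf (Pi_pmf A d p) (Pi_pmf A d' q)))
      ((\<lambda>(f, f') i. (f i, f' i)) (fst \<circ> g, snd \<circ> g)) =
    pmf (pair_pmf (Pi_pmf A d p) (Pi_pmf A d' q)) (fst \<circ> g, snd \<circ> g)"
    by (rule pmf_map_inj') (auto simp: inj_def fun_eq_iff)
  moreover have "pmf (pair_pmf (p i) (q i)) (g i) = pmf (p i) (fst (g i)) * pmf (q i) (snd (g i))"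
      for i
    by (cases "g i") (simp add: pmf_pair)
  then have "pmf (Pi_pmf A (d, d') (\<lambda>i. pair_pmf (p i) (q i))) g =
      pmf (Pi_pmf A d p) (fst \<circ> g) * pmf (Pi_pmf A d' q) (snd \<circ> g)"
    using assms by (auto simp: pmf_Pi prod.distrib prod_eq_iff)
  ultimately show "pmf (Pi_pmf A (d, d') (\<lambda>i. pair_pmf (p i) (q i))) g =
      pmf (map_pmf (\<lambda>(f, f') i. (f i, f' i)) (pair_pmf (Pi_pmf A d p) (Pi_pmf A d' q))) g"
    by (simp add: pmf_pair)
qed

lemma pmf_Poisson: "0 \<le> \<mu> \<Longrightarrow> pmf (Poisson \<mu>) k = \<mu> ^ k / fact k * exp (- \<mu>)"
  by (cases "\<mu> = 0") (auto simp: Poisson_def pmf_return power_0_left)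

lemma Poisson_add:
  assumes "0 \<le> \<mu>" "0 \<le> \<nu>"
  shows "Poisson \<mu> \<bind> (\<lambda>k. map_pmf ((+) k) (Poisson \<nu>)) = Poisson (\<mu> + \<nu>)"
proof (rule pmf_eqI)
  fix c
  have shift: "pmf (map_pmf ((+) k) (Poisson \<nu>)) c =
      (if k \<le> c then pmf (Poisson \<nu>) (c - k) else 0)" for k
  proof (cases "k \<le> c")
    case True
    then show ?thesis using pmf_map_inj'[of "(+) k" "Poisson \<nu>" "c - k"] by simp
  next
    case False
    then have "c \<notin> (+) k ` set_pmf (Poisson \<nu>)" by auto
    then show ?thesis using False by (simp add: pmf_map_outside)
  qed
  have "pmf (Poisson \<mu> \<bind> (\<lambda>k. map_pmf ((+) k) (Poisson \<nu>))) c =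
      (\<Sum>k\<le>c. pmf (Poisson \<mu>) k * pmf (Poisson \<nu>) (c - k))"
    unfolding pmf_bind shift
    by (subst integral_measure_pmf[of "{..c}"]) (auto split: if_splits intro!: sum.cong)
  also have "\<dots> = (\<Sum>k\<le>c. of_nat (c choose k) * \<mu> ^ k * \<nu> ^ (c - k)) * (exp (- (\<mu> + \<nu>)) / fact c)"
    unfolding sum_distrib_right
  proof (intro sum.cong refl)
    fix k assume "k \<in> {..c}"
    then show "pmf (Poisson \<mu>) k * pmf (Poisson \<nu>) (c - k) =
      of_nat (c choose k) * \<mu> ^ k * \<nu> ^ (c - k) * (exp (- (\<mu> + \<nu>)) / fact c)"
      using assms
      by (simp add: pmf_Poisson binomial_fact exp_add[symmetric] exp_minus_inverse field_simps)
  qed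
  also have "\<dots> = pmf (Poisson (\<mu> + \<nu>)) c"
    using assms by (simp add: pmf_Poisson flip: binomial_ring)
  finally show "pmf (Poisson \<mu> \<bind> (\<lambda>k. map_pmf ((+) k) (Poisson \<nu>))) c = pmf (Poisson (\<mu> + \<nu>)) c" .
qed

subsection \<open>Relabeling a random node\<close>

lemma shuffle_pmf_const: "shuffle_pmf c (\<lambda>_. p) = node_pmf c (\<lambda>_. p)"
  by (simp add: shuffle_pmf_def)

lemma Pi_pmf_bind_shuffle_pmf:
  "Pi_pmf {1..c} d P \<bind> (\<lambda>F. shuffle_pmf c (\<lambda>i. K i (F i))) = shuffle_pmf c (\<lambda>i. P i \<bind> K i)"
proof -
  have "Pi_pmf {1..c} d P \<bind> (\<lambda>F. node_pmf c (\<lambda>j. K (inv \<pi> j) (F (inv \<pi> j)))) =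
      node_pmf c (\<lambda>j. P (inv \<pi> j) \<bind> K (inv \<pi> j))" if \<pi>: "\<pi> permutes {1..c}" for \<pi>
  proof -
    have "node_pmf c (\<lambda>j. P (inv \<pi> j) \<bind> K (inv \<pi> j)) =
      map_pmf (node c) (Pi_pmf {1..c} d (P \<circ> inv \<pi>) \<bind>
        (\<lambda>F. Pi_pmf {1..c} {[]} (\<lambda>j. K (inv \<pi> j) (F j))))"
      unfolding node_pmf_def by (subst Pi_pmf_bind[where d' = d]) (auto simp: o_def)
    also have "Pi_pmf {1..c} d (P \<circ> inv \<pi>) = map_pmf (\<lambda>F. F \<circ> inv \<pi>) (Pi_pmf {1..c} d P)"
      by (rule Pi_pmf_permute[OF permutes_inv[OF \<pi>], symmetric]) simp
    finally show ?thesis by (simp add: node_pmf_def map_bind_pmf bind_map_pmf o_def)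
  qed
  then show ?thesis
    unfolding shuffle_pmf_def
    by (subst bind_commute_pmf) (intro bind_pmf_cong refl, simp)
qed

lemma relabeling_pmf_node:
  assumes "\<And>i. i \<in> {1..c} \<Longrightarrow> F i \<in> ltrees_upto n"
  shows "relabeling_pmf (Suc m) (node c F) = shuffle_pmf c (\<lambda>i. relabeling_pmf m (F i))"
proof -
  have "nchildren (node c F) [] = c"
    using assms by (intro nchildren_node) (auto intro: Nil_in_ltrees_upto)
  then show ?thesis by (auto simp: subtree_node intro!: shuffle_pmf_cong)
qed

lemma node_pmf_bind_relabeling_pmf:
  assumes "\<And>i. i \<in> {1..c} \<Longrightarrow> set_pmf (P i) \<subseteq> ltrees_upto n"
  shows "node_pmf c P \<bind> relabeling_pmf (Suc m) = shuffle_pmf c (\<lambda>i. P i \<bind> relabeling_pmf m)"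
proof -
  have "node_pmf c P \<bind> relabeling_pmf (Suc m) =
      Pi_pmf {1..c} {[]} P \<bind> (\<lambda>F. shuffle_pmf c (\<lambda>i. relabeling_pmf m (F i)))"
    unfolding node_pmf_def bind_map_pmf
  proof (intro bind_pmf_cong refl)
    fix F assume "F \<in> set_pmf (Pi_pmf {1..c} {[]} P)"
    from set_Pi_pmf_in[OF this] assms
    show "relabeling_pmf (Suc m) (node c F) = shuffle_pmf c (\<lambda>i. relabeling_pmf m (F i))"
      by (intro relabeling_pmf_node) blast
  qed
  then show ?thesis
    using Pi_pmf_bind_shuffle_pmf[of c "{[]}" P "\<lambda>_. relabeling_pmf m"] by simp
qed

lemma GW_pmf_bind_relabeling_pmf: "GW_pmf \<mu> n \<bind> relabeling_pmf n = GW_pmf \<mu> n"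
proof (induction n)
  case (Suc n)
  show ?case
    unfolding GW_pmf.simps bind_assoc_pmf
    by (simp add: node_pmf_bind_relabeling_pmf[OF set_GW_pmf] Suc shuffle_pmf_const
        del: relabeling_pmf.simps)
qed (simp add: bind_return_pmf)

subsection \<open>Completing common children\<close>

definition completion_pmf :: "real \<Rightarrow> nat \<Rightarrow> nat \<Rightarrow> nat \<Rightarrow> (nat \<Rightarrow> ltree) \<Rightarrow> ltree pmf" where
  "completion_pmf lam n k a f =
     shuffle_pmf (k + a) (\<lambda>i. if i \<le> k then return_pmf (f i) else GW_pmf lam n)"

lemma completion_pmf_cong:
  "(\<And>i. i \<in> {1..k} \<Longrightarrow> f i = f' i) \<Longrightarrow> completion_pmf lam n k a f = completion_pmf lam n k a f'"
  unfolding completion_pmf_def by (rule shuffle_pmf_cong) auto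

lemma Pi_pmf_bind_completion_pmf:
  "Pi_pmf {1..k} {[]} P \<bind> completion_pmf lam n k a =
    shuffle_pmf (k + a) (\<lambda>i. if i \<le> k then P i else GW_pmf lam n)"
proof -
  let ?P = "\<lambda>i. if i \<in> {1..k} then P i else return_pmf {[]}"
  have "Pi_pmf {1..k} {[]} P = Pi_pmf {1..k + a} {[]} ?P"
    by (subst Pi_pmf_subset'[of "{1..k + a}" "{1..k}"]) (auto intro!: Pi_pmf_cong)
  then have "Pi_pmf {1..k} {[]} P \<bind> completion_pmf lam n k a =
      shuffle_pmf (k + a) (\<lambda>i. ?P i \<bind> (\<lambda>x. if i \<le> k then return_pmf x else GW_pmf lam n))"
    using Pi_pmf_bind_shuffle_pmf[of "k + a" "{[]}" ?P
        "\<lambda>i x. if i \<le> k then return_pmf x else GW_pmf lam n"]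
    by (simp add: completion_pmf_def[abs_def])
  also have "\<dots> = shuffle_pmf (k + a) (\<lambda>i. if i \<le> k then P i else GW_pmf lam n)"
    by (rule shuffle_pmf_cong) (auto simp: bind_return_pmf bind_return_pmf')
  finally show ?thesis .
qed

lemma Pi_GW_pmf_bind_completion_pmf:
  "Pi_pmf {1..k} {[]} (\<lambda>_. GW_pmf lam n) \<bind> completion_pmf lam n k a =
    node_pmf (k + a) (\<lambda>_. GW_pmf lam n)"
  by (simp add: Pi_pmf_bind_completion_pmf shuffle_pmf_const)

lemma relabeled_augmentation_pmf_0: "relabeled_augmentation_pmf lam s 0 t = return_pmf {[]}"
  by (simp add: relabeled_augmentation_pmf_def bind_return_pmf)

lemma relabeled_augmentation_pmf_Suc:
  "relabeled_augmentation_pmf lam s (Suc n) t = Poisson (lam * (1 - s)) \<bind> (\<lambda>a.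
     Pi_pmf {1..nchildren t []} {[]} (\<lambda>i. relabeled_augmentation_pmf lam s n (subtree t i)) \<bind>
     completion_pmf lam n (nchildren t []) a)"
proof -
  let ?k = "nchildren t []"
  let ?P = "\<lambda>i. if i \<le> ?k then augmentation_pmf lam s n (subtree t i) else GW_pmf lam n"
  have relabeled: "(\<lambda>i. ?P i \<bind> relabeling_pmf n) =
      (\<lambda>i. if i \<le> ?k then relabeled_augmentation_pmf lam s n (subtree t i) else GW_pmf lam n)"
    by (auto simp: relabeled_augmentation_pmf_def GW_pmf_bind_relabeling_pmf)
  have "node_pmf (?k + a) ?P \<bind> relabeling_pmf (Suc n) =
      shuffle_pmf (?k + a) (\<lambda>i. ?P i \<bind> relabeling_pmf n)" for a
    by (rule node_pmf_bind_relabeling_pmf[where n = n])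
       (use set_augmentation_pmf set_GW_pmf in auto)
  then show ?thesis
    by (simp add: relabeled_augmentation_pmf_def[of lam s "Suc n"] bind_assoc_pmf relabeled
        Pi_pmf_bind_completion_pmf del: relabeling_pmf.simps)
qed

lemma relabeled_augmentation_pmf_Suc_node:
  assumes "\<And>i. i \<in> {1..k} \<Longrightarrow> T i \<in> ltrees_upto m"
  shows "relabeled_augmentation_pmf lam s (Suc n) (node k T) = Poisson (lam * (1 - s)) \<bind> (\<lambda>a.
     Pi_pmf {1..k} {[]} (\<lambda>i. relabeled_augmentation_pmf lam s n (T i)) \<bind> completion_pmf lam n k a)"
proof -
  have "nchildren (node k T) [] = k"
    using assms by (intro nchildren_node) (auto intro: Nil_in_ltrees_upto)
  moreover have
    "Pi_pmf {1..k} {[]} (\<lambda>i. relabeled_augmentation_pmf lam s n (subtree (node k T) i)) =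
      Pi_pmf {1..k} {[]} (\<lambda>i. relabeled_augmentation_pmf lam s n (T i))"
    by (intro Pi_pmf_cong) (auto simp: subtree_node)
  ultimately show ?thesis by (simp add: relabeled_augmentation_pmf_Suc)
qed

lemma GW_pmf_Suc_bind:
  assumes "\<And>k T. (\<And>i. i \<in> {1..k} \<Longrightarrow> T i \<in> ltrees_upto n) \<Longrightarrow> f (node k T) = g k T"
  shows "GW_pmf \<mu> (Suc n) \<bind> f =
    Poisson \<mu> \<bind> (\<lambda>k. Pi_pmf {1..k} {[]} (\<lambda>_. GW_pmf \<mu> n) \<bind> g k)"
  unfolding GW_pmf.simps node_pmf_def bind_assoc_pmf bind_map_pmf
proof (intro bind_pmf_cong refl assms)
  fix k :: nat and T i
  assume T: "T \<in> set_pmf (Pi_pmf {1..k} {[]} (\<lambda>_. GW_pmf \<mu> n))" and "i \<in> {1..k}"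
  then show "T i \<in> ltrees_upto n" using set_Pi_pmf_in[OF T] set_GW_pmf by blast
qed

lemma GW_pmf_bind_relabeled_augmentation_pmf:
  assumes "0 < lam" "0 \<le> s" "s \<le> 1"
  shows "GW_pmf (lam * s) n \<bind> relabeled_augmentation_pmf lam s n = GW_pmf lam n"
proof (induction n)
  case 0 show ?case by (simp add: relabeled_augmentation_pmf_0 bind_return_pmf)
next
  case (Suc n)
  let ?q = "relabeled_augmentation_pmf lam s n" and ?A = "Poisson (lam * (1 - s))"
  have inner: "Pi_pmf {1..k} {[]} (\<lambda>_. GW_pmf (lam * s) n) \<bind>
      (\<lambda>T. Pi_pmf {1..k} {[]} (\<lambda>i. ?q (T i)) \<bind> completion_pmf lam n k a) =
      node_pmf (k + a) (\<lambda>_. GW_pmf lam n)" for k a :: nat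
  proof -
    have "Pi_pmf {1..k} {[]} (\<lambda>_. GW_pmf (lam * s) n) \<bind> (\<lambda>T. Pi_pmf {1..k} {[]} (\<lambda>i. ?q (T i))) =
        Pi_pmf {1..k} {[]} (\<lambda>_. GW_pmf lam n)"
      by (subst Suc.IH[symmetric], rule Pi_pmf_bind[symmetric]) simp
    then show ?thesis by (simp add: Pi_GW_pmf_bind_completion_pmf flip: bind_assoc_pmf)
  qed
  have "GW_pmf (lam * s) (Suc n) \<bind> relabeled_augmentation_pmf lam s (Suc n) =
      Poisson (lam * s) \<bind> (\<lambda>k. Pi_pmf {1..k} {[]} (\<lambda>_. GW_pmf (lam * s) n) \<bind> (\<lambda>T.
        ?A \<bind> (\<lambda>a. Pi_pmf {1..k} {[]} (\<lambda>i. ?q (T i)) \<bind> completion_pmf lam n k a)))"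
    by (rule GW_pmf_Suc_bind) (rule relabeled_augmentation_pmf_Suc_node)
  also have "\<dots> = Poisson (lam * s) \<bind> (\<lambda>k. ?A \<bind> (\<lambda>a. node_pmf (k + a) (\<lambda>_. GW_pmf lam n)))"
    by (simp only: bind_commute_pmf[of "Pi_pmf C d P" ?A for C d P] inner)
  also have "\<dots> = (Poisson (lam * s) \<bind> (\<lambda>k. map_pmf ((+) k) ?A)) \<bind>
      (\<lambda>c. node_pmf c (\<lambda>_. GW_pmf lam n))"
    by (simp add: bind_assoc_pmf bind_map_pmf)
  also have "Poisson (lam * s) \<bind> (\<lambda>k. map_pmf ((+) k) ?A) = Poisson lam"
    using Poisson_add[of "lam * s" "lam * (1 - s)"] assms by (simp add: algebra_simps)
  finally show ?case by simp
qed

subsection \<open>The branching recursion\<close>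

definition branch :: "'r pmf \<Rightarrow> ('r \<Rightarrow> nat) \<Rightarrow> 's \<Rightarrow> 's pmf \<Rightarrow> ('r \<times> (nat \<Rightarrow> 's)) pmf" where
  "branch \<rho> \<kappa> d p = \<rho> \<bind> (\<lambda>r. map_pmf (Pair r) (Pi_pmf {1..\<kappa> r} d (\<lambda>_. p)))"

lemma set_branch:
  assumes "(r, G) \<in> set_pmf (branch \<rho> \<kappa> d p)"
  shows "r \<in> set_pmf \<rho>" "\<And>i. i \<in> {1..\<kappa> r} \<Longrightarrow> G i \<in> set_pmf p"
  using assms by (auto simp: branch_def intro: set_Pi_pmf_in)

definition root_degrees_pmf :: "real \<Rightarrow> real \<Rightarrow> (nat \<times> nat \<times> nat) pmf" where
  "root_degrees_pmf lam s =
     pair_pmf (Poisson (lam * s)) (pair_pmf (Poisson (lam * (1 - s))) (Poisson (lam * (1 - s))))"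

definition pair_completion_pmf ::
  "real \<Rightarrow> nat \<Rightarrow> nat \<times> nat \<times> nat \<Rightarrow> (nat \<Rightarrow> ltree \<times> ltree) \<Rightarrow> (ltree \<times> ltree) pmf" where
  "pair_completion_pmf lam n = (\<lambda>(k, a, a') g.
     pair_pmf (completion_pmf lam n k a (fst \<circ> g)) (completion_pmf lam n k a' (snd \<circ> g)))"

lemma P1_pmf_Suc:
  "P1_pmf lam s (Suc n) = branch (root_degrees_pmf lam s) fst ({[]}, {[]}) (P1_pmf lam s n) \<bind>
     (\<lambda>(r, g). pair_completion_pmf lam n r g)"
proof -
  let ?A = "Poisson (lam * (1 - s))" and ?q = "relabeled_augmentation_pmf lam s n"
  let ?F = "\<lambda>k T. Pi_pmf {1..k} {[]} (\<lambda>i. ?q (T i))" and ?C = "completion_pmf lam n"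
  have pairs: "Pi_pmf {1..k} ({[]}, {[]}) (\<lambda>_. P1_pmf lam s n) =
      Pi_pmf {1..k} {[]} (\<lambda>_. GW_pmf (lam * s) n) \<bind>
      (\<lambda>T. map_pmf (\<lambda>(f, f') i. (f i, f' i)) (pair_pmf (?F k T) (?F k T)))" for k :: nat
    unfolding P1_pmf_def by (simp add: Pi_pmf_bind[where d' = "{[]}"] Pi_pmf_pair)
  have "P1_pmf lam s (Suc n) = Poisson (lam * s) \<bind>
      (\<lambda>k. Pi_pmf {1..k} {[]} (\<lambda>_. GW_pmf (lam * s) n) \<bind>
      (\<lambda>T. pair_pmf (?A \<bind> (\<lambda>a. ?F k T \<bind> ?C k a)) (?A \<bind> (\<lambda>a. ?F k T \<bind> ?C k a))))"
    unfolding P1_pmf_def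
    by (rule GW_pmf_Suc_bind)
       (intro arg_cong2[where f = pair_pmf] relabeled_augmentation_pmf_Suc_node)
  also have "\<dots> = do {
      k \<leftarrow> Poisson (lam * s); a \<leftarrow> ?A; a' \<leftarrow> ?A; T \<leftarrow> Pi_pmf {1..k} {[]} (\<lambda>_. GW_pmf (lam * s) n);
      f \<leftarrow> ?F k T; f' \<leftarrow> ?F k T; x \<leftarrow> ?C k a f; y \<leftarrow> ?C k a' f'; return_pmf (x, y)}"
    unfolding pair_pmf_def bind_assoc_pmf
    by (simp only: bind_commute_pmf[of "completion_pmf lam n k a f" ?A for k a f]
       bind_commute_pmf[of "Pi_pmf B d P" ?A for B d P]
       bind_commute_pmf[of "completion_pmf lam n k a f" "Pi_pmf B d P" for k a f B d P])
  also have "\<dots> = do {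
      k \<leftarrow> Poisson (lam * s); a \<leftarrow> ?A; a' \<leftarrow> ?A; g \<leftarrow> Pi_pmf {1..k} ({[]}, {[]}) (\<lambda>_. P1_pmf lam s n);
      pair_completion_pmf lam n (k, a, a') g}"
    by (simp add: pairs pair_completion_pmf_def pair_pmf_def map_pmf_def bind_assoc_pmf
      bind_return_pmf
        o_def)
  finally show ?thesis
    by (simp add: branch_def root_degrees_pmf_def pair_pmf_def map_pmf_def bind_assoc_pmf
        bind_return_pmf)
qed

section \<open>Likelihood ratios of discrete distributions\<close>

definition likelihood_ratio :: "'a pmf \<Rightarrow> 'a pmf \<Rightarrow> 'a \<Rightarrow> real" where
  "likelihood_ratio P Q x = pmf Q x / pmf P x"

lemma likelihood_ratio_nonneg: "0 \<le> likelihood_ratio P Q x"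
  by (simp add: likelihood_ratio_def)

lemma prob_le_mult_prob:
  assumes "0 \<le> c" "\<And>x. x \<in> A \<Longrightarrow> pmf p x \<le> c * pmf q x"
  shows "measure_pmf.prob p A \<le> c * measure_pmf.prob q A"
proof -
  have "emeasure (measure_pmf p) A = (\<integral>\<^sup>+x. ennreal (pmf p x) \<partial>count_space A)"
    by (simp add: nn_integral_pmf)
  also have "\<dots> \<le> (\<integral>\<^sup>+x. ennreal c * ennreal (pmf q x) \<partial>count_space A)"
    using assms by (intro nn_integral_mono) (auto simp: ennreal_mult'[symmetric])
  also have "\<dots> = ennreal c * emeasure (measure_pmf q) A"
    by (simp add: nn_integral_cmult nn_integral_pmf)
  finally show ?thesis
    using assms(1) by (simp add: measure_pmf.emeasure_eq_measure ennreal_mult'[symmetric])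
qed

lemma integrable_pmf_bounded:
  fixes f :: "'a \<Rightarrow> real"
  assumes "\<And>x. \<bar>f x\<bar> \<le> C" shows "integrable (measure_pmf p) f"
  by (rule measure_pmf.integrable_const_bound[where B = C]) (use assms in auto)

lemma integrable_pmf_indicator: "integrable (measure_pmf p) (indicator A :: _ \<Rightarrow> real)"
  by (rule integrable_pmf_bounded[of _ 1]) (simp add: indicator_def)

lemma square_le_2_exp: "0 \<le> x \<Longrightarrow> x\<^sup>2 \<le> 2 * exp (x :: real)"
  using exp_lower_Taylor_quadratic[of x] by linarith

lemma abs_le_1_add_square: "\<bar>x\<bar> \<le> 1 + x\<^sup>2" for x :: real
proof -
  have "0 \<le> (\<bar>x\<bar> - 1)\<^sup>2 + \<bar>x\<bar>" by simp
  then show ?thesis by (simp add: power2_eq_square algebra_simps)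
qed

locale dominated_pmf =
  fixes P Q :: "'a pmf"
  assumes set_pmf_subset: "set_pmf Q \<subseteq> set_pmf P"
begin

abbreviation lr :: "'a \<Rightarrow> real" where "lr \<equiv> likelihood_ratio P Q"

lemma pmf_eq_lr_mult: "pmf Q x = lr x * pmf P x"
  using set_pmf_subset by (auto simp: likelihood_ratio_def set_pmf_eq)

lemma lr_pos: "x \<in> set_pmf Q \<Longrightarrow> 0 < lr x"
  using likelihood_ratio_nonneg[of P Q x] pmf_eq_lr_mult[of x] by (auto simp: set_pmf_eq less_le)

lemma measure_pmf_eq_density: "measure_pmf Q = density (measure_pmf P) (\<lambda>x. ennreal (lr x))"
proof (rule measure_eqI)
  fix A
  have "emeasure (density (measure_pmf P) (\<lambda>x. ennreal (lr x))) A =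
      (\<integral>\<^sup>+x. ennreal (lr x) * indicator A x \<partial>P)" by (subst emeasure_density) auto
  also have "\<dots> = (\<integral>\<^sup>+x. ennreal (pmf P x) * (ennreal (lr x) * indicator A x) \<partial>count_space UNIV)"
    by (simp add: nn_integral_measure_pmf)
  also have "\<dots> = (\<integral>\<^sup>+x. ennreal (pmf Q x) * indicator A x \<partial>count_space UNIV)"
    by (intro nn_integral_cong)
       (simp add: pmf_eq_lr_mult ennreal_mult' likelihood_ratio_nonneg ac_simps)
  also have "\<dots> = emeasure Q A"
    by (simp add: nn_integral_pmf[symmetric] nn_integral_count_space_indicator)
  finally show "emeasure Q A = emeasure (density (measure_pmf P) (\<lambda>x. ennreal (lr x))) A" by simp
qed simp

lemma nn_integral_eq_lr: "(\<integral>\<^sup>+x. f x \<partial>Q) = (\<integral>\<^sup>+x. ennreal (lr x) * f x \<partial>P)"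
  unfolding measure_pmf_eq_density by (subst nn_integral_density) auto

lemma integral_eq_lr: "(\<integral>x. f x \<partial>Q) = (\<integral>x. lr x * f x \<partial>P)" for f :: "'a \<Rightarrow> real"
  unfolding measure_pmf_eq_density
  by (subst integral_real_density) (auto simp: likelihood_ratio_nonneg)

lemma integrable_lr: "integrable P lr"
proof -
  have "(\<integral>\<^sup>+x. ennreal (lr x) \<partial>P) = 1"
    using nn_integral_eq_lr[of "\<lambda>_. 1"] by (simp add: measure_pmf.emeasure_space_1[simplified])
  then show ?thesis by (intro integrableI_nonneg) (auto simp: likelihood_ratio_nonneg)
qed

lemma integral_lr_indicator: "(\<integral>x. lr x * indicator A x \<partial>P) = measure_pmf.prob Q A"
  using integral_eq_lr[of "indicator A"] by simp

lemma prob_le_if_lr_le: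
  assumes "0 \<le> c" "\<And>x. x \<in> A \<Longrightarrow> lr x \<le> c"
  shows "measure_pmf.prob Q A \<le> c * measure_pmf.prob P A"
  using assms by (intro prob_le_mult_prob) (auto simp: pmf_eq_lr_mult mult_right_mono)

lemma prob_ge_if_lr_ge:
  assumes "0 < c" "\<And>x. x \<in> A \<Longrightarrow> c \<le> lr x"
  shows "c * measure_pmf.prob P A \<le> measure_pmf.prob Q A"
proof -
  have "measure_pmf.prob P A \<le> (1 / c) * measure_pmf.prob Q A"
  proof (rule prob_le_mult_prob)
    fix x assume "x \<in> A"
    then have "c * pmf P x \<le> pmf Q x" using assms(2) by (simp add: pmf_eq_lr_mult mult_right_mono)
    then show "pmf P x \<le> (1 / c) * pmf Q x" using assms(1) by (simp add: field_simps)
  qed (use assms(1) in simp)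
  then show ?thesis using assms(1) by (simp add: field_simps)
qed

lemma prob_lr_gt_le:
  assumes "0 < c" shows "measure_pmf.prob P {x. lr x > c} \<le> 1 / c"
proof -
  have "c * measure_pmf.prob P {x. lr x > c} \<le> measure_pmf.prob Q {x. lr x > c}"
    by (rule prob_ge_if_lr_ge) (use assms in auto)
  also have "\<dots> \<le> 1" by simp
  finally show ?thesis using assms by (simp add: field_simps)
qed

lemma prob_lr_less_le:
  assumes "0 \<le> c" shows "measure_pmf.prob Q {x. lr x < c} \<le> c"
proof -
  have "measure_pmf.prob Q {x. lr x < c} \<le> c * measure_pmf.prob P {x. lr x < c}"
    by (rule prob_le_if_lr_le) (use assms in auto)
  also have "\<dots> \<le> c" using assms by (simp add: mult_left_le)
  finally show ?thesis .
qed

abbreviation neg_ln_lr_square :: "'a \<Rightarrow> real" where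
  "neg_ln_lr_square \<equiv> \<lambda>x. (ln (lr x))\<^sup>2 * indicator {x. lr x < 1} x"

lemma nn_integral_neg_ln_lr_square: "(\<integral>\<^sup>+x. ennreal (neg_ln_lr_square x) \<partial>Q) \<le> 2"
proof -
  have "(\<integral>\<^sup>+x. ennreal (neg_ln_lr_square x) \<partial>Q) = (\<integral>\<^sup>+x. ennreal (lr x * neg_ln_lr_square x) \<partial>P)"
    by (simp add: nn_integral_eq_lr ennreal_mult' likelihood_ratio_nonneg)
  also have "\<dots> \<le> (\<integral>\<^sup>+x. ennreal 2 \<partial>P)"
  proof (intro nn_integral_mono ennreal_leI)
    fix x
    have "lr x * (ln (lr x))\<^sup>2 \<le> 2" if "lr x < 1"
    proof (cases "lr x = 0")
      case False
      then have pos: "lr x > 0" using likelihood_ratio_nonneg[of P Q x] by simp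
      then have "(- ln (lr x))\<^sup>2 \<le> 2 * exp (- ln (lr x))"
        using that by (intro square_le_2_exp) auto
      then show ?thesis using pos by (simp add: exp_minus field_simps)
    qed simp
    then show "lr x * neg_ln_lr_square x \<le> 2" by (auto simp: indicator_def)
  qed
  also have "\<dots> = 2" by (simp add: measure_pmf.emeasure_space_1[simplified])
  finally show ?thesis .
qed

lemma integrable_neg_ln_lr_square: "integrable Q neg_ln_lr_square"
  using le_less_trans[OF nn_integral_neg_ln_lr_square, of \<infinity>] by (intro integrableI_nonneg) auto

lemma integral_neg_ln_lr_square: "(\<integral>x. neg_ln_lr_square x \<partial>Q) \<le> 2"
  using nn_integral_neg_ln_lr_square nn_integral_eq_integral[OF integrable_neg_ln_lr_square]
  by (simp flip: ennreal_numeral)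

lemma expectation_ln_lr_ge:
  assumes "1 \<le> a" and int: "integrable Q (\<lambda>x. ln (lr x))"
  shows "ln a * measure_pmf.prob Q {x. lr x > a} - 3 \<le> (\<integral>x. ln (lr x) \<partial>Q)"
proof -
  let ?g = neg_ln_lr_square and ?A = "{x. lr x > a}"
  have "(\<integral>x. ln a * indicator ?A x - (1 + ?g x) \<partial>Q) \<le> (\<integral>x. ln (lr x) \<partial>Q)"
  proof (rule integral_mono_AE[OF _ int])
    show "integrable Q (\<lambda>x. ln a * indicator ?A x - (1 + ?g x))"
      using integrable_neg_ln_lr_square integrable_pmf_indicator[of Q ?A] by auto
    have "ln a * indicator ?A x - (1 + ?g x) \<le> ln (lr x)" if "x \<in> set_pmf Q" for x
    proof -
      consider (small) "lr x < 1" | (middle) "1 \<le> lr x" "lr x \<le> a" | (large) "a < lr x"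
        by linarith
      then show ?thesis
      proof cases
        case small
        then show ?thesis using abs_le_1_add_square[of "ln (lr x)"] assms(1) by simp
      next
        case middle
        then have "ln a * indicator ?A x - (1 + ?g x) = - 1" "0 \<le> ln (lr x)" by simp_all
        then show ?thesis by linarith
      next
        case large
        then have "ln a \<le> ln (lr x)" using assms(1) by simp
        moreover have "ln a * indicator ?A x - (1 + ?g x) = ln a - 1"
          using large assms(1) by simp
        ultimately show ?thesis by linarith
      qed
    qed
    then show "AE x in Q. ln a * indicator ?A x - (1 + ?g x) \<le> ln (lr x)"
      by (simp add: AE_measure_pmf_iff)
  qed
  also have "(\<integral>x. ln a * indicator ?A x - (1 + ?g x) \<partial>Q) =
      ln a * measure_pmf.prob Q ?A - (1 + (\<integral>x. ?g x \<partial>Q))"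
    using integrable_neg_ln_lr_square integrable_pmf_indicator[of Q ?A] by simp
  finally show ?thesis using integral_neg_ln_lr_square by linarith
qed

end

subsection \<open>Sequences of likelihood ratios\<close>

lemma liminf_ereal_pos_iff:
  "liminf (\<lambda>d. ereal (f d)) > 0 \<longleftrightarrow> (\<exists>\<epsilon>>0. eventually (\<lambda>d. \<epsilon> \<le> f d) sequentially)"
proof
  assume "liminf (\<lambda>d. ereal (f d)) > 0"
  then obtain \<epsilon> where \<epsilon>: "0 < ereal \<epsilon>" "ereal \<epsilon> < liminf (\<lambda>d. ereal (f d))"
    using ereal_dense2 by blast
  then have "eventually (\<lambda>d. ereal \<epsilon> < ereal (f d)) sequentially" by (intro less_LiminfD)
  then have "eventually (\<lambda>d. \<epsilon> \<le> f d) sequentially" by eventually_elim simp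
  then show "\<exists>\<epsilon>>0. eventually (\<lambda>d. \<epsilon> \<le> f d) sequentially" using \<epsilon> by auto
next
  assume "\<exists>\<epsilon>>0. eventually (\<lambda>d. \<epsilon> \<le> f d) sequentially"
  then obtain \<epsilon> where "\<epsilon> > 0" "eventually (\<lambda>d. \<epsilon> \<le> f d) sequentially" by blast
  then have "ereal \<epsilon> \<le> liminf (\<lambda>d. ereal (f d))" by (intro Liminf_bounded) simp
  then show "liminf (\<lambda>d. ereal (f d)) > 0" using \<open>\<epsilon> > 0\<close> by (meson ereal_less(2) less_le_trans)
qed

lemma ex_diverging_selection:
  fixes R :: "nat \<Rightarrow> nat \<Rightarrow> bool"
  assumes R: "\<And>K. eventually (R K) sequentially"
  shows "\<exists>a. filterlim a at_top sequentially \<and> eventually (\<lambda>n. R (a n) n) sequentially"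
proof -
  define S where "S n = {K. K \<le> n \<and> (\<forall>n'\<ge>n. R K n')}" for n
  define a where "a n = Max (insert 0 (S n))" for n
  have fin: "finite (insert 0 (S n))" for n
    by (rule finite_subset[of _ "{..n}"]) (auto simp: S_def)
  have in_S: "eventually (\<lambda>n. K \<in> S n) sequentially" for K
  proof -
    obtain N where "\<forall>n\<ge>N. R K n" using R[of K] by (auto simp: eventually_sequentially)
    then show ?thesis unfolding eventually_sequentially
      by (intro exI[of _ "max N K"]) (auto simp: S_def)
  qed
  have "filterlim a at_top sequentially"
    unfolding filterlim_at_top
  proof
    fix K show "eventually (\<lambda>n. K \<le> a n) sequentially"
      using in_S[of K] by eventually_elim (auto simp: a_def intro!: Max_ge fin)
  qed
  moreover have "eventually (\<lambda>n. R (a n) n) sequentially"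
    using in_S[of 0]
  proof eventually_elim
    case (elim n)
    have "a n \<in> insert 0 (S n)" unfolding a_def by (rule Max_in[OF fin]) simp
    then have "a n \<in> S n" using elim by auto
    then show ?case by (auto simp: S_def)
  qed
  ultimately show ?thesis by blast
qed

lemma tendsto_SUP_ennreal_0_iff:
  fixes f :: "nat \<Rightarrow> real \<Rightarrow> real"
  assumes mono: "\<And>n. antimono (f n)" and nonneg: "\<And>n K. 0 \<le> f n K"
  shows "((\<lambda>K. SUP n. ennreal (f n K)) \<longlongrightarrow> 0) at_top \<longleftrightarrow> (\<forall>\<epsilon>>0. \<exists>K. \<forall>n. f n K < \<epsilon>)"
proof
  assume lim: "((\<lambda>K. SUP n. ennreal (f n K)) \<longlongrightarrow> 0) at_top"
  show "\<forall>\<epsilon>>0. \<exists>K. \<forall>n. f n K < \<epsilon>"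
  proof (intro allI impI)
    fix \<epsilon> :: real assume "0 < \<epsilon>"
    then have "eventually (\<lambda>K. (SUP n. ennreal (f n K)) < ennreal \<epsilon>) at_top"
      using order_tendstoD(2)[OF lim] by simp
    then obtain K where "(SUP n. ennreal (f n K)) < ennreal \<epsilon>" by (auto dest!: eventually_happens)
    then have "ennreal (f n K) < ennreal \<epsilon>" for n by (rule le_less_trans[OF SUP_upper[OF UNIV_I]])
    then show "\<exists>K. \<forall>n. f n K < \<epsilon>" using nonneg by (auto simp: ennreal_less_iff)
  qed
next
  assume small: "\<forall>\<epsilon>>0. \<exists>K. \<forall>n. f n K < \<epsilon>"
  show "((\<lambda>K. SUP n. ennreal (f n K)) \<longlongrightarrow> 0) at_top"
  proof (rule order_tendstoI)
    fix y :: ennreal assume "0 < y"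
    then obtain \<epsilon> where \<epsilon>: "0 < \<epsilon>" "ennreal \<epsilon> < y"
    proof (cases y)
      case (real r)
      then show ?thesis using \<open>0 < y\<close> by (intro that[of "r / 2"]) (auto simp: ennreal_lessI)
    next
      case top
      then show ?thesis by (intro that[of 1]) auto
    qed
    with small obtain K where K: "\<And>n. f n K < \<epsilon>" by blast
    show "eventually (\<lambda>K. (SUP n. ennreal (f n K)) < y) at_top"
      using eventually_ge_at_top[of K]
    proof eventually_elim
      case (elim K')
      have "f n K' \<le> \<epsilon>" for n using antimonoD[OF mono elim, of n] K[of n] by linarith
      then have "(SUP n. ennreal (f n K')) \<le> ennreal \<epsilon>" by (intro SUP_least ennreal_leI)
      then show ?case using \<epsilon> by order
    qed
  qed simp
qed

locale dominated_pmfs =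
  fixes P Q :: "nat \<Rightarrow> 'a pmf"
  assumes dominated_pmf: "dominated_pmf (P n) (Q n)"
begin

sublocale dominated_pmf "P n" "Q n" for n by (rule dominated_pmf)

definition ratio_test :: "(nat \<Rightarrow> real) \<Rightarrow> bool" where
  "ratio_test a \<longleftrightarrow> filterlim a at_top sequentially \<and>
     (\<exists>\<epsilon>>0. eventually (\<lambda>n. \<epsilon> \<le> measure_pmf.prob (Q n) {x. lr n x > a n}) sequentially)"

lemma ratio_testE:
  assumes "ratio_test a"
  obtains \<epsilon> where "0 < \<epsilon>"
    "eventually (\<lambda>n. \<epsilon> \<le> measure_pmf.prob (Q n) {x. lr n x > a n}) sequentially"
  using assms by (auto simp: ratio_test_def)

definition tight_lr :: bool where
  "tight_lr \<longleftrightarrow> (\<forall>\<epsilon>>0. \<exists>K. \<forall>n. measure_pmf.prob (Q n) {x. lr n x > K} < \<epsilon>)"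

lemma tight_lrE:
  assumes "tight_lr" "0 < \<epsilon>"
  obtains K where "\<And>n. measure_pmf.prob (Q n) {x. lr n x > K} < \<epsilon>"
  using assms unfolding tight_lr_def by blast

lemma tendsto_prob_lr_gt:
  assumes "filterlim a at_top sequentially"
  shows "(\<lambda>n. measure_pmf.prob (P n) {x. lr n x > a n}) \<longlonglongrightarrow> 0"
proof (rule tendsto_sandwich[where f = "\<lambda>_. 0" and h = "\<lambda>n. 1 / a n"])
  show "(\<lambda>n. 1 / a n) \<longlonglongrightarrow> 0"
    by (rule tendsto_divide_0[OF tendsto_const filterlim_at_top_imp_at_infinity[OF assms]])
  have "eventually (\<lambda>n. a n > 0) sequentially" using assms by (auto simp: filterlim_at_top_dense)
  then show "eventually (\<lambda>n. measure_pmf.prob (P n) {x. lr n x > a n} \<le> 1 / a n) sequentially"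
    by eventually_elim (rule prob_lr_gt_le)
qed auto

lemma prob_le_prob_lr_gt:
  assumes "0 < a" "a * measure_pmf.prob (P n) A \<le> \<delta>"
  shows "measure_pmf.prob (Q n) A \<le> measure_pmf.prob (Q n) {x. lr n x > a} + \<delta>"
proof -
  let ?low = "A \<inter> {x. lr n x \<le> a}"
  have "measure_pmf.prob (Q n) ?low \<le> a * measure_pmf.prob (P n) ?low"
    using assms(1) by (intro prob_le_if_lr_le) auto
  also have "\<dots> \<le> a * measure_pmf.prob (P n) A"
    using assms(1) by (intro mult_left_mono measure_pmf.finite_measure_mono) auto
  finally have "measure_pmf.prob (Q n) ?low \<le> \<delta>" using assms(2) by linarith
  moreover have "measure_pmf.prob (Q n) A \<le>
      measure_pmf.prob (Q n) {x. lr n x > a} + measure_pmf.prob (Q n) ?low"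
    by (rule order_trans[OF measure_pmf.finite_measure_mono measure_Un_le]) auto
  ultimately show ?thesis by linarith
qed

text \<open>The threshold \<open>1 / sqrt (P n (A n))\<close> diverges, while by the change of measure the part of
  \<open>A n\<close> below it has \<open>Q n\<close>-mass at most \<open>sqrt (P n (A n))\<close>; the summand \<open>1 / (n + 1)\<close> avoids
  division by zero.\<close>

lemma ex_ratio_test:
  assumes null: "(\<lambda>n. measure_pmf.prob (P n) (A n)) \<longlonglongrightarrow> 0"
    and mass: "0 < \<epsilon>" "eventually (\<lambda>n. \<epsilon> \<le> measure_pmf.prob (Q n) (A n)) sequentially"
  shows "\<exists>a. ratio_test a"
proof -
  define b where "b n = measure_pmf.prob (P n) (A n) + 1 / real (Suc n)" for n
  define a where "a n = 1 / sqrt (b n)" for n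
  have b_pos: "b n > 0" for n by (simp add: b_def add_nonneg_pos)
  have "b \<longlonglongrightarrow> 0"
    unfolding b_def using tendsto_add[OF null LIMSEQ_inverse_real_of_nat]
    by (simp add: inverse_eq_divide)
  then have sqrt_b: "(\<lambda>n. sqrt (b n)) \<longlonglongrightarrow> 0" using tendsto_real_sqrt by fastforce
  then have "filterlim a at_top sequentially"
    unfolding a_def using b_pos
    by (intro filterlim_inverse_at_top[of "\<lambda>n. sqrt (b n)", simplified inverse_eq_divide]) simp_all
  moreover have "eventually (\<lambda>n. sqrt (b n) < \<epsilon> / 2) sequentially"
    using order_tendstoD(2)[OF sqrt_b, of "\<epsilon> / 2"] mass(1) by simp
  then have "eventually (\<lambda>n. \<epsilon> / 2 \<le> measure_pmf.prob (Q n) {x. lr n x > a n}) sequentially"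
    using mass(2)
  proof eventually_elim
    case (elim n)
    have a_pos: "a n > 0" using b_pos[of n] by (simp add: a_def)
    have "a n * measure_pmf.prob (P n) (A n) \<le> a n * b n"
      using a_pos by (intro mult_left_mono) (auto simp: b_def)
    also have "\<dots> = sqrt (b n)" using b_pos[of n] by (simp add: a_def real_div_sqrt)
    finally show ?case using prob_le_prob_lr_gt[OF a_pos] elim by fastforce
  qed
  ultimately show ?thesis
    using mass(1) unfolding ratio_test_def by (intro exI[of _ a] conjI exI[of _ "\<epsilon> / 2"]) auto
qed

lemma filterlim_expectation_ln_lr:
  assumes "ratio_test a" and int: "\<And>n. integrable (Q n) (\<lambda>x. ln (lr n x))"
  shows "filterlim (\<lambda>n. \<integral>x. ln (lr n x) \<partial>Q n) at_top sequentially"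
proof -
  obtain \<epsilon> where \<epsilon>: "0 < \<epsilon>"
    "eventually (\<lambda>n. \<epsilon> \<le> measure_pmf.prob (Q n) {x. lr n x > a n}) sequentially"
    using assms(1) by (rule ratio_testE)
  have a: "filterlim a at_top sequentially" using assms(1) by (simp add: ratio_test_def)
  have "filterlim (\<lambda>n. - 3 + \<epsilon> * ln (a n)) at_top sequentially"
    by (intro filterlim_tendsto_add_at_top[OF tendsto_const]
        filterlim_tendsto_pos_mult_at_top[OF tendsto_const \<epsilon>(1)] filterlim_compose[OF ln_at_top a])
  moreover have "eventually (\<lambda>n. 1 \<le> a n) sequentially" using a unfolding filterlim_at_top
    by blast
  then have "eventually (\<lambda>n. - 3 + \<epsilon> * ln (a n) \<le> (\<integral>x. ln (lr n x) \<partial>Q n)) sequentially"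
    using \<epsilon>(2)
  proof eventually_elim
    case (elim n)
    have "\<epsilon> * ln (a n) \<le> ln (a n) * measure_pmf.prob (Q n) {x. lr n x > a n}"
      using elim by (subst mult.commute) (intro mult_left_mono, auto)
    then show ?case using expectation_ln_lr_ge[OF elim(1) int, of n] by linarith
  qed
  ultimately show ?thesis by (rule filterlim_at_top_mono)
qed

lemma not_tight_lr_if_ratio_test:
  assumes "ratio_test a" shows "\<not> tight_lr"
proof
  obtain \<epsilon> where \<epsilon>: "0 < \<epsilon>"
    "eventually (\<lambda>n. \<epsilon> \<le> measure_pmf.prob (Q n) {x. lr n x > a n}) sequentially"
    using assms by (rule ratio_testE)
  assume tight_lr
  then obtain K where K: "\<And>n. measure_pmf.prob (Q n) {x. lr n x > K} < \<epsilon>"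
    using \<epsilon>(1) by (rule tight_lrE) blast
  have "eventually (\<lambda>n. K < a n) sequentially"
    using assms unfolding ratio_test_def filterlim_at_top_dense by blast
  then have "eventually (\<lambda>n. False) sequentially"
    using \<epsilon>(2)
  proof eventually_elim
    case (elim n)
    have "measure_pmf.prob (Q n) {x. lr n x > a n} \<le> measure_pmf.prob (Q n) {x. lr n x > K}"
      using elim by (intro measure_pmf.finite_measure_mono) auto
    then show ?case using elim K[of n] by linarith
  qed
  then show False by simp
qed

lemma not_ratio_test_if_uniformly_dominated:
  assumes "\<And>\<epsilon>. 0 < \<epsilon> \<Longrightarrow>
    \<exists>C\<ge>0. \<forall>n A. measure_pmf.prob (Q n) A \<le> \<epsilon> + C * measure_pmf.prob (P n) A"
  shows "\<not> ratio_test a"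
proof
  assume test: "ratio_test a"
  then obtain \<epsilon> where \<epsilon>: "0 < \<epsilon>"
    "eventually (\<lambda>n. \<epsilon> \<le> measure_pmf.prob (Q n) {x. lr n x > a n}) sequentially"
    by (rule ratio_testE)
  obtain C where C: "C \<ge> 0"
    "\<And>n A. measure_pmf.prob (Q n) A \<le> \<epsilon> / 2 + C * measure_pmf.prob (P n) A"
    using assms[of "\<epsilon> / 2"] \<epsilon>(1) by auto
  have "(\<lambda>n. C * measure_pmf.prob (P n) {x. lr n x > a n}) \<longlonglongrightarrow> C * 0"
    using test unfolding ratio_test_def by (intro tendsto_intros tendsto_prob_lr_gt) blast
  then have "eventually (\<lambda>n. C * measure_pmf.prob (P n) {x. lr n x > a n} < \<epsilon> / 2) sequentially"
    using order_tendstoD(2)[of _ "C * 0" _ "\<epsilon> / 2"] \<epsilon>(1) by simp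
  then have "eventually (\<lambda>n. False) sequentially"
    using \<epsilon>(2)
  proof eventually_elim
    case (elim n)
    then show ?case using C(2)[of n "{x. lr n x > a n}"] by linarith
  qed
  then show False by simp
qed

end

locale projective_pmfs = dominated_pmfs P Q for P Q :: "nat \<Rightarrow> 'a pmf" +
  fixes proj :: "nat \<Rightarrow> 'a \<Rightarrow> 'a"
  assumes map_proj_P: "m \<le> n \<Longrightarrow> map_pmf (proj m) (P n) = P m"
    and map_proj_Q: "m \<le> n \<Longrightarrow> map_pmf (proj m) (Q n) = Q m"
begin

lemma prob_P_vimage_proj:
  "m \<le> n \<Longrightarrow> measure_pmf.prob (P n) (proj m -` A) = measure_pmf.prob (P m) A"
  using map_proj_P by (metis measure_map_pmf)

lemma prob_Q_vimage_proj:
  "m \<le> n \<Longrightarrow> measure_pmf.prob (Q n) (proj m -` A) = measure_pmf.prob (Q m) A"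
  using map_proj_Q by (metis measure_map_pmf)

text \<open>The event \<open>lr m > 2 K\<close> seen at a deeper level \<open>n\<close> has small \<open>P\<close>-probability, so most of
  its \<open>Q\<close>-mass lies in \<open>lr n > K\<close>; this replaces almost sure convergence of the ratio under \<open>Q\<close>.\<close>

lemma prob_lr_gt_persists:
  assumes "m \<le> n" "0 < K"
  shows "measure_pmf.prob (Q m) {x. lr m x > 2 * K} / 2 \<le> measure_pmf.prob (Q n) {x. lr n x > K}"
proof -
  let ?A = "{x. lr m x > 2 * K}"
  have "2 * K * measure_pmf.prob (P m) ?A \<le> measure_pmf.prob (Q m) ?A"
    using assms(2) by (intro prob_ge_if_lr_ge) auto
  then have "K * measure_pmf.prob (P n) (proj m -` ?A) \<le> measure_pmf.prob (Q m) ?A / 2"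
    unfolding prob_P_vimage_proj[OF assms(1)] by simp
  from prob_le_prob_lr_gt[OF assms(2) this] show ?thesis
    unfolding prob_Q_vimage_proj[OF assms(1)] by simp
qed

lemma ex_ratio_test_if_not_tight_lr:
  assumes "\<not> tight_lr" shows "\<exists>a. ratio_test a"
proof -
  obtain \<epsilon> where \<epsilon>: "0 < \<epsilon>" "\<And>K. \<exists>m. \<epsilon> \<le> measure_pmf.prob (Q m) {x. lr m x > K}"
    using assms by (auto simp: tight_lr_def not_less)
  have "eventually (\<lambda>n. \<epsilon> / 2 \<le> measure_pmf.prob (Q n) {x. lr n x > real K}) sequentially" for K
  proof -
    obtain m where m: "\<epsilon> \<le> measure_pmf.prob (Q m) {x. lr m x > 2 * (real K + 1)}"
      using \<epsilon>(2) by blast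
    show ?thesis
      using eventually_ge_at_top[of m]
    proof eventually_elim
      case (elim n)
      have "\<epsilon> / 2 \<le> measure_pmf.prob (Q n) {x. lr n x > real K + 1}"
        using prob_lr_gt_persists[OF elim, of "real K + 1"] m by simp
      also have "\<dots> \<le> measure_pmf.prob (Q n) {x. lr n x > real K}"
        by (intro measure_pmf.finite_measure_mono) auto
      finally show ?case .
    qed
  qed
  then obtain a where "filterlim a at_top sequentially"
    "eventually (\<lambda>n. \<epsilon> / 2 \<le> measure_pmf.prob (Q n) {x. lr n x > real (a n)}) sequentially"
    using ex_diverging_selection[of "\<lambda>K n. \<epsilon> / 2 \<le> measure_pmf.prob (Q n) {x. lr n x > real K}"]
    by blast
  then have "ratio_test (\<lambda>n. real (a n))"
    using \<epsilon>(1) unfolding ratio_test_def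
    by (intro conjI exI[of _ "\<epsilon> / 2"]) 
       (auto intro: filterlim_compose[OF filterlim_real_sequentially])
  then show "\<exists>a. ratio_test a" by blast
qed

lemma ex_ratio_test_iff_not_tight_lr: "(\<exists>a. ratio_test a) \<longleftrightarrow> \<not> tight_lr"
  using not_tight_lr_if_ratio_test ex_ratio_test_if_not_tight_lr by blast

end

section \<open>The likelihood ratio of correlated trees\<close>

locale correlated_trees =
  fixes lam s :: real
  assumes lam_pos: "lam > 0" and s_nonneg: "0 \<le> s" and s_le_1: "s \<le> 1"
begin

abbreviation p1 :: "nat \<Rightarrow> (ltree \<times> ltree) pmf" where "p1 n \<equiv> P1_pmf lam s n"
abbreviation p0 :: "nat \<Rightarrow> (ltree \<times> ltree) pmf" where "p0 n \<equiv> P0_pmf lam n"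
abbreviation gw :: "nat \<Rightarrow> ltree pmf" where "gw n \<equiv> GW_pmf lam n"
abbreviation \<mu> :: real where "\<mu> \<equiv> lam * s"
abbreviation \<nu> :: real where "\<nu> \<equiv> lam * (1 - s)"
abbreviation root_degrees :: "(nat \<times> nat \<times> nat) pmf" where
  "root_degrees \<equiv> root_degrees_pmf lam s"

lemma mu_nonneg: "0 \<le> \<mu>" and nu_nonneg: "0 \<le> \<nu>"
  using lam_pos s_nonneg s_le_1 by auto

lemma pmf_gw_pos: "x \<in> ltrees_upto n \<Longrightarrow> pmf (gw n) x > 0"
proof (induction n arbitrary: x)
  case 0 then show ?case by (simp add: ltrees_upto_0)
next
  case (Suc n)
  then obtain c f where x: "x = node c f" and f: "\<And>i. f i \<in> ltrees_upto n"
    by (blast elim: ltrees_upto_SucE)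
  have "pmf (Poisson lam) c > 0" using lam_pos by (simp add: pmf_Poisson)
  then show ?case
    unfolding x pmf_GW_pmf_node[OF f] using Suc.IH[OF f] by (intro mult_pos_pos prod_pos)
qed

lemma pmf_p0_pos: "x \<in> tree_pairs n \<Longrightarrow> pmf (p0 n) x > 0"
  by (cases x) (auto simp: P0_pmf_def pmf_pair pmf_gw_pos)

sublocale projective_pmfs p0 p1 prune2
proof unfold_locales
  show "set_pmf (p1 n) \<subseteq> set_pmf (p0 n)" for n
    using P1.set_p[of lam s n] pmf_p0_pos by (fastforce simp: set_pmf_eq)
qed (rule P0.map_prune2 P1.map_prune2, assumption)+

lemma L_eq_lr: "L lam s = lr"
  by (auto simp: fun_eq_iff L_eq_pmf_quotient likelihood_ratio_def)

subsection \<open>Tests\<close>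

lemma likelihood_test_iff:
  "(\<exists>a :: nat \<Rightarrow> real. filterlim a at_top sequentially \<and>
      (\<lambda>d. measure (pruned_law (P0 lam) d) {x \<in> tree_pairs d. lr d x > a d}) \<longlonglongrightarrow> 0 \<and>
      liminf (\<lambda>d. ereal (measure (pruned_law (P1 lam s) d) {x \<in> tree_pairs d. lr d x > a d})) > 0)
    \<longleftrightarrow> (\<exists>a. ratio_test a)"
  by (simp add: ratio_test_def liminf_ereal_pos_iff P0.measure_pruned_law P1.measure_pruned_law
      P0.prob_p_Int_tree_pairs P1.prob_p_Int_tree_pairs tendsto_prob_lr_gt cong: conj_cong)

lemma ex_one_sided_test_iff:
  "(\<exists>T. one_sided_test (pruned_law (P0 lam)) (pruned_law (P1 lam s)) T) \<longleftrightarrow> (\<exists>a. ratio_test a)"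
proof
  assume "\<exists>T. one_sided_test (pruned_law (P0 lam)) (pruned_law (P1 lam s)) T"
  then obtain T where "one_sided_test (pruned_law (P0 lam)) (pruned_law (P1 lam s)) T" by blast
  then have "(\<lambda>n. measure_pmf.prob (p0 n) {x. T n x = 1}) \<longlonglongrightarrow> 0"
    "\<exists>\<epsilon>>0. eventually (\<lambda>n. \<epsilon> \<le> measure_pmf.prob (p1 n) {x. T n x = 1}) sequentially"
    unfolding one_sided_test_def liminf_ereal_pos_iff
    by (simp_all add: P0.measure_pruned_law P1.measure_pruned_law P0.prob_p_Int_tree_pairs
        P1.prob_p_Int_tree_pairs)
  then show "\<exists>a. ratio_test a" using ex_ratio_test[of "\<lambda>n. {x. T n x = 1}"] by blast
next
  assume "\<exists>a. ratio_test a"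
  then obtain a :: "nat \<Rightarrow> real"
    where "(\<lambda>d. measure (pruned_law (P0 lam) d) {x \<in> tree_pairs d. lr d x > a d}) \<longlonglongrightarrow> 0"
      "liminf (\<lambda>d. ereal (measure (pruned_law (P1 lam s) d) {x \<in> tree_pairs d. lr d x > a d})) > 0"
    unfolding likelihood_test_iff[symmetric] by blast
  moreover have "{x \<in> tree_pairs d. (if lr d x > a d then 1 else 0 :: nat) = 1} =
      {x \<in> tree_pairs d. lr d x > a d}" for d
    by auto
  ultimately have "one_sided_test (pruned_law (P0 lam)) (pruned_law (P1 lam s))
      (\<lambda>d x. if lr d x > a d then 1 else 0)"
    unfolding one_sided_test_def by (intro conjI) auto
  then show "\<exists>T. one_sided_test (pruned_law (P0 lam)) (pruned_law (P1 lam s)) T" by blast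
qed

subsection \<open>Uniform integrability\<close>

lemma nn_integral_lr_tail:
  assumes "0 \<le> K"
  shows "(\<integral>\<^sup>+x. ennreal \<bar>lr n (prune2 n x)\<bar> * indicator {x. \<bar>lr n (prune2 n x)\<bar> > K} x \<partial>P0 lam) =
    ennreal (measure_pmf.prob (p1 n) {x. lr n x > K})"
proof -
  have "(\<integral>\<^sup>+x. ennreal \<bar>lr n (prune2 n x)\<bar> * indicator {x. \<bar>lr n (prune2 n x)\<bar> > K} x \<partial>P0 lam) =
     (\<integral>\<^sup>+x. ennreal (lr n (prune2 n x)) * indicator {x. lr n x > K} (prune2 n x) \<partial>P0 lam)"
    by (intro nn_integral_cong) (simp add: likelihood_ratio_nonneg indicator_def)
  also have "\<dots> = (\<integral>\<^sup>+x. ennreal (lr n x) * indicator {x. lr n x > K} x \<partial>p0 n)"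
    by (rule P0.nn_integral_prune2)
  also have "\<dots> = emeasure (p1 n) {x. lr n x > K}" by (simp add: nn_integral_eq_lr[symmetric])
  finally show ?thesis by (simp add: measure_pmf.emeasure_eq_measure)
qed

lemma measurable_lr: "(\<lambda>x. lr n (prune2 n x)) \<in> borel_measurable (P0 lam)"
  by (rule measurable_compose[OF P0.measurable_prune2_M]) simp

lemma uniformly_integrable_lr_iff:
  "uniformly_integrable (P0 lam) (\<lambda>d x. lr d (prune2 d x)) \<longleftrightarrow> \<not> (\<exists>a. ratio_test a)"
proof -
  let ?tail = "\<lambda>n K. measure_pmf.prob (p1 n) {x. lr n x > K}"
  have "eventually (\<lambda>K. (SUP n. \<integral>\<^sup>+x. ennreal \<bar>lr n (prune2 n x)\<bar> *
      indicator {x. \<bar>lr n (prune2 n x)\<bar> > K} x \<partial>P0 lam) = (SUP n. ennreal (?tail n K))) at_top"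
    using eventually_ge_at_top[of 0] by eventually_elim (simp add: nn_integral_lr_tail)
  then have "uniformly_integrable (P0 lam) (\<lambda>d x. lr d (prune2 d x)) \<longleftrightarrow>
      ((\<lambda>K. SUP n. ennreal (?tail n K)) \<longlongrightarrow> 0) at_top"
    using measurable_lr by (simp add: uniformly_integrable_def tendsto_cong)
  also have "\<dots> \<longleftrightarrow> tight_lr"
    unfolding tight_lr_def
    by (rule tendsto_SUP_ennreal_0_iff)
       (auto simp: antimono_def intro!: measure_pmf.finite_measure_mono)
  finally show ?thesis unfolding ex_ratio_test_iff_not_tight_lr by simp
qed

subsection \<open>The martingale\<close>

lemma sets_pruned_filtration:
  "sets (pruned_filtration d) = {prune2 d -` A \<inter> (ltrees \<times> ltrees) | A. A \<subseteq> tree_pairs d}"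
  unfolding pruned_filtration_def
  by (subst sets_vimage_algebra2) (use prune2_in_tree_pairs in auto)

lemma space_pruned_filtration [simp]: "space (pruned_filtration d) = ltrees \<times> ltrees"
  by (simp add: pruned_filtration_def)

lemma sets_pruned_filtration_mono:
  assumes "i \<le> j" shows "sets (pruned_filtration i) \<subseteq> sets (pruned_filtration j)"
proof
  fix C assume "C \<in> sets (pruned_filtration i)"
  then obtain A where A: "C = prune2 i -` A \<inter> (ltrees \<times> ltrees)"
    by (auto simp: sets_pruned_filtration)
  have "C = prune2 j -` (prune2 i -` A \<inter> tree_pairs j) \<inter> (ltrees \<times> ltrees)"
  proof (rule set_eqI)
    fix x show "x \<in> C \<longleftrightarrow> x \<in> prune2 j -` (prune2 i -` A \<inter> tree_pairs j) \<inter> (ltrees \<times> ltrees)"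
      unfolding A Int_iff vimage_eq prune2_prune2[OF assms] using prune2_in_tree_pairs[of x j]
      by blast
  qed
  then show "C \<in> sets (pruned_filtration j)" unfolding sets_pruned_filtration by blast
qed

lemma subalgebra_pruned_filtration: "subalgebra (P0 lam) (pruned_filtration n)"
  using P0.sets_vimage_prune2 by (auto simp: subalgebra_def sets_pruned_filtration P0.space_M)

lemma real_cond_exp_lr:
  assumes "m \<le> n"
  shows "AE x in P0 lam. real_cond_exp (P0 lam) (pruned_filtration m) (\<lambda>x. lr n (prune2 n x)) x =
    lr m (prune2 m x)"
proof -
  interpret P: prob_space "P0 lam" by (rule prob_space_P0)
  interpret finite_measure_subalgebra "P0 lam" "pruned_filtration m"
    by unfold_locales (rule subalgebra_pruned_filtration)
  have int: "integrable (P0 lam) (\<lambda>x. lr k (prune2 k x))" for k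
    unfolding P0.integrable_prune2 by (rule integrable_lr)
  show ?thesis
  proof (rule real_cond_exp_charact[OF _ int int])
    show "(\<lambda>x. lr m (prune2 m x)) \<in> borel_measurable (pruned_filtration m)"
      unfolding pruned_filtration_def
      by (rule measurable_compose[OF measurable_vimage_algebra1]) (use prune2_in_tree_pairs in auto)
    fix C assume "C \<in> sets (pruned_filtration m)"
    then obtain A where A: "C = prune2 m -` A \<inter> (ltrees \<times> ltrees)"
      by (auto simp: sets_pruned_filtration)
    have "(\<integral>x\<in>C. lr k (prune2 k x) \<partial>P0 lam) = measure_pmf.prob (p1 m) A" if "m \<le> k" for k
    proof -
      have "(\<integral>x\<in>C. lr k (prune2 k x) \<partial>P0 lam) =
          (\<integral>x. lr k (prune2 k x) * indicator (prune2 m -` A) (prune2 k x) \<partial>P0 lam)"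
        unfolding set_lebesgue_integral_def A
        by (intro Bochner_Integration.integral_cong)
           (auto simp: indicator_def prune2_prune2[OF that] P0.space_M)
      also have "\<dots> = (\<integral>x. lr k x * indicator (prune2 m -` A) x \<partial>p0 k)"
        by (rule P0.integral_prune2)
      finally show ?thesis using that by (simp add: integral_lr_indicator prob_Q_vimage_proj)
    qed
    from this[OF assms] this[OF order_refl]
    show "(\<integral>x\<in>C. lr n (prune2 n x) \<partial>P0 lam) = (\<integral>x\<in>C. lr m (prune2 m x) \<partial>P0 lam)" by simp
  qed
qed

lemma martingale_lr: "martingale (P0 lam) pruned_filtration (\<lambda>d x. lr d (prune2 d x))"
  unfolding martingale_def
proof (intro conjI allI impI)
  show "filtration (space (P0 lam)) pruned_filtration"
    by (rule filtration.intro) (use sets_pruned_filtration_mono in \<open>auto simp: P0.space_M\<close>)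
  show "(\<lambda>x. lr n (prune2 n x)) \<in> borel_measurable (pruned_filtration n)" for n
    unfolding pruned_filtration_def
    by (rule measurable_compose[OF measurable_vimage_algebra1]) (use prune2_in_tree_pairs in auto)
qed (use subalgebra_pruned_filtration real_cond_exp_lr in
     \<open>auto simp: P0.integrable_prune2 integrable_lr\<close>)

subsection \<open>The relative entropy\<close>

lemma pruned_law_P1_eq_density:
  "pruned_law (P1 lam s) d = density (pruned_law (P0 lam) d) (\<lambda>x. ennreal (lr d x))"
proof (rule measure_eqI)
  let ?M = "pruned_law (P0 lam) d" and ?N = "pruned_law (P1 lam s) d"
  fix A assume A: "A \<in> sets ?N"
  have "emeasure ?N A = (\<integral>\<^sup>+x. indicator A x \<partial>p1 d)"
    using A by (simp add: P1.nn_integral_pruned_law flip: nn_integral_indicator)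
  also have "\<dots> = (\<integral>\<^sup>+x. ennreal (lr d x) * indicator A x \<partial>?M)"
    unfolding P0.nn_integral_pruned_law by (rule nn_integral_eq_lr)
  also have "\<dots> = emeasure (density ?M (\<lambda>x. ennreal (lr d x))) A"
    using A by (subst emeasure_density) (auto simp: pruned_law_def measurable_def)
  finally show "emeasure ?N A = emeasure (density ?M (\<lambda>x. ennreal (lr d x))) A" .
qed (simp add: pruned_law_def)

lemma KL_eq_expectation: "KL lam s d = (\<integral>x. ln (lr d x) \<partial>p1 d)"
proof -
  let ?M = "pruned_law (P0 lam) d"
  interpret prob_space ?M
    unfolding pruned_law_def
    by (rule prob_space.prob_space_distr[OF prob_space_P0 P0.measurable_prune2_M_tree_pairs])
  have "KL lam s d = (\<integral>x. lr d x * log (exp 1) (lr d x) \<partial>?M)"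
    unfolding KL_def pruned_law_P1_eq_density
    by (intro KL_density) (auto simp: likelihood_ratio_nonneg pruned_law_def measurable_def)
  also have "\<dots> = (\<integral>x. lr d x * ln (lr d x) \<partial>p0 d)"
    by (simp add: log_def P0.integral_pruned_law)
  finally show ?thesis by (simp add: integral_eq_lr)
qed

end

section \<open>Second moments of branching sums\<close>

text \<open>Cauchy--Schwarz for \<open>X\<close> and the indicator of \<open>{X \<ge> m / 2}\<close>, in the form
  \<open>X \<le> (\<epsilon> X\<^sup>2 + 1 / \<epsilon>) / 2\<close> with the optimal \<open>\<epsilon>\<close>.\<close>

lemma (in prob_space) prob_ge_half_mean:
  assumes X: "random_variable borel X" "integrable M (\<lambda>x. (X x)\<^sup>2)"
    and m: "0 < m" "m \<le> expectation X" and V: "expectation (\<lambda>x. (X x)\<^sup>2) \<le> V"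
  shows "m\<^sup>2 / (4 * V) \<le> prob {x \<in> space M. X x \<ge> m / 2}"
proof -
  define A where "A = {x \<in> space M. X x \<ge> m / 2}"
  have int: "integrable M X" using X by (rule square_integrable_imp_integrable)
  have A: "A \<in> events" using X(1) unfolding A_def by measurable
  then have int_A: "integrable M (indicator A :: 'a \<Rightarrow> real)" by (simp add: less_top[symmetric])
  have "0 < (expectation X)\<^sup>2" using m by simp
  also have "\<dots> \<le> expectation (\<lambda>x. (X x)\<^sup>2)"
    using variance_eq[OF int X(2)] variance_positive[of X] by linarith
  finally have V_pos: "0 < V" using V by linarith
  define \<epsilon> where "\<epsilon> = m / (2 * V)"
  have \<epsilon>: "\<epsilon> > 0" using m V_pos by (simp add: \<epsilon>_def)
  have "X x \<le> m / 2 + (\<epsilon> / 2 * (X x)\<^sup>2 + 1 / (2 * \<epsilon>) * indicator A x)" if "x \<in> space M" for x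
  proof (cases "X x \<ge> m / 2")
    case True
    have "0 \<le> (\<epsilon> * X x - 1)\<^sup>2 / (2 * \<epsilon>)" using \<epsilon> by simp
    also have "\<dots> = \<epsilon> / 2 * (X x)\<^sup>2 - X x + 1 / (2 * \<epsilon>)"
      using \<epsilon> by (simp add: power2_eq_square field_simps)
    finally have "X x \<le> \<epsilon> / 2 * (X x)\<^sup>2 + 1 / (2 * \<epsilon>)" by simp
    then show ?thesis using True that m by (simp add: A_def)
  next
    case False
    moreover have "0 \<le> \<epsilon> / 2 * (X x)\<^sup>2" using \<epsilon> by simp
    ultimately show ?thesis by (simp add: A_def)
  qed
  then have "m \<le>
      expectation (\<lambda>x. m / 2 + (\<epsilon> / 2 * (X x)\<^sup>2 + 1 / (2 * \<epsilon>) * indicator A x))"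
    using int X int_A by (intro order_trans[OF m(2)] integral_mono) auto
  also have "\<dots> = m / 2 + (\<epsilon> / 2 * expectation (\<lambda>x. (X x)\<^sup>2) + 1 / (2 * \<epsilon>) * prob A)"
    using X int_A A by (simp add: prob_space)
  also have "\<dots> \<le> m / 2 + (\<epsilon> / 2 * V + 1 / (2 * \<epsilon>) * prob A)"
    using V \<epsilon> by (intro add_left_mono add_right_mono mult_left_mono) auto
  finally have "m / 4 \<le> V / m * prob A"
    using V_pos m by (simp add: \<epsilon>_def field_simps)
  then show ?thesis using V_pos m(1) unfolding A_def by (simp add: field_simps power2_eq_square)
qed

lemma integrable_pmf_of_square:
  fixes f :: "'a \<Rightarrow> real"
  shows "integrable (measure_pmf p) (\<lambda>x. (f x)\<^sup>2) \<Longrightarrow> integrable (measure_pmf p) f"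
  by (rule measure_pmf.square_integrable_imp_integrable) simp_all

lemma integral_shift_square:
  fixes f :: "'a \<Rightarrow> real"
  assumes "integrable (measure_pmf p) (\<lambda>x. (f x)\<^sup>2)"
  shows "integrable (measure_pmf p) (\<lambda>x. (\<alpha> + f x)\<^sup>2)"
    "(\<integral>x. (\<alpha> + f x)\<^sup>2 \<partial>p) = \<alpha>\<^sup>2 + 2 * \<alpha> * (\<integral>x. f x \<partial>p) + (\<integral>x. (f x)\<^sup>2 \<partial>p)"
proof -
  note int = integrable_pmf_of_square[OF assms]
  have eq: "(\<lambda>x. (\<alpha> + f x)\<^sup>2) = (\<lambda>x. \<alpha>\<^sup>2 + (2 * \<alpha> * f x + (f x)\<^sup>2))"
    by (auto simp: power2_eq_square algebra_simps)
  show "integrable (measure_pmf p) (\<lambda>x. (\<alpha> + f x)\<^sup>2)" unfolding eq using assms int by simp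
  show "(\<integral>x. (\<alpha> + f x)\<^sup>2 \<partial>p) = \<alpha>\<^sup>2 + 2 * \<alpha> * (\<integral>x. f x \<partial>p) + (\<integral>x. (f x)\<^sup>2 \<partial>p)"
    unfolding eq using assms int by simp
qed

definition centred :: "'a pmf \<Rightarrow> ('a \<Rightarrow> real) \<Rightarrow> real \<Rightarrow> bool" where
  "centred p f v \<longleftrightarrow> integrable p (\<lambda>x. (f x)\<^sup>2) \<and> (\<integral>x. f x \<partial>p) = 0 \<and> (\<integral>x. (f x)\<^sup>2 \<partial>p) \<le> v"

lemma centredD:
  assumes "centred p f v"
  shows "integrable p (\<lambda>x. (f x)\<^sup>2)" "(\<integral>x. f x \<partial>p) = 0" "(\<integral>x. (f x)\<^sup>2 \<partial>p) \<le> v"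
  using assms by (auto simp: centred_def)

lemma centred_nonneg: "centred p f v \<Longrightarrow> 0 \<le> v"
  using order_trans[of 0 "\<integral>x. (f x)\<^sup>2 \<partial>p" v] by (simp add: centred_def)

lemma centred_minus_mean:
  assumes "integrable (measure_pmf p) (\<lambda>x. (f x)\<^sup>2)"
  shows "centred p (\<lambda>x. f x - measure_pmf.expectation p f) (measure_pmf.variance p f)"
  using integral_shift_square(1)[OF assms, of "- measure_pmf.expectation p f"]
    integrable_pmf_of_square[OF assms] by (simp add: centred_def)

lemma centred_map_cong:
  assumes "map_pmf F p = map_pmf X q" "centred q X v" shows "centred p F v"
proof -
  have transfer: "integrable p (\<lambda>x. h (F x)) \<longleftrightarrow> integrable q (\<lambda>x. h (X x))"
    "(\<integral>x. h (F x) \<partial>p) = (\<integral>x. h (X x) \<partial>q)" for h :: "real \<Rightarrow> real"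
    using integrable_map_pmf_eq[of F p h] integrable_map_pmf_eq[of X q h]
      integral_map_pmf[of F p h] integral_map_pmf[of X q h] assms(1) by auto
  show ?thesis
    using assms(2) transfer[of "\<lambda>x. x\<^sup>2"] transfer[of "\<lambda>x. x"] by (simp add: centred_def)
qed

lemma centred_mono: "centred p f v \<Longrightarrow> v \<le> w \<Longrightarrow> centred p f w"
  by (auto simp: centred_def)

lemma centred_linear:
  assumes "centred p f v" "centred p g w"
  shows "centred p (\<lambda>x. a * f x + b * g x) (2 * a\<^sup>2 * v + 2 * b\<^sup>2 * w)"
proof -
  note f = centredD[OF assms(1)] and g = centredD[OF assms(2)]
  have square_le: "(a * f x + b * g x)\<^sup>2 \<le> 2 * a\<^sup>2 * (f x)\<^sup>2 + 2 * b\<^sup>2 * (g x)\<^sup>2" for x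
  proof -
    have "0 \<le> (a * f x - b * g x)\<^sup>2" by simp
    then show ?thesis by (simp add: power2_eq_square algebra_simps)
  qed
  have bound: "integrable p (\<lambda>x. 2 * a\<^sup>2 * (f x)\<^sup>2 + 2 * b\<^sup>2 * (g x)\<^sup>2)" using f g by simp
  have int: "integrable p (\<lambda>x. (a * f x + b * g x)\<^sup>2)"
    by (rule Bochner_Integration.integrable_bound[OF bound])
       (use square_le in \<open>auto intro: order_trans[OF square_le abs_ge_self]\<close>)
  have "(\<integral>x. (a * f x + b * g x)\<^sup>2 \<partial>p) \<le> (\<integral>x. 2 * a\<^sup>2 * (f x)\<^sup>2 + 2 * b\<^sup>2 * (g x)\<^sup>2 \<partial>p)"
    by (intro integral_mono int bound square_le)
  also have "\<dots> = 2 * a\<^sup>2 * (\<integral>x. (f x)\<^sup>2 \<partial>p) + 2 * b\<^sup>2 * (\<integral>x. (g x)\<^sup>2 \<partial>p)" using f g by simp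
  also have "\<dots> \<le> 2 * a\<^sup>2 * v + 2 * b\<^sup>2 * w" using f g by (intro add_mono mult_left_mono) auto
  finally show ?thesis
    using int f g integrable_pmf_of_square[OF f(1)] integrable_pmf_of_square[OF g(1)]
    by (simp add: centred_def)
qed

lemma centred_prob_abs_gt_le:
  assumes "centred p f v" "0 < c"
  shows "measure_pmf.prob p {x. \<bar>f x\<bar> > c} \<le> v / c\<^sup>2"
proof -
  note f = centredD[OF assms(1)]
  have "measure_pmf.prob p {x. \<bar>f x\<bar> > c} \<le>
      measure_pmf.prob p {x \<in> space p. c \<le> \<bar>f x - (\<integral>x. f x \<partial>p)\<bar>}"
    by (intro measure_pmf.finite_measure_mono) (auto simp: f(2))
  also have "\<dots> \<le> (\<integral>x. (f x - (\<integral>x. f x \<partial>p))\<^sup>2 \<partial>p) / c\<^sup>2"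
    by (rule measure_pmf.Chebyshev_inequality) (use f(1) assms(2) in auto)
  also have "\<dots> \<le> v / c\<^sup>2" using f by (simp add: divide_right_mono)
  finally show ?thesis .
qed

lemma nn_integral_Pi_pmf_square_sum:
  fixes f :: "'a \<Rightarrow> real"
  assumes f: "integrable (measure_pmf p) (\<lambda>x. (f x)\<^sup>2)" "(\<integral>x. f x \<partial>p) = 0" and "finite I"
  shows "(\<integral>\<^sup>+G. ennreal ((\<alpha> + (\<Sum>i\<in>I. f (G i)))\<^sup>2) \<partial>Pi_pmf I d (\<lambda>_. p)) =
    ennreal (\<alpha>\<^sup>2 + real (card I) * (\<integral>x. (f x)\<^sup>2 \<partial>p))"
  using assms(3)
proof (induction I arbitrary: \<alpha> rule: finite_induct)
  case empty show ?case by simp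
next
  case (insert i I)
  let ?v = "\<integral>x. (f x)\<^sup>2 \<partial>p"
  have v: "0 \<le> ?v" by simp
  have upd: "(\<Sum>j\<in>I. f (if j = i then y else G j)) = (\<Sum>j\<in>I. f (G j))" for G y
    using insert.hyps by (intro sum.cong) auto
  have "(\<integral>\<^sup>+G. ennreal ((\<alpha> + (\<Sum>j\<in>insert i I. f (G j)))\<^sup>2) \<partial>Pi_pmf (insert i I) d (\<lambda>_. p)) =
    (\<integral>\<^sup>+y. \<integral>\<^sup>+G. ennreal ((\<alpha> + f y + (\<Sum>j\<in>I. f (G j)))\<^sup>2) \<partial>Pi_pmf I d (\<lambda>_. p) \<partial>p)"
    using insert.hyps by (simp add: Pi_pmf_insert' upd add.assoc)
  also have "\<dots> = (\<integral>\<^sup>+y. ennreal ((\<alpha> + f y)\<^sup>2 + real (card I) * ?v) \<partial>p)"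
    by (simp only: insert.IH)
  also have "\<dots> = ennreal (\<integral>y. (\<alpha> + f y)\<^sup>2 + real (card I) * ?v \<partial>p)"
    using integral_shift_square(1)[OF f(1)] v by (intro nn_integral_eq_integral) auto
  also have "(\<integral>y. (\<alpha> + f y)\<^sup>2 + real (card I) * ?v \<partial>p) = \<alpha>\<^sup>2 + real (card (insert i I)) * ?v"
    using integral_shift_square[OF f(1), of \<alpha>] f(2) insert.hyps by (simp add: algebra_simps)
  finally show ?case .
qed

lemma branch_square_sum:
  fixes f :: "'s \<Rightarrow> real"
  assumes f: "integrable (measure_pmf p) (\<lambda>x. (f x)\<^sup>2)" "(\<integral>x. f x \<partial>p) = 0"
    and A: "integrable (measure_pmf \<rho>) (\<lambda>r. (A r)\<^sup>2)"
    and \<kappa>: "integrable (measure_pmf \<rho>) (\<lambda>r. real (\<kappa> r))"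
  shows "integrable (branch \<rho> \<kappa> d p) (\<lambda>(r, G). (A r + (\<Sum>i\<in>{1..\<kappa> r}. f (G i)))\<^sup>2)"
      (is "integrable ?J ?X")
    and "(\<integral>(r, G). (A r + (\<Sum>i\<in>{1..\<kappa> r}. f (G i)))\<^sup>2 \<partial>branch \<rho> \<kappa> d p) =
      (\<integral>r. (A r)\<^sup>2 \<partial>\<rho>) + (\<integral>r. real (\<kappa> r) \<partial>\<rho>) * (\<integral>x. (f x)\<^sup>2 \<partial>p)" (is "_ = ?E")
proof -
  let ?v = "\<integral>x. (f x)\<^sup>2 \<partial>p"
  have "(\<integral>\<^sup>+y. ennreal (?X y) \<partial>?J) = (\<integral>\<^sup>+r. ennreal ((A r)\<^sup>2 + real (\<kappa> r) * ?v) \<partial>\<rho>)"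
    by (simp add: branch_def nn_integral_Pi_pmf_square_sum[OF f])
  also have "\<dots> = ennreal (\<integral>r. (A r)\<^sup>2 + real (\<kappa> r) * ?v \<partial>\<rho>)"
    using A \<kappa> by (intro nn_integral_eq_integral) auto
  also have "(\<integral>r. (A r)\<^sup>2 + real (\<kappa> r) * ?v \<partial>\<rho>) = ?E" using A \<kappa> by simp
  finally have eq: "(\<integral>\<^sup>+y. ennreal (?X y) \<partial>?J) = ennreal ?E" .
  then show int: "integrable ?J ?X" by (intro integrableI_nonneg) auto
  have "ennreal (\<integral>y. ?X y \<partial>?J) = ennreal ?E"
    unfolding eq[symmetric] by (rule nn_integral_eq_integral[OF int, symmetric]) auto
  moreover have "0 \<le> (\<integral>y. ?X y \<partial>?J)" by (rule integral_nonneg_AE) auto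
  moreover have "0 \<le> ?E" by simp
  ultimately show "(\<integral>y. ?X y \<partial>?J) = ?E" by (rule ennreal_inj[THEN iffD1, rotated 2])
qed

text \<open>The mean vanishes because adding \<open>1\<close> to the sum raises its second moment by exactly \<open>1\<close>.\<close>

lemma centred_branch:
  assumes f: "centred p f v" and A: "centred \<rho> A w"
    and \<kappa>: "integrable (measure_pmf \<rho>) (\<lambda>r. real (\<kappa> r))"
  shows "centred (branch \<rho> \<kappa> d p) (\<lambda>(r, G). A r + (\<Sum>i\<in>{1..\<kappa> r}. f (G i)))
    (w + (\<integral>r. real (\<kappa> r) \<partial>\<rho>) * v)"
proof -
  let ?X = "\<lambda>(r, G). A r + (\<Sum>i\<in>{1..\<kappa> r}. f (G i))"
  let ?J = "branch \<rho> \<kappa> d p"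
  note f' = centredD[OF f] and A' = centredD[OF A]
  have case_square: "(case y of (r, G) \<Rightarrow> (A r + (\<Sum>i\<in>{1..\<kappa> r}. f (G i)))\<^sup>2) = (?X y)\<^sup>2"
     "(case y of (r, G) \<Rightarrow> (1 + A r + (\<Sum>i\<in>{1..\<kappa> r}. f (G i)))\<^sup>2) = (1 + ?X y)\<^sup>2" for y
    by (auto split: prod.splits simp: add.assoc)
  note sum = branch_square_sum[OF f'(1,2) A'(1) \<kappa>, of d, unfolded case_square]
  note shifted = branch_square_sum[OF f'(1,2) integral_shift_square(1)[OF A'(1), of 1] \<kappa>, of d,
      unfolded case_square]
  have "(\<integral>y. (1 + ?X y)\<^sup>2 \<partial>?J) = 1 + 2 * (\<integral>y. ?X y \<partial>?J) + (\<integral>y. (?X y)\<^sup>2 \<partial>?J)"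
    using integral_shift_square(2)[OF sum(1), of 1] by simp
  moreover have "(\<integral>y. (1 + ?X y)\<^sup>2 \<partial>?J) = 1 + (\<integral>y. (?X y)\<^sup>2 \<partial>?J)"
    unfolding shifted(2) sum(2) integral_shift_square(2)[OF A'(1)] using A'(2) by simp
  ultimately have "(\<integral>y. ?X y \<partial>?J) = 0" by simp
  moreover have "(\<integral>r. real (\<kappa> r) \<partial>\<rho>) * (\<integral>x. (f x)\<^sup>2 \<partial>p) \<le> (\<integral>r. real (\<kappa> r) \<partial>\<rho>) * v"
    using f'(3) by (intro mult_left_mono) auto
  ultimately show ?thesis unfolding centred_def using sum A'(3) by auto
qed

section \<open>Poisson moments\<close>

lemma expectation_nat_pmf_sums:
  fixes p :: "nat pmf" and g :: "nat \<Rightarrow> real"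
  assumes g: "\<And>k. 0 \<le> g k" and sums: "(\<lambda>k. pmf p k * g k) sums S"
  shows "integrable p g" "(\<integral>k. g k \<partial>p) = S"
proof -
  have "(\<integral>\<^sup>+k. ennreal (g k) \<partial>p) = (\<Sum>k. ennreal (pmf p k * g k))"
    unfolding nn_integral_measure_pmf nn_integral_count_space_nat by (simp add: ennreal_mult')
  also have "\<dots> = ennreal S"
    using g sums_unique[OF sums] sums_summable[OF sums] by (subst suminf_ennreal2) auto
  finally have eq: "(\<integral>\<^sup>+k. ennreal (g k) \<partial>p) = ennreal S" .
  then show "integrable p g" using g by (intro integrableI_nonneg) auto
  have "0 \<le> S" using g by (intro sums_le[OF _ sums_zero sums]) simp
  then show "(\<integral>k. g k \<partial>p) = S" using eq g by (subst integral_eq_nn_integral) auto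
qed

lemma Poisson_pgf:
  assumes "0 \<le> \<mu>" "0 \<le> z"
  shows "integrable (Poisson \<mu>) (\<lambda>k. z ^ k)" "(\<integral>k. z ^ k \<partial>Poisson \<mu>) = exp (\<mu> * (z - 1))"
proof -
  have "(\<lambda>k. exp (- \<mu>) * ((\<mu> * z) ^ k /\<^sub>R fact k)) sums (exp (- \<mu>) * exp (\<mu> * z))"
    by (intro sums_mult exp_converges)
  moreover have "exp (- \<mu>) * exp (\<mu> * z) = exp (\<mu> * (z - 1))"
    by (simp add: exp_add[symmetric] algebra_simps)
  moreover have "exp (- \<mu>) * ((\<mu> * z) ^ k /\<^sub>R fact k) = pmf (Poisson \<mu>) k * z ^ k" for k
    using assms by (simp add: pmf_Poisson power_mult_distrib divide_inverse)
  ultimately have sums: "(\<lambda>k. pmf (Poisson \<mu>) k * z ^ k) sums exp (\<mu> * (z - 1))" by (simp only:)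
  show "integrable (Poisson \<mu>) (\<lambda>k. z ^ k)" "(\<integral>k. z ^ k \<partial>Poisson \<mu>) = exp (\<mu> * (z - 1))"
    using assms(2) by (auto intro!: expectation_nat_pmf_sums[OF _ sums])
qed

lemma integrable_Poisson_exp:
  assumes "0 \<le> \<mu>" shows "integrable (Poisson \<mu>) (\<lambda>k. exp (c * real k))"
  using Poisson_pgf(1)[OF assms, of "exp c"]
  by (simp add: exp_of_nat_mult[symmetric] mult.commute)

lemma Poisson_mean:
  assumes "0 \<le> \<mu>" shows "integrable (Poisson \<mu>) real" "(\<integral>k. real k \<partial>Poisson \<mu>) = \<mu>"
proof -
  have "(\<lambda>k. exp (- \<mu>) * \<mu> * (\<mu> ^ k /\<^sub>R fact k)) sums (exp (- \<mu>) * \<mu> * exp \<mu>)"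
    by (intro sums_mult exp_converges)
  moreover have "exp (- \<mu>) * \<mu> * exp \<mu> = \<mu>" by (simp add: exp_minus)
  moreover have "exp (- \<mu>) * \<mu> * (\<mu> ^ k /\<^sub>R fact k) = pmf (Poisson \<mu>) (Suc k) * real (Suc k)"
      for k
    using assms by (simp add: pmf_Poisson fact_Suc divide_simps del: of_nat_Suc)
  ultimately have "(\<lambda>k. pmf (Poisson \<mu>) (Suc k) * real (Suc k)) sums \<mu>" by (simp only:)
  then have sums: "(\<lambda>k. pmf (Poisson \<mu>) k * real k) sums \<mu>"
    using sums_Suc_iff[of "\<lambda>k. pmf (Poisson \<mu>) k * real k" \<mu>] by simp
  show "integrable (Poisson \<mu>) real" "(\<integral>k. real k \<partial>Poisson \<mu>) = \<mu>"
    by (auto intro!: expectation_nat_pmf_sums[OF _ sums])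
qed

lemma pmf_Poisson_exp:
  assumes "0 \<le> \<mu>" "k \<in> set_pmf (Poisson \<mu>)"
  shows "pmf (Poisson \<mu>) k = exp (real k * ln \<mu> - ln (fact k) - \<mu>)"
proof (cases "\<mu> = 0")
  case True then show ?thesis using assms(2) by (simp add: Poisson_def)
next
  case False
  then have "\<mu> > 0" using assms by simp
  then show ?thesis
    by (simp add: pmf_Poisson exp_diff exp_minus exp_add exp_of_nat_mult field_simps)
qed

lemma ln_fact_le_2_exp: "ln (fact k :: real) \<le> 2 * exp (real k)"
proof (cases "k = 0")
  case False
  have "ln (fact k :: real) \<le> ln (real k ^ k)"
  proof (subst ln_le_cancel_iff)
    show "fact k \<le> real k ^ k" using fact_le_power[of k, where 'a = real] by simp
  qed (use False in auto)
  also have "\<dots> = real k * ln (real k)" using False by (simp add: ln_realpow)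
  also have "\<dots> \<le> real k * real k"
    using False ln_le_minus_one[of "real k"] by (intro mult_left_mono) auto
  also have "\<dots> \<le> 2 * exp (real k)" using square_le_2_exp[of "real k"]
    by (simp add: power2_eq_square)
  finally show ?thesis .
qed simp

lemma abs_mult_diff_ln_fact_le:
  assumes "real k \<le> t" shows "\<bar>real k * c - ln (fact k)\<bar> \<le> (\<bar>c\<bar> + 2) * exp t"
proof -
  have "real k \<le> exp t" using assms exp_ge_add_one_self[of t] by linarith
  then have "\<bar>real k * c\<bar> \<le> \<bar>c\<bar> * exp t" by (simp add: abs_mult mult.commute mult_left_mono)
  moreover have "ln (fact k :: real) \<le> 2 * exp t"
    using ln_fact_le_2_exp[of k] exp_le_cancel_iff[of "real k" t] assms by linarith
  moreover have "0 \<le> ln (fact k :: real)" by (simp add: ln_ge_zero)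
  ultimately show ?thesis unfolding distrib_right by linarith
qed

section \<open>A lower bound for the likelihood ratio\<close>

lemma pmf_bind_ge: "pmf p x * pmf (f x) y \<le> pmf (p \<bind> f) y"
proof -
  have "pmf p x * pmf (f x) y = (\<integral>z. pmf (f x) y * indicator {x} z \<partial>p)"
    by (simp add: measure_pmf_single)
  also have "\<dots> \<le> (\<integral>z. pmf (f z) y \<partial>p)"
    using integrable_pmf_indicator[of p "{x}"]
    by (intro integral_mono integrable_pmf_bounded[of _ 1])
       (auto simp: indicator_def pmf_le_1 intro: mult_le_one)
  finally show ?thesis by (simp add: pmf_bind)
qed

lemma pmf_branch:
  "pmf (branch \<rho> \<kappa> d p) (r, G) = pmf \<rho> r * pmf (Pi_pmf {1..\<kappa> r} d (\<lambda>_. p)) G"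
proof -
  have other: "pmf (map_pmf (Pair b) q) (r, G) = 0" if "b \<noteq> r" for b q
    using that by (intro pmf_map_outside) auto
  show ?thesis
    unfolding branch_def
    by (subst pmf_bind_single[where a = r]) (auto simp: other pmf_map_inj' inj_def)
qed

lemma pair_completion_pmf_cong:
  "(\<And>i. i \<in> {1..fst r} \<Longrightarrow> g i = g' i) \<Longrightarrow>
    pair_completion_pmf lam n r g = pair_completion_pmf lam n r g'"
  unfolding pair_completion_pmf_def
  by (cases r) (auto intro!: arg_cong2[where f = pair_pmf] completion_pmf_cong)

lemma pmf_P1_pmf_Suc_ge:
  "pmf (root_degrees_pmf lam s) r * (\<Prod>i\<in>{1..fst r}. pmf (P1_pmf lam s n) (g i)) *
    pmf (pair_completion_pmf lam n r g) z \<le> pmf (P1_pmf lam s (Suc n)) z"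
proof -
  define g' where "g' i = (if i \<in> {1..fst r} then g i else ({[]}, {[]}))" for i
  have "pmf (Pi_pmf {1..fst r} ({[]}, {[]}) (\<lambda>_. P1_pmf lam s n)) g' =
      (\<Prod>i\<in>{1..fst r}. pmf (P1_pmf lam s n) (g i))"
    by (subst pmf_Pi') (auto simp: g'_def intro!: prod.cong)
  moreover have "pair_completion_pmf lam n r g' = pair_completion_pmf lam n r g"
    by (rule pair_completion_pmf_cong) (simp add: g'_def)
  ultimately show ?thesis
    unfolding P1_pmf_Suc
    using pmf_bind_ge[of "branch (root_degrees_pmf lam s) fst ({[]}, {[]}) (P1_pmf lam s n)"
        "(r, g')"
        "\<lambda>(r, g). pair_completion_pmf lam n r g" z]
    by (simp add: pmf_branch)
qed

lemma set_completion_pmfE: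
  assumes "x \<in> set_pmf (completion_pmf lam n k a f)"
  obtains \<pi> h where "\<pi> permutes {1..k + a}" "\<And>i. i \<in> {1..k} \<Longrightarrow> h i = f i"
    "\<And>i. i \<in> {k + 1..k + a} \<Longrightarrow> h i \<in> ltrees_upto n" "x = node (k + a) (\<lambda>j. h (inv \<pi> j))"
proof -
  from assms obtain \<pi> h where \<pi>: "\<pi> permutes {1..k + a}" "x = node (k + a) (\<lambda>j. h (inv \<pi> j))"
    and h: "\<And>i. i \<in> {1..k + a} \<Longrightarrow> h i \<in> set_pmf (if i \<le> k then return_pmf (f i) else GW_pmf lam n)"
    unfolding completion_pmf_def by (rule set_shuffle_pmfE) blast
  show ?thesis
  proof (rule that[OF \<pi>(1) _ _ \<pi>(2)])
    show "h i = f i" if "i \<in> {1..k}" for i using h[of i] that by auto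
    show "h i \<in> ltrees_upto n" if "i \<in> {k + 1..k + a}" for i
      using h[of i] that set_GW_pmf by auto
  qed
qed

context correlated_trees
begin

definition log_weight :: "nat \<times> nat \<times> nat \<Rightarrow> real" where
  "log_weight = (\<lambda>(k, a, a'). (2 * lam - \<mu> - 2 * \<nu>) + (real k * (ln \<mu> - 2 * ln lam) - ln (fact k)) +
     (real a * (ln \<nu> - ln lam) - ln (fact a)) + (real a' * (ln \<nu> - ln lam) - ln (fact a')))"

lemma exp_log_weight:
  assumes "(k, a, a') \<in> set_pmf root_degrees"
  shows "exp (log_weight (k, a, a')) *
      ((lam ^ (k + a) * exp (- lam)) * (lam ^ (k + a') * exp (- lam))) =
    pmf root_degrees (k, a, a')"
proof -
  have set: "k \<in> set_pmf (Poisson \<mu>)" "a \<in> set_pmf (Poisson \<nu>)" "a' \<in> set_pmf (Poisson \<nu>)"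
    using assms by (auto simp: root_degrees_pmf_def)
  have power: "lam ^ m * exp (- lam) = exp (real m * ln lam - lam)" for m
    using lam_pos by (simp add: exp_diff exp_minus exp_of_nat_mult field_simps)
  have "pmf root_degrees (k, a, a') = pmf (Poisson \<mu>) k * (pmf (Poisson \<nu>) a * pmf (Poisson \<nu>) a')"
    by (simp add: root_degrees_pmf_def pmf_pair)
  then show ?thesis
    unfolding power pmf_Poisson_exp[OF mu_nonneg set(1)] pmf_Poisson_exp[OF nu_nonneg set(2)]
      pmf_Poisson_exp[OF nu_nonneg set(3)] exp_add[symmetric]
    by (simp add: log_weight_def algebra_simps)
qed

lemma log_weight_bound:
  "\<exists>C. \<forall>k a a'. \<bar>log_weight (k, a, a')\<bar> \<le> C * exp (real k + real a + real a')"
proof -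
  define c0 where "c0 = \<bar>2 * lam - \<mu> - 2 * \<nu>\<bar>"
  define c1 where "c1 = \<bar>ln \<mu> - 2 * ln lam\<bar> + 2"
  define c2 where "c2 = \<bar>ln \<nu> - ln lam\<bar> + 2"
  have "\<bar>log_weight (k, a, a')\<bar> \<le> (c0 + c1 + c2 + c2) * exp (real k + real a + real a')"
      for k a a'
  proof -
    let ?t = "real k + real a + real a'"
    have "\<bar>2 * lam - \<mu> - 2 * \<nu>\<bar> \<le> c0 * exp ?t"
      unfolding c0_def by (simp add: mult_left_le mult_le_cancel_left1)
    moreover have "\<bar>real k * (ln \<mu> - 2 * ln lam) - ln (fact k)\<bar> \<le> c1 * exp ?t"
      unfolding c1_def by (rule abs_mult_diff_ln_fact_le) simp
    moreover have new: "\<bar>real b * (ln \<nu> - ln lam) - ln (fact b)\<bar> \<le> c2 * exp ?t"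
        if "real b \<le> ?t" for b
      unfolding c2_def by (rule abs_mult_diff_ln_fact_le[OF that])
    ultimately show ?thesis
      using new[of a] new[of a'] unfolding log_weight_def distrib_right prod.case by linarith
  qed
  then show ?thesis by blast
qed

lemma integrable_root_degrees:
  fixes h :: "nat \<times> nat \<times> nat \<Rightarrow> real"
  assumes "\<And>k a a'. \<bar>h (k, a, a')\<bar> \<le> C * exp (c * (real k + real a + real a'))"
  shows "integrable root_degrees h"
proof (rule Bochner_Integration.integrable_bound)
  let ?g = "\<lambda>(k :: nat, a :: nat, a' :: nat). exp (c * (real k + real a + real a'))"
  have fin: "(\<integral>\<^sup>+k. ennreal (exp (c * real k)) \<partial>Poisson m) < \<infinity>" if "0 \<le> m" for m
    using integrable_Poisson_exp[OF that, of c] by (simp add: integrable_iff_bounded)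
  have "(\<integral>\<^sup>+r. ennreal (?g r) \<partial>root_degrees) =
    (\<integral>\<^sup>+k. \<integral>\<^sup>+a. \<integral>\<^sup>+a'. ennreal (exp (c * real k)) *
      (ennreal (exp (c * real a)) * ennreal (exp (c * real a'))) \<partial>Poisson \<nu> \<partial>Poisson \<nu> \<partial>Poisson \<mu>)"
    unfolding root_degrees_pmf_def nn_integral_pair_pmf'
    by (intro nn_integral_cong)
       (simp add: ennreal_mult'[symmetric] exp_add[symmetric] algebra_simps)
  also have "\<dots> < \<infinity>"
    using fin[OF mu_nonneg] fin[OF nu_nonneg]
    by (simp add: nn_integral_cmult nn_integral_multc ennreal_mult_eq_top_iff less_top[symmetric])
  finally have "integrable root_degrees ?g" by (intro integrableI_nonneg) auto
  then show "integrable root_degrees (\<lambda>r. C * ?g r)" by simp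
  show "AE r in root_degrees. norm (h r) \<le> norm (C * ?g r)"
    using order_trans[OF assms abs_ge_self] by (auto intro!: AE_I2)
qed simp

lemma map_fst_root_degrees: "map_pmf fst root_degrees = Poisson \<mu>"
  by (simp add: root_degrees_pmf_def map_fst_pair_pmf)

lemma mean_root_degrees:
  "integrable root_degrees (\<lambda>r. real (fst r))" "(\<integral>r. real (fst r) \<partial>root_degrees) = \<mu>"
  using Poisson_mean[OF mu_nonneg] unfolding map_fst_root_degrees[symmetric] by simp_all

lemma pmf_gw_Suc_le_completion:
  assumes \<pi>: "\<pi> permutes {1..k + a}" and h: "\<And>i. i \<in> {1..k + a} \<Longrightarrow> h i \<in> ltrees_upto n"
    and x: "x = node (k + a) (\<lambda>j. h (inv \<pi> j))"
  shows "pmf (gw (Suc n)) x \<le>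
    pmf (completion_pmf lam n k a h) x * ((lam ^ (k + a) * exp (- lam)) *
      (\<Prod>i\<in>{1..k}. pmf (gw n) (h i)))"
proof -
  let ?P = "\<lambda>i. if i \<le> k then return_pmf (h i) else gw n"
  let ?new = "\<Prod>j\<in>{1..a}. pmf (gw n) (h (k + j))"
  have "?new = (\<Prod>i\<in>{1..k + a}. pmf (?P i) (h (inv \<pi> (\<pi> i))))"
    by (simp add: prod_atLeast1_add permutes_inverses[OF \<pi>])
  also have "\<dots> \<le> (\<Sum>\<sigma>\<in>perms (k + a). \<Prod>i\<in>{1..k + a}. pmf (?P i) (h (inv \<pi> (\<sigma> i))))"
    using \<pi> by (intro member_le_sum[of \<pi>]) (auto simp: finite_perms intro!: prod_nonneg)
  also have "\<dots> = fact (k + a) * pmf (completion_pmf lam n k a h) x"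
    unfolding x completion_pmf_def
    by (subst pmf_shuffle_pmf[where n = n])
       (use h set_GW_pmf inv_permutes_in[OF \<pi>] in \<open>auto split: if_splits\<close>)
  finally have new: "?new \<le> fact (k + a) * pmf (completion_pmf lam n k a h) x" .
  have "pmf (gw (Suc n)) x = pmf (Poisson lam) (k + a) * (\<Prod>j\<in>{1..k + a}. pmf (gw n) (h (inv \<pi> j)))"
    unfolding x by (rule pmf_GW_pmf_node) (rule h[OF inv_permutes_in[OF \<pi>]])
  also have "(\<Prod>j\<in>{1..k + a}. pmf (gw n) (h (inv \<pi> j))) = (\<Prod>i\<in>{1..k + a}. pmf (gw n) (h i))"
    using prod.permute[OF permutes_inv[OF \<pi>], of "\<lambda>i. pmf (gw n) (h i)"] by (simp add: o_def)
  also have "\<dots> = (\<Prod>i\<in>{1..k}. pmf (gw n) (h i)) * ?new" by (rule prod_atLeast1_add)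
  also have "pmf (Poisson lam) (k + a) * ((\<Prod>i\<in>{1..k}. pmf (gw n) (h i)) * ?new) \<le>
      pmf (Poisson lam) (k + a) * ((\<Prod>i\<in>{1..k}. pmf (gw n) (h i)) *
        (fact (k + a) * pmf (completion_pmf lam n k a h) x))"
    using new by (intro mult_left_mono) (auto intro!: prod_nonneg)
  also have "\<dots> = pmf (completion_pmf lam n k a h) x *
      ((lam ^ (k + a) * exp (- lam)) * (\<Prod>i\<in>{1..k}. pmf (gw n) (h i)))"
    using lam_pos by (simp add: pmf_Poisson)
  finally show ?thesis .
qed

lemma prod_lr_eq:
  "(\<Prod>i\<in>I. lr n (g i)) * ((\<Prod>i\<in>I. pmf (gw n) (fst (g i))) * (\<Prod>i\<in>I. pmf (gw n) (snd (g i)))) =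
    (\<Prod>i\<in>I. pmf (p1 n) (g i))"
proof -
  have "lr n (g i) * (pmf (gw n) (fst (g i)) * pmf (gw n) (snd (g i))) = pmf (p1 n) (g i)" for i
    unfolding pmf_eq_lr_mult by (cases "g i") (simp add: P0_pmf_def pmf_pair)
  then show ?thesis by (simp only: prod.distrib[symmetric])
qed

text \<open>A single outcome of the random completion, the relabelings \<open>\<pi>\<close> and \<open>\<pi>'\<close>, already yields this
  bound: the two factorials it costs are those in the Poisson weights of the denominator.\<close>

lemma lr_node_ge:
  assumes r: "(k, a, a') \<in> set_pmf root_degrees"
    and \<pi>: "\<pi> permutes {1..k + a}" "\<And>i. i \<in> {1..k + a} \<Longrightarrow> h i \<in> ltrees_upto n"
    and \<pi>': "\<pi>' permutes {1..k + a'}" "\<And>i. i \<in> {1..k + a'} \<Longrightarrow> h' i \<in> ltrees_upto n"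
  shows "exp (log_weight (k, a, a')) * (\<Prod>i\<in>{1..k}. lr n (h i, h' i)) \<le>
    lr (Suc n) (node (k + a) (\<lambda>j. h (inv \<pi> j)), node (k + a') (\<lambda>j. h' (inv \<pi>' j)))"
    (is "_ \<le> lr _ (?x, ?y)")
proof -
  let ?f = "pmf (completion_pmf lam n k a h) ?x" and ?f' = "pmf (completion_pmf lam n k a' h') ?y"
  let ?w = "lam ^ (k + a) * exp (- lam)" and ?w' = "lam ^ (k + a') * exp (- lam)"
  let ?Q = "\<Prod>i\<in>{1..k}. pmf (gw n) (h i)" and ?Q' = "\<Prod>i\<in>{1..k}. pmf (gw n) (h' i)"
  let ?R = "\<Prod>i\<in>{1..k}. lr n (h i, h' i)" and ?e = "exp (log_weight (k, a, a'))"
  have le_x: "pmf (gw (Suc n)) ?x \<le> ?f * (?w * ?Q)"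
    by (rule pmf_gw_Suc_le_completion[OF \<pi> refl])
  have le_y: "pmf (gw (Suc n)) ?y \<le> ?f' * (?w' * ?Q')"
    by (rule pmf_gw_Suc_le_completion[OF \<pi>' refl])
  have pos: "pmf (gw (Suc n)) ?x > 0" "pmf (gw (Suc n)) ?y > 0"
    using \<pi>(2)[OF inv_permutes_in[OF \<pi>(1)]] \<pi>'(2)[OF inv_permutes_in[OF \<pi>'(1)]]
    by (auto intro!: pmf_gw_pos node_in_ltrees_upto simp del: GW_pmf.simps)
  have lr_prod: "?R * (?Q * ?Q') = (\<Prod>i\<in>{1..k}. pmf (p1 n) (h i, h' i))"
    using prod_lr_eq[of n "\<lambda>i. (h i, h' i)" "{1..k}"] by simp
  have "?e * ?R * (pmf (gw (Suc n)) ?x * pmf (gw (Suc n)) ?y) \<le>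
     ?e * ?R * ((?f * (?w * ?Q)) * (?f' * (?w' * ?Q')))"
    using le_x le_y by (intro mult_left_mono mult_mono mult_nonneg_nonneg prod_nonneg)
      (auto intro!: likelihood_ratio_nonneg mult_nonneg_nonneg prod_nonneg simp: lam_pos
        less_imp_le)
  also have "\<dots> = (?e * (?w * ?w')) * (?R * (?Q * ?Q')) * (?f * ?f')" by (simp only: ac_simps)
  also have "\<dots> = pmf root_degrees (k, a, a') * (\<Prod>i\<in>{1..k}. pmf (p1 n) (h i, h' i)) *
      pmf (pair_completion_pmf lam n (k, a, a') (\<lambda>i. (h i, h' i))) (?x, ?y)"
    unfolding exp_log_weight[OF r] lr_prod by (simp add: pair_completion_pmf_def pmf_pair o_def)
  also have "\<dots> \<le> pmf (p1 (Suc n)) (?x, ?y)"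
    using pmf_P1_pmf_Suc_ge[of lam s "(k, a, a')"] by simp
  also have "\<dots> = lr (Suc n) (?x, ?y) * (pmf (gw (Suc n)) ?x * pmf (gw (Suc n)) ?y)"
    by (simp add: pmf_eq_lr_mult P0_pmf_def pmf_pair del: GW_pmf.simps)
  finally show ?thesis using mult_pos_pos[OF pos] by (simp only: mult_le_cancel_right_pos)
qed

lemma completion_in_ltrees:
  assumes "\<And>i. i \<in> {1..k} \<Longrightarrow> f i \<in> ltrees" "x \<in> set_pmf (completion_pmf lam n k a f)"
  obtains \<pi> h where "\<pi> permutes {1..k + a}" "\<And>i. i \<in> {1..k} \<Longrightarrow> h i = f i"
    "\<And>i. i \<in> {1..k + a} \<Longrightarrow> h i \<in> ltrees" "x = node (k + a) (\<lambda>j. h (inv \<pi> j))"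
proof -
  from assms(2) obtain \<pi> h where h: "\<pi> permutes {1..k + a}" "\<And>i. i \<in> {1..k} \<Longrightarrow> h i = f i"
    "\<And>i. i \<in> {k + 1..k + a} \<Longrightarrow> h i \<in> ltrees_upto n" "x = node (k + a) (\<lambda>j. h (inv \<pi> j))"
    by (rule set_completion_pmfE) blast
  have "h i \<in> ltrees" if "i \<in> {1..k + a}" for i
    using h(2,3)[of i] assms(1)[of i] that by (cases "i \<le> k") (auto simp: ltrees_upto_def)
  then show ?thesis by (intro that[of \<pi> h] h)
qed

lemma lr_completion_ge:
  assumes r: "r \<in> set_pmf root_degrees" and g: "\<And>i. i \<in> {1..fst r} \<Longrightarrow> g i \<in> ltrees \<times> ltrees"
    and z: "z \<in> set_pmf (pair_completion_pmf lam n r g)"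
  shows "exp (log_weight r) * (\<Prod>i\<in>{1..fst r}. lr m (prune2 m (g i))) \<le>
      lr (Suc m) (prune2 (Suc m) z)"
proof -
  obtain k a a' x y where eq: "r = (k, a, a')" "z = (x, y)" by (metis prod.exhaust)
  have x: "x \<in> set_pmf (completion_pmf lam n k a (fst \<circ> g))"
    and y: "y \<in> set_pmf (completion_pmf lam n k a' (snd \<circ> g))"
    using z by (auto simp: pair_completion_pmf_def eq)
  have g_in: "fst (g i) \<in> ltrees" "snd (g i) \<in> ltrees" if "i \<in> {1..k}" for i
    using g[of i] that by (auto simp: eq mem_Times_iff)
  from x obtain \<pi> h where h: "\<pi> permutes {1..k + a}" "\<And>i. i \<in> {1..k} \<Longrightarrow> h i = (fst \<circ> g) i"
    "\<And>i. i \<in> {1..k + a} \<Longrightarrow> h i \<in> ltrees" "x = node (k + a) (\<lambda>j. h (inv \<pi> j))"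
    by (rule completion_in_ltrees[rotated]) (use g_in in auto)
  from y obtain \<pi>' h' where h': "\<pi>' permutes {1..k + a'}" "\<And>i. i \<in> {1..k} \<Longrightarrow> h' i = (snd \<circ> g) i"
    "\<And>i. i \<in> {1..k + a'} \<Longrightarrow> h' i \<in> ltrees" "y = node (k + a') (\<lambda>j. h' (inv \<pi>' j))"
    by (rule completion_in_ltrees[rotated]) (use g_in in auto)
  have "(\<Prod>i\<in>{1..k}. lr m (prune2 m (g i))) = (\<Prod>i\<in>{1..k}. lr m (prune m (h i), prune m (h' i)))"
    using h(2) h'(2) by (intro prod.cong) (auto simp: prune2_def case_prod_unfold)
  moreover have "exp (log_weight (k, a, a')) * (\<Prod>i\<in>{1..k}. lr m (prune m (h i), prune m (h' i))) \<le>
    lr (Suc m) (node (k + a) (\<lambda>j. prune m (h (inv \<pi> j))),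
      node (k + a') (\<lambda>j. prune m (h' (inv \<pi>' j))))"
    by (rule lr_node_ge[where h = "\<lambda>i. prune m (h i)" and h' = "\<lambda>i. prune m (h' i)"])
       (use r h h' in \<open>auto simp: eq prune_in_ltrees_upto\<close>)
  ultimately show ?thesis by (simp add: eq h(4) h'(4) prune2_def prune_node)
qed

end

section \<open>Exponential growth with positive probability\<close>

lemma sum_geometric_tail_le:
  fixes w :: real
  assumes "0 \<le> w" "w < 1"
  shows "(\<Sum>n\<in>{N..<D}. w ^ n) \<le> w ^ N / (1 - w)"
proof -
  have "(\<Sum>n\<in>{N..<D}. w ^ n) = w ^ N * (\<Sum>n<D - N. w ^ n)"
    by (subst sum.atLeastLessThan_shift_0) (simp add: power_add sum_distrib_left lessThan_atLeast0)
  also have "(\<Sum>n<D - N. w ^ n) \<le> (\<Sum>n. w ^ n)"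
    using assms by (intro sum_le_suminf summable_geometric) auto
  also have "\<dots> = 1 / (1 - w)" using assms by (intro suminf_geometric) auto
  finally show ?thesis using assms(1) by (simp add: mult_left_mono)
qed

lemma perturbed_geometric_growth_ge:
  fixes x :: "nat \<Rightarrow> real"
  assumes \<rho>: "0 < \<rho>" "\<rho> < \<mu>" and b: "0 \<le> b"
    and step: "\<And>n. N \<le> n \<Longrightarrow> n < D \<Longrightarrow> \<mu> * x n - b * \<rho> ^ n \<le> x (Suc n)"
    and n: "N \<le> n" "n \<le> D"
  shows "(x N / \<mu> ^ N - b * (\<rho> / \<mu>) ^ N / (\<mu> - \<rho>)) * \<mu> ^ n \<le> x n"
proof -
  let ?q = "b / (\<mu> - \<rho>)" and ?y = "x N / \<mu> ^ N - b * (\<rho> / \<mu>) ^ N / (\<mu> - \<rho>)"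
  have q: "\<mu> * ?q = b + \<rho> * ?q" "0 \<le> ?q" using \<rho> b by (auto simp: field_simps)
  have "?y * \<mu> ^ n + ?q * \<rho> ^ n \<le> x n"
    using n
  proof (induction n rule: dec_induct)
    case base
    then show ?case using \<rho> by (simp add: power_divide left_diff_distrib)
  next
    case (step m)
    have "?y * \<mu> ^ Suc m + ?q * \<rho> ^ Suc m =
        \<mu> * (?y * \<mu> ^ m + ?q * \<rho> ^ m) - (\<mu> * ?q - \<rho> * ?q) * \<rho> ^ m"
      by (simp add: algebra_simps)
    also have "\<dots> \<le> \<mu> * x m - b * \<rho> ^ m"
      using step \<rho> unfolding q(1) by (intro diff_mono mult_left_mono) auto
    also have "\<dots> \<le> x (Suc m)" using step by (intro assms(4)) auto
    finally show ?case .
  qed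
  then show ?thesis using mult_nonneg_nonneg[OF q(2), of "\<rho> ^ n"] \<rho>(1) by simp
qed

lemma branch_map_pmf:
  "branch \<rho> \<kappa> (h d) (map_pmf h p) = map_pmf (\<lambda>(r, G). (r, h \<circ> G)) (branch \<rho> \<kappa> d p)"
  by (simp add: branch_def map_bind_pmf pmf.map_comp o_def Pi_pmf_map[of _ h d "h d"])

lemma (in dominated_pmf) ex_truncated_ln_lr:
  assumes int: "integrable Q (\<lambda>x. ln (lr x))" and K: "K < (\<integral>x. ln (lr x) \<partial>Q)"
  shows "\<exists>Y. integrable Q (\<lambda>x. (Y x)\<^sup>2) \<and> K < (\<integral>x. Y x \<partial>Q) \<and>
    (\<forall>x\<in>set_pmf Q. exp (Y x) \<le> lr x)"
proof -
  let ?Y = "\<lambda>M x. min (real M) (ln (lr x))"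
  have "(\<lambda>M. \<integral>x. ?Y M x \<partial>Q) \<longlonglongrightarrow> (\<integral>x. ln (lr x) \<partial>Q)"
  proof (rule integral_dominated_convergence[where w = "\<lambda>x. \<bar>ln (lr x)\<bar>"])
    have "eventually (\<lambda>M. ?Y M x = ln (lr x)) sequentially" for x
      using filterlim_real_sequentially[unfolded filterlim_at_top, rule_format, of "ln (lr x)"]
      by (rule eventually_mono) simp
    then have "(\<lambda>M. ?Y M x) \<longlonglongrightarrow> ln (lr x)" for x by (rule tendsto_eventually)
    then show "AE x in Q. (\<lambda>M. ?Y M x) \<longlonglongrightarrow> ln (lr x)" by simp
  qed (use int in auto)
  then have "eventually (\<lambda>M. (\<integral>x. ?Y M x \<partial>Q) > K) sequentially" using K by (rule order_tendstoD)
  then obtain M where M: "(\<integral>x. ?Y M x \<partial>Q) > K" by (auto dest!: eventually_happens)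
  have square_le: "(?Y M x)\<^sup>2 \<le> (real M)\<^sup>2 + neg_ln_lr_square x" if "x \<in> set_pmf Q" for x
  proof (cases "lr x < 1")
    case True
    then have "ln (lr x) < 0" using lr_pos[OF that] by simp
    then show ?thesis using True by simp
  next
    case False
    then show ?thesis by (auto intro!: power_mono)
  qed
  have "integrable Q (\<lambda>x. (?Y M x)\<^sup>2)"
  proof (rule Bochner_Integration.integrable_bound)
    show "integrable Q (\<lambda>x. (real M)\<^sup>2 + neg_ln_lr_square x)"
      using integrable_neg_ln_lr_square by simp
    show "AE x in Q. norm ((?Y M x)\<^sup>2) \<le> norm ((real M)\<^sup>2 + neg_ln_lr_square x)"
      using square_le by (auto simp: AE_measure_pmf_iff intro: order_trans[OF _ abs_ge_self])
  qed simp
  moreover have "exp (?Y M x) \<le> lr x" if "x \<in> set_pmf Q" for x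
  proof -
    have "exp (?Y M x) \<le> exp (ln (lr x))" by simp
    then show ?thesis using lr_pos[OF that] by simp
  qed
  ultimately show ?thesis using M by (intro exI[of _ "?Y M"]) auto
qed

subsection \<open>Coupled sums of log weights\<close>

context correlated_trees
begin

lemma integrable_square_root_degrees:
  fixes h :: "nat \<times> nat \<times> nat \<Rightarrow> real"
  assumes "\<And>k a a'. \<bar>h (k, a, a')\<bar> \<le> C * exp (real k + real a + real a')"
  shows "integrable root_degrees (\<lambda>r. (h r)\<^sup>2)"
proof (rule integrable_root_degrees[where c = 2])
  fix k a a' :: nat
  let ?t = "real k + real a + real a'"
  have "\<bar>h (k, a, a')\<bar>\<^sup>2 \<le> (C * exp ?t)\<^sup>2" using assms by (intro power_mono) auto
  then show "\<bar>(h (k, a, a'))\<^sup>2\<bar> \<le> C\<^sup>2 * exp (2 * ?t)"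
    by (simp only: power_mult_distrib exp_double power2_abs abs_power2)
qed

definition mean_log_weight :: real where
  "mean_log_weight = measure_pmf.expectation root_degrees log_weight"

abbreviation weight_variance :: real where
  "weight_variance \<equiv> measure_pmf.variance root_degrees log_weight"

abbreviation degree_variance :: real where
  "degree_variance \<equiv> measure_pmf.variance root_degrees (\<lambda>r. real (fst r))"

lemma centred_root_degrees:
  "centred root_degrees (\<lambda>r. a * (log_weight r - mean_log_weight) + b * (real (fst r) - \<mu>))
     (2 * a\<^sup>2 * weight_variance + 2 * b\<^sup>2 * degree_variance)"
proof (rule centred_linear)
  obtain C where "\<And>k a a'. \<bar>log_weight (k, a, a')\<bar> \<le> C * exp (real k + real a + real a')"
    using log_weight_bound by blast
  then show "centred root_degrees (\<lambda>r. log_weight r - mean_log_weight) weight_variance"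
    unfolding mean_log_weight_def by (intro centred_minus_mean integrable_square_root_degrees)
  have "real k \<le> exp (real k + real a + real a')" for k a a' :: nat
    using exp_ge_add_one_self[of "real k + real a + real a'"] by linarith
  then have "integrable root_degrees (\<lambda>r. (real (fst r))\<^sup>2)"
    by (intro integrable_square_root_degrees[where C = 1]) simp
  from centred_minus_mean[OF this]
  show "centred root_degrees (\<lambda>r. real (fst r) - \<mu>) degree_variance"
    by (simp only: mean_root_degrees(2))
qed

end

locale growth_seed = correlated_trees +
  fixes d0 :: nat and Y :: "ltree \<times> ltree \<Rightarrow> real"
  assumes mu_gt_1: "1 < \<mu>" and integrable_seed_square: "integrable (p1 d0) (\<lambda>z. (Y z)\<^sup>2)"
    and exp_seed_le: "z \<in> set_pmf (p1 d0) \<Longrightarrow> exp (Y z) \<le> lr d0 z"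
    and mean_seed_gt: "\<bar>mean_log_weight / (\<mu> - 1)\<bar> < measure_pmf.expectation (p1 d0) Y"
begin

text \<open>In a pair \<open>(z, S)\<close> drawn from \<open>coupled_sums D\<close>, \<open>S n\<close> adds up \<open>Y\<close> over the common vertices
  at depth \<open>n\<close> and the log weights over the common vertices above; it is a lower bound for the log
  likelihood ratio of \<open>z\<close> at depth \<open>n + d0\<close>.\<close>

primrec coupled_sums :: "nat \<Rightarrow> ((ltree \<times> ltree) \<times> (nat \<Rightarrow> real)) pmf" where
  "coupled_sums 0 = map_pmf (\<lambda>z. (z, case_nat (Y z) (\<lambda>_. 0))) (p1 d0)"
| "coupled_sums (Suc D) = branch root_degrees fst (({[]}, {[]}), \<lambda>_. 0) (coupled_sums D) \<bind>
     (\<lambda>(r, G). map_pmf (\<lambda>z. (z, case_nat (Y (prune2 d0 z))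
         (\<lambda>n. log_weight r + (\<Sum>i\<in>{1..fst r}. snd (G i) n))))
       (pair_completion_pmf lam (D + d0) r (fst \<circ> G)))"

lemma map_fst_coupled_sums: "map_pmf fst (coupled_sums D) = p1 (D + d0)"
proof (induction D)
  case 0 show ?case by (simp add: pmf.map_comp o_def)
next
  case (Suc D)
  have "branch root_degrees fst ({[]}, {[]}) (p1 (D + d0)) = map_pmf (\<lambda>(r, G). (r, fst \<circ> G))
      (branch root_degrees fst (({[]}, {[]}), \<lambda>_. 0) (coupled_sums D))"
    unfolding Suc.IH[symmetric]
    using branch_map_pmf[of root_degrees fst fst "(({[]}, {[]}), \<lambda>_. 0)" "coupled_sums D"] by simp
  then show ?case
    by (simp add: P1_pmf_Suc map_bind_pmf bind_map_pmf pmf.map_comp o_def case_prod_unfold)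
qed

lemma fst_coupled_sums:
  assumes "st \<in> set_pmf (coupled_sums D)"
  shows "fst st \<in> set_pmf (p1 (D + d0))" "fst st \<in> ltrees \<times> ltrees"
proof -
  show "fst st \<in> set_pmf (p1 (D + d0))"
    unfolding map_fst_coupled_sums[symmetric] using assms by simp
  then show "fst st \<in> ltrees \<times> ltrees"
    using P1.set_p[of lam s "D + d0"] by (auto simp: ltrees_upto_def)
qed

lemma set_coupled_sums_SucE:
  assumes "st \<in> set_pmf (coupled_sums (Suc D))"
  obtains r G where "r \<in> set_pmf root_degrees"
    "\<And>i. i \<in> {1..fst r} \<Longrightarrow> G i \<in> set_pmf (coupled_sums D)"
    "fst st \<in> set_pmf (pair_completion_pmf lam (D + d0) r (fst \<circ> G))"
    "\<And>n. snd st (Suc n) = log_weight r + (\<Sum>i\<in>{1..fst r}. snd (G i) n)"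
proof -
  from assms obtain r G z
    where rG: "(r, G) \<in> set_pmf (branch root_degrees fst (({[]}, {[]}), \<lambda>_. 0) (coupled_sums D))"
      and z: "z \<in> set_pmf (pair_completion_pmf lam (D + d0) r (fst \<circ> G))"
      and st: "st = (z, case_nat (Y (prune2 d0 z))
          (\<lambda>n. log_weight r + (\<Sum>i\<in>{1..fst r}. snd (G i) n)))"
    by auto
  show ?thesis using that[OF set_branch[OF rG]] z by (simp add: st)
qed

lemma coupled_sum_0: "st \<in> set_pmf (coupled_sums D) \<Longrightarrow> snd st 0 = Y (prune2 d0 (fst st))"
proof (cases D)
  case 0
  assume "st \<in> set_pmf (coupled_sums D)"
  then show ?thesis using 0 P1.set_p[of lam s d0] by (auto simp: prune2_ident subset_iff)
qed auto

lemma exp_coupled_sum_le: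
  "st \<in> set_pmf (coupled_sums D) \<Longrightarrow> n \<le> D \<Longrightarrow> exp (snd st n) \<le> lr (n + d0) (prune2 (n + d0) (fst st))"
proof (induction D arbitrary: st n)
  case 0
  have "prune2 d0 (fst st) = fst st"
    using fst_coupled_sums(1)[OF 0(1)] P1.set_p[of lam s d0] by (auto simp: prune2_ident)
  then show ?case
    using 0(2) coupled_sum_0[OF 0(1)] exp_seed_le fst_coupled_sums(1)[OF 0(1)] by simp
next
  case (Suc D)
  show ?case
  proof (cases n)
    case 0
    have "prune2 d0 (fst st) \<in> prune2 d0 ` set_pmf (p1 (Suc D + d0))"
      using fst_coupled_sums(1)[OF Suc.prems(1)] by simp
    also have "\<dots> = set_pmf (p1 d0)" using map_proj_Q[of d0 "Suc D + d0"]
      by (metis le_add2 set_map_pmf)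
    finally show ?thesis using exp_seed_le coupled_sum_0[OF Suc.prems(1)] 0 by simp
  next
    case (Suc m)
    obtain r G where r: "r \<in> set_pmf root_degrees"
      and G: "\<And>i. i \<in> {1..fst r} \<Longrightarrow> G i \<in> set_pmf (coupled_sums D)"
      and st: "fst st \<in> set_pmf (pair_completion_pmf lam (D + d0) r (fst \<circ> G))"
      "\<And>n. snd st (Suc n) = log_weight r + (\<Sum>i\<in>{1..fst r}. snd (G i) n)"
      using Suc.prems(1) by (rule set_coupled_sums_SucE) blast
    have "exp (snd st n) = exp (log_weight r) * (\<Prod>i\<in>{1..fst r}. exp (snd (G i) m))"
      by (simp add: st(2) Suc exp_add exp_sum)
    also have "\<dots> \<le> exp (log_weight r) *
        (\<Prod>i\<in>{1..fst r}. lr (m + d0) (prune2 (m + d0) ((fst \<circ> G) i)))"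
      using Suc.IH[OF G] Suc.prems(2) Suc by (intro mult_left_mono prod_mono) auto
    also have "\<dots> \<le> lr (Suc (m + d0)) (prune2 (Suc (m + d0)) (fst st))"
      by (rule lr_completion_ge[OF r _ st(1)]) (use fst_coupled_sums(2)[OF G] in simp)
    finally show ?thesis by (simp add: Suc)
  qed
qed

lemma centred_coupled_sums_Suc:
  assumes f: "centred (coupled_sums D) f v" and A: "centred root_degrees A w"
    and \<phi>: "\<And>r G. \<phi> (\<lambda>n. log_weight r + (\<Sum>i\<in>{1..fst r}. snd (G i) n)) =
        A r + (\<Sum>i\<in>{1..fst r}. f (G i))"
  shows "centred (coupled_sums (Suc D)) (\<lambda>st. \<phi> (\<lambda>n. snd st (Suc n))) (w + \<mu> * v)"
proof (rule centred_map_cong)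
  let ?J = "branch root_degrees fst (({[]}, {[]}), \<lambda>_. 0) (coupled_sums D)"
  let ?X = "\<lambda>(r, G). A r + (\<Sum>i\<in>{1..fst r}. f (G i))"
  show "centred ?J ?X (w + \<mu> * v)"
    using centred_branch[OF f A mean_root_degrees(1)] by (simp add: mean_root_degrees(2))
  show "map_pmf (\<lambda>st. \<phi> (\<lambda>n. snd st (Suc n))) (coupled_sums (Suc D)) = map_pmf ?X ?J"
    by (simp add: map_bind_pmf pmf.map_comp o_def \<phi> case_prod_unfold map_pmf_const
      map_pmf_def[of _ ?J])
qed

subsection \<open>Moments of the coupled sums\<close>

abbreviation mean_seed :: real where "mean_seed \<equiv> measure_pmf.expectation (p1 d0) Y"

definition mean_shift :: real where "mean_shift = mean_log_weight / (\<mu> - 1)"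

definition mean_sum :: "nat \<Rightarrow> real" where
  "mean_sum n = (mean_seed + mean_shift) * \<mu> ^ n - mean_shift"

definition mean_gap :: real where "mean_gap = mean_seed - \<bar>mean_shift\<bar>"

lemma mean_gap_pos: "0 < mean_gap"
  using mean_seed_gt by (simp add: mean_gap_def mean_shift_def)

lemma lam_neq_0: "lam \<noteq> 0" and s_neq_0: "s \<noteq> 0"
  using mu_gt_1 by auto

lemma one_le_mu_power: "1 \<le> \<mu> ^ n"
  using mu_gt_1 by (intro one_le_power) simp

lemma mu_less_square: "\<mu> < \<mu>\<^sup>2"
  using mult_strict_left_mono[OF mu_gt_1, of \<mu>] mu_gt_1 by (simp add: power2_eq_square)

lemma mean_sum_Suc: "mean_sum (Suc n) = mean_log_weight + \<mu> * mean_sum n"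
proof -
  have "\<mu> * mean_shift = mean_log_weight + mean_shift"
    using mu_gt_1 unfolding mean_shift_def by (simp add: field_simps del: mult_less_cancel_left)
  then show ?thesis unfolding mean_sum_def by (simp add: algebra_simps)
qed

lemma mean_sum_ge: "mean_gap * \<mu> ^ n \<le> mean_sum n"
proof -
  have "(mean_shift + \<bar>mean_shift\<bar>) * 1 \<le> (mean_shift + \<bar>mean_shift\<bar>) * \<mu> ^ n"
    by (rule mult_left_mono[OF one_le_mu_power]) linarith
  then show ?thesis unfolding mean_sum_def mean_gap_def left_diff_distrib distrib_right
    by linarith
qed

lemma mean_sum_square_le: "(mean_sum n)\<^sup>2 \<le> (\<bar>mean_seed\<bar> + 2 * \<bar>mean_shift\<bar>)\<^sup>2 * (\<mu> ^ n)\<^sup>2"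
proof -
  have "\<bar>(mean_seed + mean_shift) * \<mu> ^ n\<bar> \<le> (\<bar>mean_seed\<bar> + \<bar>mean_shift\<bar>) * \<bar>\<mu> ^ n\<bar>"
    unfolding abs_mult[of "mean_seed + mean_shift"] by (intro mult_right_mono) auto
  moreover have "\<bar>\<mu> ^ n\<bar> = \<mu> ^ n" using one_le_mu_power[of n] by linarith
  moreover have "\<bar>mean_shift\<bar> * 1 \<le> \<bar>mean_shift\<bar> * \<mu> ^ n"
    by (rule mult_left_mono[OF one_le_mu_power]) simp
  ultimately have "\<bar>mean_sum n\<bar> \<le> (\<bar>mean_seed\<bar> + 2 * \<bar>mean_shift\<bar>) * \<mu> ^ n"
    unfolding mean_sum_def distrib_right by linarith
  then have "\<bar>mean_sum n\<bar>\<^sup>2 \<le> ((\<bar>mean_seed\<bar> + 2 * \<bar>mean_shift\<bar>) * \<mu> ^ n)\<^sup>2"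
    by (rule power_mono) simp
  then show ?thesis by (simp only: power_mult_distrib power2_abs)
qed

lemma centred_coupled_sums_0:
  "centred (coupled_sums D) (\<lambda>st. snd st 0 - mean_seed) (measure_pmf.variance (p1 d0) Y)"
proof (rule centred_map_cong[OF _ centred_minus_mean[OF integrable_seed_square]])
  have "map_pmf (\<lambda>st. snd st 0 - mean_seed) (coupled_sums D) =
      map_pmf (\<lambda>st. Y (prune2 d0 (fst st)) - mean_seed) (coupled_sums D)"
    by (intro map_pmf_cong) (auto simp: coupled_sum_0)
  also have "\<dots> = map_pmf (\<lambda>z. Y z - mean_seed) (map_pmf (prune2 d0) (map_pmf fst (coupled_sums D)))"
    by (simp add: pmf.map_comp o_def)
  also have "map_pmf (prune2 d0) (map_pmf fst (coupled_sums D)) = p1 d0"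
    unfolding map_fst_coupled_sums by (rule map_proj_Q) simp
  finally show "map_pmf (\<lambda>st. snd st 0 - mean_seed) (coupled_sums D) =
      map_pmf (\<lambda>z. Y z - mean_seed) (p1 d0)" .
qed

lemma ex_variance_constant:
  assumes "0 \<le> K" shows "\<exists>C\<ge>V. K + \<mu> * C \<le> C * \<mu>\<^sup>2"
proof -
  have mu: "0 < \<mu>\<^sup>2 - \<mu>" using mu_less_square by simp
  define C where "C = max V (K / (\<mu>\<^sup>2 - \<mu>))"
  have "K = K / (\<mu>\<^sup>2 - \<mu>) * (\<mu>\<^sup>2 - \<mu>)" using mu by simp
  also have "\<dots> \<le> C * (\<mu>\<^sup>2 - \<mu>)" unfolding C_def using mu by (intro mult_right_mono) auto
  finally have "K + \<mu> * C \<le> C * \<mu>\<^sup>2" by (simp add: algebra_simps)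
  then show ?thesis by (intro exI[of _ C]) (simp add: C_def)
qed

lemma centred_coupled_sums:
  "\<exists>C\<ge>0. \<forall>n D. n \<le> D \<longrightarrow> centred (coupled_sums D) (\<lambda>st. snd st n - mean_sum n) (C * (\<mu> ^ n)\<^sup>2)"
proof -
  let ?v = weight_variance and ?w = degree_variance
  have nonneg: "0 \<le> ?v" "0 \<le> ?w" by simp_all
  define K where "K = 2 * ?v + 2 * (\<bar>mean_seed\<bar> + 2 * \<bar>mean_shift\<bar>)\<^sup>2 * ?w"
  have "0 \<le> K" using nonneg by (simp add: K_def)
  then obtain C where C: "measure_pmf.variance (p1 d0) Y \<le> C" "K + \<mu> * C \<le> C * \<mu>\<^sup>2"
    using ex_variance_constant by blast
  have "n \<le> D \<Longrightarrow> centred (coupled_sums D) (\<lambda>st. snd st n - mean_sum n) (C * (\<mu> ^ n)\<^sup>2)" for n D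
  proof (induction n arbitrary: D)
    case 0
    show ?case
      using centred_mono[OF centred_coupled_sums_0 C(1)] by (simp add: mean_sum_def)
  next
    case (Suc n)
    then obtain D' where D: "D = Suc D'" "n \<le> D'" by (cases D) auto
    have "2 * 1\<^sup>2 * ?v + 2 * (mean_sum n)\<^sup>2 * ?w \<le> K * (\<mu> ^ n)\<^sup>2"
    proof -
      have "?v * 1 \<le> ?v * (\<mu> ^ n)\<^sup>2"
        by (rule mult_left_mono[OF one_le_power[OF one_le_mu_power] nonneg(1)])
      then show ?thesis
        using mult_right_mono[OF mean_sum_square_le[of n] nonneg(2)]
        by (simp add: K_def algebra_simps)
    qed
    also have "K * (\<mu> ^ n)\<^sup>2 + \<mu> * (C * (\<mu> ^ n)\<^sup>2) \<le> C * (\<mu> ^ Suc n)\<^sup>2"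
      using mult_right_mono[OF C(2), of "(\<mu> ^ n)\<^sup>2"]
      by (simp add: power_mult_distrib algebra_simps)
    finally have variance: "2 * 1\<^sup>2 * ?v + 2 * (mean_sum n)\<^sup>2 * ?w + \<mu> * (C * (\<mu> ^ n)\<^sup>2) \<le>
        C * (\<mu> ^ Suc n)\<^sup>2"
      by simp
    have "centred (coupled_sums (Suc D')) (\<lambda>st. (\<lambda>S. S n - mean_sum (Suc n)) (\<lambda>n. snd st (Suc n)))
        (2 * 1\<^sup>2 * ?v + 2 * (mean_sum n)\<^sup>2 * ?w + \<mu> * (C * (\<mu> ^ n)\<^sup>2))"
      by (rule centred_coupled_sums_Suc[OF Suc.IH[OF D(2)] centred_root_degrees])
         (simp add: mean_sum_Suc sum_subtractf algebra_simps)
    from centred_mono[OF this variance] show ?case by (simp add: D(1))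
  qed
  moreover have "0 \<le> measure_pmf.variance (p1 d0) Y" by simp
  then have "0 \<le> C" using C(1) by linarith
  ultimately show ?thesis by blast
qed

abbreviation innovation :: "nat \<Rightarrow> 'b \<times> (nat \<Rightarrow> real) \<Rightarrow> real" where
  "innovation n st \<equiv> snd st (Suc n) - \<mu> * snd st n - mean_log_weight"

lemma centred_innovations:
  "\<exists>C\<ge>0. \<forall>n D. n < D \<longrightarrow> centred (coupled_sums D) (innovation n) (C * \<mu> ^ n)"
proof -
  obtain C where C: "0 \<le> C"
    "\<And>n D. n \<le> D \<Longrightarrow> centred (coupled_sums D) (\<lambda>st. snd st n - mean_sum n) (C * (\<mu> ^ n)\<^sup>2)"
    using centred_coupled_sums by blast
  define K where
    "K = 2 * (1 - \<mu>)\<^sup>2 * weight_variance + 2 * mean_log_weight\<^sup>2 * degree_variance"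
  define q where "q = K / (\<mu> - 1)"
  define C' where "C' = 4 * \<mu>\<^sup>2 * C"
  have "0 \<le> K" unfolding K_def by (rule centred_nonneg[OF centred_root_degrees])
  then have q: "(\<mu> - 1) * q = K" "0 \<le> q" using mu_gt_1 by (simp_all add: q_def)
  have centred: "n < D \<Longrightarrow> centred (coupled_sums D) (innovation n) ((C' + q) * \<mu> ^ n - q)" for n D
  proof (induction n arbitrary: D)
    case 0
    then have "centred (coupled_sums D)
        (\<lambda>st. 1 * (snd st (Suc 0) - mean_sum (Suc 0)) + - \<mu> * (snd st 0 - mean_sum 0))
       (2 * 1\<^sup>2 * (C * (\<mu> ^ Suc 0)\<^sup>2) + 2 * (- \<mu>)\<^sup>2 * (C * (\<mu> ^ 0)\<^sup>2))"
      by (intro centred_linear C(2)) auto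
    then show ?case using mean_sum_Suc[of 0] by (simp add: C'_def algebra_simps)
  next
    case (Suc n)
    then obtain D' where D: "D = Suc D'" "n < D'" by (cases D) auto
    have "centred (coupled_sums (Suc D')) (\<lambda>st. (\<lambda>S. S (Suc n) - \<mu> * S n - mean_log_weight)
        (\<lambda>n. snd st (Suc n))) (K + \<mu> * ((C' + q) * \<mu> ^ n - q))"
      unfolding K_def
      by (rule centred_coupled_sums_Suc[OF Suc.IH[OF D(2)] centred_root_degrees])
         (simp add: sum_subtractf sum.distrib sum_distrib_left algebra_simps)
    then show ?case by (simp add: D(1) q(1)[symmetric] algebra_simps)
  qed
  have "centred (coupled_sums D) (innovation n) ((C' + q) * \<mu> ^ n)" if "n < D" for n D
    by (rule centred_mono[OF centred[OF that]]) (use q(2) in simp)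
  moreover have "0 \<le> C' + q" using C(1) q(2) by (simp add: C'_def)
  ultimately show ?thesis by blast
qed

subsection \<open>Growth of the coupled sums\<close>

lemma prob_coupled_sum_ge:
  "\<exists>\<delta>>0. \<forall>n D. n \<le> D \<longrightarrow>
     \<delta> \<le> measure_pmf.prob (coupled_sums D) {st. mean_gap * \<mu> ^ n / 2 \<le> snd st n}"
proof -
  obtain C where C: "0 \<le> C"
    "\<And>n D. n \<le> D \<Longrightarrow> centred (coupled_sums D) (\<lambda>st. snd st n - mean_sum n) (C * (\<mu> ^ n)\<^sup>2)"
    using centred_coupled_sums by blast
  define K where "K = (\<bar>mean_seed\<bar> + 2 * \<bar>mean_shift\<bar>)\<^sup>2 + C"
  have "0 < \<bar>mean_seed\<bar>" using mean_seed_gt by linarith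
  then have K: "0 < K" unfolding K_def using C(1) by (intro add_pos_nonneg zero_less_power) auto
  have "mean_gap\<^sup>2 / (4 * K) \<le>
      measure_pmf.prob (coupled_sums D) {st. mean_gap * \<mu> ^ n / 2 \<le> snd st n}"
    if "n \<le> D" for n D
  proof -
    note centred = centredD[OF C(2)[OF that]]
    note shift = integral_shift_square[OF centred(1), of "mean_sum n"]
    have int: "integrable (coupled_sums D) (\<lambda>st. (snd st n)\<^sup>2)" using shift(1) by simp
    have mean: "(\<integral>st. snd st n \<partial>coupled_sums D) = mean_sum n"
      using centred(2) integrable_pmf_of_square[OF int] by simp
    have "(\<integral>st. (snd st n)\<^sup>2 \<partial>coupled_sums D) \<le> (mean_sum n)\<^sup>2 + C * (\<mu> ^ n)\<^sup>2"
      using shift(2) centred by simp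
    also have "\<dots> \<le> K * (\<mu> ^ n)\<^sup>2"
      using mean_sum_square_le[of n] by (simp add: K_def distrib_right)
    finally have "(mean_gap * \<mu> ^ n)\<^sup>2 / (4 * (K * (\<mu> ^ n)\<^sup>2)) \<le> measure_pmf.prob (coupled_sums D)
        {st \<in> space (coupled_sums D). mean_gap * \<mu> ^ n / 2 \<le> snd st n}"
      using int mean_sum_ge[of n] mean_gap_pos one_le_mu_power[of n]
      by (intro measure_pmf.prob_ge_half_mean) (auto simp: mean)
    moreover have "(mean_gap * \<mu> ^ n)\<^sup>2 / (4 * (K * (\<mu> ^ n)\<^sup>2)) = mean_gap\<^sup>2 / (4 * K)"
      using lam_neq_0 s_neq_0 by (simp add: power_mult_distrib)
    ultimately show ?thesis by simp
  qed
  moreover have "0 < mean_gap\<^sup>2 / (4 * K)" using mean_gap_pos K by simp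
  ultimately show ?thesis by blast
qed

lemma prob_large_innovation_le:
  assumes \<rho>: "0 < \<rho>" "\<mu> < \<rho>\<^sup>2"
  shows "\<exists>C. \<forall>N D. measure_pmf.prob (coupled_sums D) (\<Union>n\<in>{N..<D}. {st. \<bar>innovation n st\<bar> > \<rho> ^ n}) \<le>
    C * ((\<mu> / \<rho>\<^sup>2) ^ N / (1 - \<mu> / \<rho>\<^sup>2))"
proof -
  obtain C where C: "0 \<le> C" "\<And>n D. n < D \<Longrightarrow> centred (coupled_sums D) (innovation n) (C * \<mu> ^ n)"
    using centred_innovations by blast
  have "measure_pmf.prob (coupled_sums D) (\<Union>n\<in>{N..<D}. {st. \<bar>innovation n st\<bar> > \<rho> ^ n}) \<le>
      C * ((\<mu> / \<rho>\<^sup>2) ^ N / (1 - \<mu> / \<rho>\<^sup>2))" for N D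
  proof -
    have "measure_pmf.prob (coupled_sums D) (\<Union>n\<in>{N..<D}. {st. \<bar>innovation n st\<bar> > \<rho> ^ n}) \<le>
        (\<Sum>n\<in>{N..<D}. measure_pmf.prob (coupled_sums D) {st. \<bar>innovation n st\<bar> > \<rho> ^ n})"
      by (rule measure_UNION_le) auto
    also have "\<dots> \<le> (\<Sum>n\<in>{N..<D}. C * \<mu> ^ n / (\<rho> ^ n)\<^sup>2)"
      using \<rho>(1) by (intro sum_mono centred_prob_abs_gt_le C) auto
    also have "\<dots> = C * (\<Sum>n\<in>{N..<D}. (\<mu> / \<rho>\<^sup>2) ^ n)"
      by (simp add: sum_distrib_left power_divide power_mult[symmetric] mult.commute)
    also have "\<dots> \<le> C * ((\<mu> / \<rho>\<^sup>2) ^ N / (1 - \<mu> / \<rho>\<^sup>2))"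
      using \<rho> mu_gt_1 C(1) by (intro mult_left_mono sum_geometric_tail_le) auto
    finally show ?thesis .
  qed
  then show ?thesis by blast
qed

lemma coupled_sum_growth:
  assumes \<rho>: "1 < \<rho>" "\<rho> < \<mu>"
    and start: "c * \<mu> ^ N \<le> snd st N"
    and small: "\<And>n. n \<in> {N..<D} \<Longrightarrow> \<bar>innovation n st\<bar> \<le> \<rho> ^ n"
    and N: "(\<bar>mean_log_weight\<bar> + 1) * (\<rho> / \<mu>) ^ N / (\<mu> - \<rho>) \<le> c / 2" and n: "n \<in> {N..D}"
  shows "c / 2 * \<mu> ^ n \<le> snd st n"
proof -
  have step: "\<mu> * snd st n - (\<bar>mean_log_weight\<bar> + 1) * \<rho> ^ n \<le> snd st (Suc n)"
    if "N \<le> n" "n < D" for n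
  proof -
    have "\<bar>mean_log_weight\<bar> * 1 \<le> \<bar>mean_log_weight\<bar> * \<rho> ^ n"
      using \<rho>(1) by (intro mult_left_mono one_le_power) auto
    then show ?thesis using small[of n] that by (simp add: distrib_right abs_le_iff)
  qed
  have "c \<le> snd st N / \<mu> ^ N" using start mu_gt_1 by (simp add: pos_le_divide_eq)
  then have "c / 2 \<le> snd st N / \<mu> ^ N - (\<bar>mean_log_weight\<bar> + 1) * (\<rho> / \<mu>) ^ N / (\<mu> - \<rho>)"
    using N by linarith
  then have "c / 2 * \<mu> ^ n \<le>
      (snd st N / \<mu> ^ N - (\<bar>mean_log_weight\<bar> + 1) * (\<rho> / \<mu>) ^ N / (\<mu> - \<rho>)) * \<mu> ^ n"
    using mu_gt_1 by (intro mult_right_mono) auto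
  also have "\<dots> \<le> snd st n"
    by (rule perturbed_geometric_growth_ge[where D = D]) (use step \<rho> n in auto)
  finally show ?thesis .
qed

lemma prob_coupled_sums_start_le:
  assumes \<rho>: "1 < \<rho>" "\<rho> < \<mu>" and N: "(\<bar>mean_log_weight\<bar> + 1) * (\<rho> / \<mu>) ^ N / (\<mu> - \<rho>) \<le> c / 2"
  shows "measure_pmf.prob (coupled_sums D) {st. c * \<mu> ^ N \<le> snd st N} \<le>
    measure_pmf.prob (coupled_sums D) {st. \<forall>n\<in>{N..D}. c / 2 * \<mu> ^ n \<le> snd st n} +
    measure_pmf.prob (coupled_sums D) (\<Union>n\<in>{N..<D}. {st. \<bar>innovation n st\<bar> > \<rho> ^ n})"
    (is "_ \<le> measure_pmf.prob _ ?grow + measure_pmf.prob _ ?large")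
proof -
  have "{st :: (ltree \<times> ltree) \<times> _. c * \<mu> ^ N \<le> snd st N} \<subseteq> ?grow \<union> ?large"
  proof
    fix st :: "(ltree \<times> ltree) \<times> (nat \<Rightarrow> real)" assume start: "st \<in> {st. c * \<mu> ^ N \<le> snd st N}"
    show "st \<in> ?grow \<union> ?large"
    proof (cases "st \<in> ?large")
      case False
      then have small: "\<bar>innovation n st\<bar> \<le> \<rho> ^ n" if "n \<in> {N..<D}" for n
        using that by (auto simp: not_less)
      have "c / 2 * \<mu> ^ n \<le> snd st n" if "n \<in> {N..D}" for n
        by (rule coupled_sum_growth[OF \<rho> _ small N that]) (use start in auto)
      then show ?thesis by blast
    qed blast
  qed
  then show ?thesis
    by (intro order_trans[OF measure_pmf.finite_measure_mono measure_Un_le]) auto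
qed

lemma ex_innovation_rate: "\<exists>\<rho>>1. \<rho> < \<mu> \<and> \<mu> < \<rho>\<^sup>2"
proof -
  have "sqrt \<mu> < \<mu>" using mu_gt_1 mu_less_square by (auto intro!: real_less_lsqrt)
  then obtain \<rho> where \<rho>: "sqrt \<mu> < \<rho>" "\<rho> < \<mu>" using dense by blast
  moreover have "1 < sqrt \<mu>" using mu_gt_1 by simp
  moreover have "\<mu> < \<rho>\<^sup>2" using power_strict_mono[OF \<rho>(1), of 2] mu_gt_1 by simp
  ultimately show ?thesis by (meson less_trans)
qed

text \<open>At depth \<open>n\<close> the innovation has standard deviation of order \<open>sqrt (\<mu> ^ n)\<close>, so with high
  probability all late innovations stay below \<open>\<rho> ^ n\<close> for any \<open>\<rho> > sqrt \<mu>\<close>; taking \<open>\<rho> < \<mu>\<close>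
  they cannot stop the growth.\<close>

lemma prob_coupled_sums_grow:
  "\<exists>c>0. \<exists>\<delta>>0. \<exists>N. \<forall>D\<ge>N.
    \<delta> \<le> measure_pmf.prob (coupled_sums D) {st. \<forall>n\<in>{N..D}. c * \<mu> ^ n \<le> snd st n}"
proof -
  obtain \<rho> where \<rho>: "1 < \<rho>" "\<rho> < \<mu>" "\<mu> < \<rho>\<^sup>2" using ex_innovation_rate by blast
  obtain \<delta> where \<delta>: "0 < \<delta>" "\<And>n D. n \<le> D \<Longrightarrow>
      \<delta> \<le> measure_pmf.prob (coupled_sums D) {st. mean_gap / 2 * \<mu> ^ n \<le> snd st n}"
    using prob_coupled_sum_ge by (auto simp: mult.commute)
  obtain C where C: "\<And>N D. measure_pmf.prob (coupled_sums D)
      (\<Union>n\<in>{N..<D}. {st. \<bar>innovation n st\<bar> > \<rho> ^ n}) \<le> C * ((\<mu> / \<rho>\<^sup>2) ^ N / (1 - \<mu> / \<rho>\<^sup>2))"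
    using prob_large_innovation_le[OF _ \<rho>(3)] \<rho>(1) by auto
  have drift: "(\<lambda>N. (\<bar>mean_log_weight\<bar> + 1) * (\<rho> / \<mu>) ^ N / (\<mu> - \<rho>)) \<longlonglongrightarrow> 0"
    using \<rho> by (auto intro!: tendsto_eq_intros LIMSEQ_power_zero)
  have tail: "(\<lambda>N. C * ((\<mu> / \<rho>\<^sup>2) ^ N / (1 - \<mu> / \<rho>\<^sup>2))) \<longlonglongrightarrow> 0"
    using \<rho> mu_gt_1 by (auto intro!: tendsto_eq_intros LIMSEQ_power_zero)
  have "eventually (\<lambda>N. (\<bar>mean_log_weight\<bar> + 1) * (\<rho> / \<mu>) ^ N / (\<mu> - \<rho>) < mean_gap / 2 / 2 \<and>
      C * ((\<mu> / \<rho>\<^sup>2) ^ N / (1 - \<mu> / \<rho>\<^sup>2)) < \<delta> / 2) sequentially"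
    using mean_gap_pos \<delta>(1)
    by (intro eventually_conj order_tendstoD(2)[OF drift] order_tendstoD(2)[OF tail]) auto
  then obtain N where N: "(\<bar>mean_log_weight\<bar> + 1) * (\<rho> / \<mu>) ^ N / (\<mu> - \<rho>) < mean_gap / 2 / 2"
    "C * ((\<mu> / \<rho>\<^sup>2) ^ N / (1 - \<mu> / \<rho>\<^sup>2)) < \<delta> / 2"
    by (auto dest!: eventually_happens)
  have "\<delta> / 2 \<le>
      measure_pmf.prob (coupled_sums D) {st. \<forall>n\<in>{N..D}. mean_gap / 2 / 2 * \<mu> ^ n \<le> snd st n}"
    if "N \<le> D" for D
    using prob_coupled_sums_start_le[OF \<rho>(1,2) less_imp_le[OF N(1)], of D]
      \<delta>(2)[OF that] C[of D N] N(2)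
    by linarith
  moreover have "0 < mean_gap / 2 / 2" "0 < \<delta> / 2" using mean_gap_pos \<delta>(1) by simp_all
  ultimately show ?thesis by blast
qed

lemma prob_lr_grows_seed:
  "\<exists>c>0. \<exists>\<delta>>0. \<exists>N. \<forall>D\<ge>N.
    \<delta> \<le> measure_pmf.prob (p1 D) {z. \<forall>n\<in>{N..D}. exp (c * \<mu> ^ n) \<le> lr n (prune2 n z)}"
proof -
  obtain c \<delta> N where c: "c > 0" "\<delta> > 0"
    "\<And>D. D \<ge> N \<Longrightarrow> \<delta> \<le> measure_pmf.prob (coupled_sums D) {st. \<forall>n\<in>{N..D}. c * \<mu> ^ n \<le> snd st n}"
    using prob_coupled_sums_grow by blast
  let ?c = "c / \<mu> ^ d0"
  have "\<delta> \<le> measure_pmf.prob (p1 D) {z. \<forall>n\<in>{N + d0..D}. exp (?c * \<mu> ^ n) \<le> lr n (prune2 n z)}"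
    (is "_ \<le> measure_pmf.prob _ ?A") if "D \<ge> N + d0" for D
  proof -
    have D: "D = (D - d0) + d0" "N \<le> D - d0" using that by auto
    have "exp (?c * \<mu> ^ n) \<le> lr n (prune2 n (fst st))"
      if st: "st \<in> set_pmf (coupled_sums (D - d0))" "\<forall>n\<in>{N..D - d0}. c * \<mu> ^ n \<le> snd st n"
        and n: "n \<in> {N + d0..D}" for st n
    proof -
      have "?c * \<mu> ^ n = c * \<mu> ^ (n - d0)" using lam_neq_0 s_neq_0 n by (simp add: power_diff)
      also have "\<dots> \<le> snd st (n - d0)" by (rule bspec[OF st(2)]) (use n in auto)
      finally have "exp (?c * \<mu> ^ n) \<le> exp (snd st (n - d0))" by (simp only: exp_le_cancel_iff)
      also have "\<dots> \<le> lr n (prune2 n (fst st))" using exp_coupled_sum_le[OF st(1), of "n - d0"] n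
        by (simp add: diff_le_mono)
      finally show ?thesis .
    qed
    then have "measure_pmf.prob (coupled_sums (D - d0)) {st. \<forall>n\<in>{N..D - d0}. c * \<mu> ^ n \<le> snd st n} \<le>
        measure_pmf.prob (coupled_sums (D - d0)) (fst -` ?A)"
      by (intro measure_pmf.finite_measure_mono_AE) (auto simp: AE_measure_pmf_iff)
    also have "\<dots> = measure_pmf.prob (p1 D) ?A"
      by (subst D(1)) (simp only: map_fst_coupled_sums[symmetric] measure_map_pmf)
    finally show ?thesis using c(3)[OF D(2)] by linarith
  qed
  moreover have "0 < ?c" using c(1) mu_gt_1 by (intro divide_pos_pos zero_less_power) auto
  ultimately show ?thesis using c(2) by blast
qed

end

context correlated_trees
begin

lemma prob_lr_grows:
  assumes mu: "1 < \<mu>" and KL: "filterlim (KL lam s) at_top sequentially"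
  shows "\<exists>c>0. \<exists>\<delta>>0. \<exists>N. \<forall>D\<ge>N.
    \<delta> \<le> measure_pmf.prob (p1 D) {z. \<forall>n\<in>{N..D}. exp (c * \<mu> ^ n) \<le> lr n (prune2 n z)}"
proof -
  let ?K = "\<bar>mean_log_weight / (\<mu> - 1)\<bar>"
  have "eventually (\<lambda>d. KL lam s d > ?K) sequentially" using KL unfolding filterlim_at_top_dense
    by blast
  then obtain d0 where d0: "?K < (\<integral>z. ln (lr d0 z) \<partial>p1 d0)"
    by (auto simp: KL_eq_expectation dest!: eventually_happens)
  then have "integrable (p1 d0) (\<lambda>z. ln (lr d0 z))"
    using not_integrable_integral_eq[of "p1 d0" "\<lambda>z. ln (lr d0 z)"]
    by (metis abs_ge_zero not_less)
  from ex_truncated_ln_lr[OF this d0] obtain Y where Y: "integrable (p1 d0) (\<lambda>z. (Y z)\<^sup>2)"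
    "?K < (\<integral>z. Y z \<partial>p1 d0)" "\<forall>z\<in>set_pmf (p1 d0). exp (Y z) \<le> lr d0 z" by blast
  interpret growth_seed lam s d0 Y by unfold_locales (use mu Y in auto)
  show ?thesis by (rule prob_lr_grows_seed)
qed

end

section \<open>Extinction\<close>

lemma prob_bind_pmf: "measure_pmf.prob (bind_pmf p f) A = (\<integral>x. measure_pmf.prob (f x) A \<partial>p)"
proof -
  have "ennreal (measure_pmf.prob (bind_pmf p f) A) = (\<integral>\<^sup>+x. ennreal (measure_pmf.prob (f x) A) \<partial>p)"
    by (simp add: measure_pmf.emeasure_eq_measure[symmetric])
  also have "\<dots> = ennreal (\<integral>x. measure_pmf.prob (f x) A \<partial>p)"
    by (intro nn_integral_eq_integral integrable_pmf_bounded[of _ 1]) auto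
  finally show ?thesis by simp
qed

definition extinct_at :: "nat \<Rightarrow> ltree set" where
  "extinct_at n = {t. \<forall>m\<in>t. length m \<noteq> n}"

definition extinction_prob :: "real \<Rightarrow> nat \<Rightarrow> real" where
  "extinction_prob \<mu> n = measure_pmf.prob (GW_pmf \<mu> n) (extinct_at n)"

lemma extinction_prob_0: "extinction_prob \<mu> 0 = 0"
  by (simp add: extinction_prob_def extinct_at_def)

lemma node_in_extinct_at_Suc: "node c F \<in> extinct_at (Suc n) \<longleftrightarrow> (\<forall>i\<in>{1..c}. F i \<in> extinct_at n)"
  by (fastforce simp: extinct_at_def node_def)

lemma extinction_prob_Suc:
  assumes "0 \<le> \<mu>"
  shows "extinction_prob \<mu> (Suc n) = exp (\<mu> * (extinction_prob \<mu> n - 1))"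
proof -
  have "measure_pmf.prob (node_pmf c (\<lambda>_. GW_pmf \<mu> n)) (extinct_at (Suc n)) =
      extinction_prob \<mu> n ^ c" for c
  proof -
    have "node c -` extinct_at (Suc n) = Pi {1..c} (\<lambda>_. extinct_at n)"
      by (auto simp: node_in_extinct_at_Suc)
    then show ?thesis by (simp add: node_pmf_def measure_Pi_pmf_Pi extinction_prob_def)
  qed
  then have "extinction_prob \<mu> (Suc n) = (\<integral>c. extinction_prob \<mu> n ^ c \<partial>Poisson \<mu>)"
    by (simp add: extinction_prob_def[of _ "Suc n"] prob_bind_pmf)
  also have "\<dots> = exp (\<mu> * (extinction_prob \<mu> n - 1))"
    by (rule Poisson_pgf[OF assms]) (simp add: extinction_prob_def)
  finally show ?thesis .
qed

lemma extinction_prob_tendsto: "extinction_prob \<mu> \<longlonglongrightarrow> p_ext \<mu>"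
proof -
  interpret G: prob_space "GW \<mu>" by (rule prob_space_GW)
  let ?E = "\<lambda>n. prune n -` extinct_at n \<inter> ltrees"
  have E_eq: "?E n = {t \<in> ltrees. \<forall>m\<in>t. length m \<noteq> n}" for n
    by (auto simp: extinct_at_def prune_def)
  have "?E n \<in> sets (GW \<mu>)" for n
    using measurable_sets[OF measurable_prune_UNIV, of "extinct_at n" n] by simp
  moreover have "incseq ?E"
    unfolding E_eq
  proof (rule incseq_SucI, safe)
    fix n t m assume t: "t \<in> ltrees" "\<forall>m\<in>t. length m \<noteq> n" "m \<in> t" "length m = Suc n"
    then have "m = butlast m @ [last m]" by (cases m rule: rev_cases) auto
    then have "butlast m \<in> t" using t ltrees_snocD by metis
    then show False using t by auto
  qed
  ultimately have "(\<lambda>n. measure (GW \<mu>) (?E n)) \<longlonglongrightarrow> measure (GW \<mu>) (\<Union>n. ?E n)"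
    by (intro G.finite_Lim_measure_incseq) auto
  moreover have "(\<Union>n. ?E n) = {t \<in> ltrees. \<exists>n. \<forall>m\<in>t. length m \<noteq> n}" unfolding E_eq by blast
  moreover have "measure (GW \<mu>) (?E n) = extinction_prob \<mu> n" for n
  proof -
    have "measure (distr (GW \<mu>) (count_space UNIV) (prune n)) (extinct_at n) =
        measure (GW \<mu>) (prune n -` extinct_at n \<inter> space (GW \<mu>))"
      using measurable_prune_UNIV measurable_cong_sets[OF sets_GW refl]
      by (intro measure_distr) auto
    then show ?thesis by (simp add: distr_GW extinction_prob_def)
  qed
  ultimately show ?thesis by (simp add: p_ext_def)
qed

lemma p_ext_fixed_point: "0 \<le> \<mu> \<Longrightarrow> p_ext \<mu> = exp (\<mu> * (p_ext \<mu> - 1))"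
proof (rule LIMSEQ_unique)
  assume "0 \<le> \<mu>"
  have "(\<lambda>n. exp (\<mu> * (extinction_prob \<mu> n - 1))) \<longlonglongrightarrow> exp (\<mu> * (p_ext \<mu> - 1))"
    by (intro tendsto_intros extinction_prob_tendsto)
  then show "(\<lambda>n. extinction_prob \<mu> (Suc n)) \<longlonglongrightarrow> exp (\<mu> * (p_ext \<mu> - 1))"
    using extinction_prob_Suc[OF \<open>0 \<le> \<mu>\<close>] by simp
  show "(\<lambda>n. extinction_prob \<mu> (Suc n)) \<longlonglongrightarrow> p_ext \<mu>"
    by (rule LIMSEQ_Suc[OF extinction_prob_tendsto])
qed

lemma p_ext_leI:
  assumes "0 \<le> \<mu>" "0 \<le> \<eta>" "exp (\<mu> * (\<eta> - 1)) \<le> \<eta>" shows "p_ext \<mu> \<le> \<eta>"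
proof -
  have "extinction_prob \<mu> n \<le> \<eta>" for n
  proof (induction n)
    case 0 show ?case using assms(2) by (simp add: extinction_prob_0)
  next
    case (Suc n)
    then have "exp (\<mu> * (extinction_prob \<mu> n - 1)) \<le> exp (\<mu> * (\<eta> - 1))"
      using assms(1) by (simp add: mult_left_mono)
    also have "\<dots> \<le> \<eta>" by (rule assms(3))
    finally show ?case using assms(1) by (simp only: extinction_prob_Suc)
  qed
  then show ?thesis by (intro LIMSEQ_le_const2[OF extinction_prob_tendsto]) auto
qed

lemma p_ext_le_1: "p_ext \<mu> \<le> 1"
  unfolding p_ext_def using prob_space.prob_le_1[OF prob_space_GW] .

lemma p_ext_supercritical:
  assumes "1 < \<mu>" shows "p_ext \<mu> < 1"
proof -
  let ?f = "\<lambda>\<eta>. \<eta> - exp (\<mu> * (\<eta> - 1))"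
  have "DERIV ?f 1 :> 1 - \<mu>" by (auto intro!: derivative_eq_intros)
  then obtain d where d: "d > 0" "\<And>h. 0 < h \<Longrightarrow> h < d \<Longrightarrow> ?f 1 < ?f (1 - h)"
    using DERIV_neg_dec_left[of ?f "1 - \<mu>" 1] assms by auto
  define h where "h = min d 1 / 2"
  have "0 < h" "h < d" "h < 1" using d(1) by (auto simp: h_def)
  then have "p_ext \<mu> \<le> 1 - h" using d(2)[of h] assms by (intro p_ext_leI) auto
  then show ?thesis using \<open>0 < h\<close> by simp
qed

lemma exp_gt_add_one: "x \<noteq> 0 \<Longrightarrow> 1 + x < exp (x :: real)"
  using exp_ge_add_one_self[of x] ln_eq_minus_one[of "exp x"]
  by (metis add_diff_cancel_left' exp_eq_one_iff exp_gt_zero less_le ln_exp)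

lemma p_ext_subcritical:
  assumes "0 \<le> \<mu>" "\<mu> \<le> 1" shows "p_ext \<mu> = 1"
proof (rule ccontr)
  assume "p_ext \<mu> \<noteq> 1"
  then have less: "p_ext \<mu> < 1" using p_ext_le_1[of \<mu>] by simp
  show False
  proof (cases "\<mu> = 0")
    case True then show ?thesis using p_ext_fixed_point[of \<mu>] less by simp
  next
    case False
    then have "1 + \<mu> * (p_ext \<mu> - 1) < p_ext \<mu>"
      using exp_gt_add_one[of "\<mu> * (p_ext \<mu> - 1)"] p_ext_fixed_point[OF assms(1)] less by simp
    moreover have "(1 - \<mu>) * (p_ext \<mu> - 1) \<le> 0" using assms less
      by (intro mult_nonneg_nonpos) auto
    ultimately show ?thesis by (simp add: algebra_simps)
  qed
qed

text \<open>By strict convexity the curve lies below the diagonal between its fixed points \<open>p_ext \<mu>\<close> and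
  \<open>1\<close>; concretely, the tangent at \<open>\<eta>\<close> lies strictly below the curve at both of them.\<close>

lemma le_p_extI:
  assumes mu: "0 < \<mu>" and \<eta>: "\<eta> < 1" "\<eta> \<le> exp (\<mu> * (\<eta> - 1))"
  shows "\<eta> \<le> p_ext \<mu>"
proof (rule ccontr)
  assume "\<not> \<eta> \<le> p_ext \<mu>"
  then have less: "p_ext \<mu> < \<eta>" by simp
  define G where "G = exp (\<mu> * (\<eta> - 1))"
  have tangent: "G * (1 + \<mu> * (x - \<eta>)) < exp (\<mu> * (x - 1))" if "x \<noteq> \<eta>" for x
  proof -
    have "G * (1 + \<mu> * (x - \<eta>)) < G * exp (\<mu> * (x - \<eta>))"
      using exp_gt_add_one[of "\<mu> * (x - \<eta>)"] that mu by (simp add: G_def)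
    also have "\<dots> = exp (\<mu> * (x - 1))" by (simp add: G_def exp_add[symmetric] algebra_simps)
    finally show ?thesis .
  qed
  have "G * (1 + \<mu> * (1 - \<eta>)) < 1" using tangent[of 1] \<eta>(1) by simp
  moreover have "G * (1 + \<mu> * (p_ext \<mu> - \<eta>)) < p_ext \<mu>"
    using tangent[of "p_ext \<mu>"] less p_ext_fixed_point[of \<mu>] mu by simp
  ultimately have "(\<eta> - p_ext \<mu>) * (G * (1 + \<mu> * (1 - \<eta>))) +
      (1 - \<eta>) * (G * (1 + \<mu> * (p_ext \<mu> - \<eta>))) < (\<eta> - p_ext \<mu>) * 1 + (1 - \<eta>) * p_ext \<mu>"
    using less \<eta> by (intro add_strict_mono mult_strict_left_mono) auto
  then have "G * (1 - p_ext \<mu>) < \<eta> * (1 - p_ext \<mu>)" by (simp add: algebra_simps)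
  then show False using less \<eta> by (simp add: G_def)
qed

section \<open>The growth event\<close>

lemma ex_inverse_Suc_le:
  fixes \<epsilon> :: real
  assumes "0 < \<epsilon>" shows "\<exists>j\<ge>N. inverse (real (Suc j)) \<le> \<epsilon>"
proof -
  obtain i where i: "inverse (real (Suc i)) < \<epsilon>" using reals_Archimedean[OF assms] by blast
  have "inverse (real (Suc (max N i))) \<le> inverse (real (Suc i))" by (rule le_imp_inverse_le) auto
  then have "inverse (real (Suc (max N i))) \<le> \<epsilon>" using i by linarith
  then show ?thesis using max.cobounded1 by blast
qed

lemma eventually_ge_pos_iff:
  fixes f :: "nat \<Rightarrow> real"
  shows "(\<exists>\<epsilon>>0. eventually (\<lambda>n. \<epsilon> \<le> f n) sequentially) \<longleftrightarrow> (\<exists>j. \<forall>n\<ge>j. inverse (real (Suc j)) \<le> f n)"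
proof
  assume "\<exists>\<epsilon>>0. eventually (\<lambda>n. \<epsilon> \<le> f n) sequentially"
  then obtain \<epsilon> N where \<epsilon>: "0 < \<epsilon>" "\<And>n. n \<ge> N \<Longrightarrow> \<epsilon> \<le> f n" by (auto simp: eventually_sequentially)
  then obtain j where "j \<ge> N" "inverse (real (Suc j)) \<le> \<epsilon>" using ex_inverse_Suc_le by blast
  then show "\<exists>j. \<forall>n\<ge>j. inverse (real (Suc j)) \<le> f n" using \<epsilon>(2) by (meson order_trans)
next
  assume "\<exists>j. \<forall>n\<ge>j. inverse (real (Suc j)) \<le> f n"
  then obtain j where "\<forall>n\<ge>j. inverse (real (Suc j)) \<le> f n" by blast
  then show "\<exists>\<epsilon>>0. eventually (\<lambda>n. \<epsilon> \<le> f n) sequentially"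
    unfolding eventually_sequentially by (intro exI[of _ "inverse (real (Suc j))"]) auto
qed

lemma exp_mult_le_iff_le_ln_divide:
  fixes a b x :: real
  assumes "0 < a" "0 < b" "0 \<le> x" shows "exp (a * b) \<le> x \<longleftrightarrow> a \<le> ln x / b"
proof (cases "x = 0")
  case False
  then show ?thesis using assms by (simp add: pos_le_divide_eq ln_ge_iff)
qed (use assms in simp)

context correlated_trees
begin

abbreviation rate :: "nat \<Rightarrow> real" where "rate j \<equiv> inverse (real (Suc j))"

definition grows_upto :: "nat \<Rightarrow> nat \<Rightarrow> (ltree \<times> ltree) set" where
  "grows_upto j D = {z. \<forall>n\<in>{j..D}. exp (rate j * \<mu> ^ n) \<le> lr n (prune2 n z)}"

definition growth_event :: "nat \<Rightarrow> (ltree \<times> ltree) set" where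
  "growth_event j = {x \<in> ltrees \<times> ltrees. \<forall>n\<ge>j. exp (rate j * \<mu> ^ n) \<le> lr n (prune2 n x)}"

definition growth_prob :: real where
  "growth_prob = measure (P1 lam s) (\<Union>j. growth_event j)"

lemma growth_event_Union:
  assumes "0 < \<mu>"
  shows "{x \<in> ltrees \<times> ltrees. liminf (\<lambda>d. ereal (ln (lr d (prune2 d x)) / \<mu> ^ d)) > 0} =
    (\<Union>j. growth_event j)"
proof -
  have "exp (rate j * \<mu> ^ n) \<le> lr n z \<longleftrightarrow> rate j \<le> ln (lr n z) / \<mu> ^ n" for j n z
    by (rule exp_mult_le_iff_le_ln_divide)
       (use assms in \<open>simp_all add: likelihood_ratio_nonneg zero_less_power del: of_nat_Suc\<close>)
  then show ?thesis
    unfolding liminf_ereal_pos_iff eventually_ge_pos_iff growth_event_def by blast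
qed

lemma vimage_grows_upto:
  "prune2 D -` grows_upto j D \<inter> (ltrees \<times> ltrees) =
    {x \<in> ltrees \<times> ltrees. \<forall>n\<in>{j..D}. exp (rate j * \<mu> ^ n) \<le> lr n (prune2 n x)}"
  by (auto simp: grows_upto_def prune2_prune2)

lemma growth_event_eq_Inter: "growth_event j = (\<Inter>D. prune2 D -` grows_upto j D \<inter> (ltrees \<times> ltrees))"
  unfolding vimage_grows_upto growth_event_def by fastforce

lemma sets_growth_event: "growth_event j \<in> sets (P1 lam s)"
  unfolding growth_event_eq_Inter using P1.sets_vimage_prune2 by (intro sets.countable_INT) auto

lemma measure_growth_event_le:
  "measure (P1 lam s) (growth_event j) \<le> measure_pmf.prob (p1 D) (grows_upto j D)"
proof -
  interpret P: prob_space "P1 lam s" by (rule prob_space_P1)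
  show ?thesis
    unfolding P1.measure_vimage_prune2[symmetric] growth_event_eq_Inter
    by (intro P.finite_measure_mono INF_lower P1.sets_vimage_prune2) simp
qed

lemma measure_growth_event_ge:
  assumes "eventually (\<lambda>D. \<delta> \<le> measure_pmf.prob (p1 D) (grows_upto j D)) sequentially"
  shows "\<delta> \<le> measure (P1 lam s) (growth_event j)"
proof -
  interpret P: prob_space "P1 lam s" by (rule prob_space_P1)
  have "(\<lambda>D. measure (P1 lam s) (prune2 D -` grows_upto j D \<inter> (ltrees \<times> ltrees))) \<longlonglongrightarrow>
      measure (P1 lam s) (growth_event j)"
    unfolding growth_event_eq_Inter
  proof (rule P.finite_Lim_measure_decseq)
    show "decseq (\<lambda>D. prune2 D -` grows_upto j D \<inter> (ltrees \<times> ltrees))"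
      unfolding vimage_grows_upto decseq_def by auto
  qed (use P1.sets_vimage_prune2 in blast)
  then show ?thesis
    unfolding P1.measure_vimage_prune2 using assms by (rule tendsto_lowerbound) simp
qed

lemma incseq_growth_event: "incseq growth_event"
proof (rule incseq_SucI)
  fix j
  have "rate (Suc j) * \<mu> ^ n \<le> rate j * \<mu> ^ n" for n
    using mu_nonneg by (intro mult_right_mono le_imp_inverse_le) auto
  then have "exp (rate (Suc j) * \<mu> ^ n) \<le> exp (rate j * \<mu> ^ n)" for n
    unfolding exp_le_cancel_iff .
  from order_trans[OF this] show "growth_event j \<subseteq> growth_event (Suc j)"
    unfolding growth_event_def by (fastforce simp del: of_nat_Suc)
qed

lemma growth_prob_ge: "measure (P1 lam s) (growth_event j) \<le> growth_prob"
proof -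
  interpret P: prob_space "P1 lam s" by (rule prob_space_P1)
  show ?thesis
    unfolding growth_prob_def by (rule P.finite_measure_mono) (use sets_growth_event in auto)
qed

lemma ex_growth_event_ge:
  assumes "0 < \<epsilon>" shows "\<exists>j. growth_prob - \<epsilon> < measure (P1 lam s) (growth_event j)"
proof -
  interpret P: prob_space "P1 lam s" by (rule prob_space_P1)
  have "(\<lambda>j. measure (P1 lam s) (growth_event j)) \<longlonglongrightarrow> growth_prob"
    unfolding growth_prob_def
    using sets_growth_event incseq_growth_event by (intro P.finite_Lim_measure_incseq) auto
  then have "eventually (\<lambda>j. growth_prob - \<epsilon> < measure (P1 lam s) (growth_event j)) sequentially"
    using assms by (intro order_tendstoD) auto
  then show ?thesis by (auto dest!: eventually_happens)
qed

lemma growth_prob_pos: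
  assumes mu: "1 < \<mu>" and KL: "filterlim (KL lam s) at_top sequentially"
  shows "0 < growth_prob"
proof -
  obtain \<epsilon> \<delta> N where \<epsilon>: "\<epsilon> > 0" "\<delta> > 0" and \<delta>: "\<And>D. D \<ge> N \<Longrightarrow>
      \<delta> \<le> measure_pmf.prob (p1 D) {z. \<forall>n\<in>{N..D}. exp (\<epsilon> * \<mu> ^ n) \<le> lr n (prune2 n z)}"
    using prob_lr_grows[OF assms] by blast
  obtain j where j: "j \<ge> N" "rate j \<le> \<epsilon>" using ex_inverse_Suc_le[OF \<epsilon>(1)] by blast
  have "rate j * \<mu> ^ n \<le> \<epsilon> * \<mu> ^ n" for n
    by (rule mult_right_mono[OF j(2)]) (rule zero_le_power[OF mu_nonneg])
  then have "exp (rate j * \<mu> ^ n) \<le> exp (\<epsilon> * \<mu> ^ n)" for n unfolding exp_le_cancel_iff .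
  from order_trans[OF this] have "{z. \<forall>n\<in>{N..D}. exp (\<epsilon> * \<mu> ^ n) \<le> lr n (prune2 n z)} \<subseteq>
      grows_upto j D" for D
    using j(1) unfolding grows_upto_def by auto
  then have "measure_pmf.prob (p1 D) {z. \<forall>n\<in>{N..D}. exp (\<epsilon> * \<mu> ^ n) \<le> lr n (prune2 n z)} \<le>
      measure_pmf.prob (p1 D) (grows_upto j D)" for D
    by (intro measure_pmf.finite_measure_mono) auto
  from order_trans[OF \<delta> this] have "\<delta> \<le> measure (P1 lam s) (growth_event j)"
    by (intro measure_growth_event_ge) (auto simp: eventually_sequentially)
  then show ?thesis using growth_prob_ge[of j] \<epsilon>(2) by linarith
qed

end

section \<open>Amplification of the growth probability\<close>

lemma prob_branch:
  "measure_pmf.prob (branch \<rho> \<kappa> d p) A =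
    (\<integral>r. measure_pmf.prob (Pi_pmf {1..\<kappa> r} d (\<lambda>_. p)) {G. (r, G) \<in> A} \<partial>\<rho>)"
  unfolding branch_def prob_bind_pmf measure_map_pmf by (simp add: vimage_def)

lemma prob_branch_all:
  "measure_pmf.prob (branch \<rho> \<kappa> d p) {(r, G). \<forall>i\<in>{1..\<kappa> r}. G i \<in> A} =
    (\<integral>r. measure_pmf.prob p A ^ \<kappa> r \<partial>\<rho>)"
proof -
  have "{G. \<forall>i\<in>{1..k}. G i \<in> A} = Pi {1..k} (\<lambda>_. A)" for k :: nat by auto
  then show ?thesis unfolding prob_branch by (simp add: measure_Pi_pmf_Pi)
qed

lemma prob_branch_ex_le:
  assumes "integrable (measure_pmf \<rho>) (\<lambda>r. real (\<kappa> r))"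
  shows "measure_pmf.prob (branch \<rho> \<kappa> d p) {(r, G). \<exists>i\<in>{1..\<kappa> r}. G i \<in> A} \<le>
    (\<integral>r. real (\<kappa> r) \<partial>\<rho>) * measure_pmf.prob p A"
proof -
  have "measure_pmf.prob (Pi_pmf {1..k} d (\<lambda>_. p)) {G. \<exists>i\<in>{1..k}. G i \<in> A} \<le>
      real k * measure_pmf.prob p A" for k :: nat
  proof -
    have "{G. \<exists>i\<in>{1..k}. G i \<in> A} = (\<Union>i\<in>{1..k}. (\<lambda>G. G i) -` A)" by auto
    also have "measure_pmf.prob (Pi_pmf {1..k} d (\<lambda>_. p)) \<dots> \<le>
        (\<Sum>i\<in>{1..k}. measure_pmf.prob (Pi_pmf {1..k} d (\<lambda>_. p)) ((\<lambda>G. G i) -` A))"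
      by (rule measure_UNION_le) auto
    also have "\<dots> = (\<Sum>i\<in>{1..k}. measure_pmf.prob p A)"
      by (intro sum.cong refl) (simp add: measure_map_pmf[symmetric] Pi_pmf_component)
    finally show ?thesis by simp
  qed
  then have "measure_pmf.prob (branch \<rho> \<kappa> d p) {(r, G). \<exists>i\<in>{1..\<kappa> r}. G i \<in> A} \<le>
      (\<integral>r. real (\<kappa> r) * measure_pmf.prob p A \<partial>\<rho>)"
    unfolding prob_branch using assms
    by (intro integral_mono[OF integrable_pmf_bounded[of _ 1]]) auto
  then show ?thesis by simp
qed

lemma prob_bind_pmf_le:
  assumes "0 \<le> c" "\<And>x. x \<in> set_pmf p \<Longrightarrow> x \<notin> B \<Longrightarrow> measure_pmf.prob (f x) A \<le> c"
  shows "measure_pmf.prob (p \<bind> f) A \<le> measure_pmf.prob p B + c"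
proof -
  have "(\<integral>x. measure_pmf.prob (f x) A \<partial>p) \<le> (\<integral>x. indicator B x + c \<partial>p)"
  proof (rule integral_mono_AE[OF integrable_pmf_bounded[of _ 1]])
    have "measure_pmf.prob (f x) A \<le> indicator B x + c" if "x \<in> set_pmf p" for x
      using assms(2)[OF that] assms(1) measure_pmf.prob_le_1[of "f x" A]
      by (auto simp: indicator_def intro: order_trans)
    then show "AE x in p. measure_pmf.prob (f x) A \<le> indicator B x + c"
      by (simp add: AE_measure_pmf_iff)
  qed (auto intro: integrable_pmf_indicator)
  then show ?thesis using integrable_pmf_indicator[of p B] by (simp add: prob_bind_pmf)
qed

lemma prob_Compl_pmf: "measure_pmf.prob p (- A) = 1 - measure_pmf.prob p A"
  using measure_pmf.prob_compl[of A p] by (simp add: Compl_eq_Diff_UNIV)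

lemma finite_set_approx_prob:
  assumes "0 < \<epsilon>"
  shows "\<exists>F\<subseteq>A \<inter> set_pmf p. finite F \<and> measure_pmf.prob p A - \<epsilon> < measure_pmf.prob p F"
proof -
  let ?S = "A \<inter> set_pmf p"
  let ?F = "\<lambda>n. {x \<in> ?S. to_nat_on ?S x \<le> n}"
  have countable: "countable ?S" by simp
  have fin: "finite (?F n)" for n
    by (rule inj_on_finite[of "to_nat_on ?S" _ "{..n}"])
       (auto intro: inj_on_subset[OF inj_on_to_nat_on[OF countable]])
  have "(\<lambda>n. measure_pmf.prob p (?F n)) \<longlonglongrightarrow> measure_pmf.prob p (\<Union>n. ?F n)"
    by (rule measure_pmf.finite_Lim_measure_incseq) (auto simp: incseq_def)
  also have "(\<Union>n. ?F n) = ?S" by auto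
  finally have "(\<lambda>n. measure_pmf.prob p (?F n)) \<longlonglongrightarrow> measure_pmf.prob p A"
    by (simp add: measure_Int_set_pmf)
  then have "eventually (\<lambda>n. measure_pmf.prob p A - \<epsilon> < measure_pmf.prob p (?F n)) sequentially"
    using assms by (intro order_tendstoD) auto
  then obtain n where "measure_pmf.prob p A - \<epsilon> < measure_pmf.prob p (?F n)"
    by (auto dest!: eventually_happens)
  then show ?thesis using fin[of n] by (intro exI[of _ "?F n"]) auto
qed

lemma ex_prob_gt_le:
  fixes f :: "'a \<Rightarrow> real"
  assumes "0 < \<epsilon>" shows "\<exists>K. measure_pmf.prob p {x. f x > K} \<le> \<epsilon>"
proof -
  obtain F where F: "finite F" "1 - \<epsilon> < measure_pmf.prob p F"
    using finite_set_approx_prob[OF assms, of UNIV p] by auto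
  define K where "K = Max (insert 0 (f ` F))"
  have "{x. f x > K} \<subseteq> - F" using F(1) by (auto simp: K_def not_less[symmetric])
  then have "measure_pmf.prob p {x. f x > K} \<le> measure_pmf.prob p (- F)"
    by (intro measure_pmf.finite_measure_mono) auto
  then have "measure_pmf.prob p {x. f x > K} \<le> \<epsilon>" using F(2) unfolding prob_Compl_pmf by linarith
  then show ?thesis by blast
qed

lemma eventually_linear_le_power:
  fixes \<mu> :: real
  assumes "1 < \<mu>" "0 < c" shows "eventually (\<lambda>n. a + b * real n \<le> c * \<mu> ^ n) sequentially"
proof -
  have "norm (1 / \<mu>) < 1" using assms(1) by simp
  then have "(\<lambda>n. a * (1 / \<mu>) ^ n + b * (real n * (1 / \<mu>) ^ n)) \<longlonglongrightarrow> a * 0 + b * 0"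
    by (intro tendsto_intros LIMSEQ_power_zero powser_times_n_limit_0)
  then have "eventually (\<lambda>n. a * (1 / \<mu>) ^ n + b * (real n * (1 / \<mu>) ^ n) < c) sequentially"
    using assms(2) by (intro order_tendstoD(2)) auto
  then show ?thesis
  proof eventually_elim
    case (elim n)
    have "0 < \<mu> ^ n" using assms(1) by simp
    then show ?case
      using assms(1) elim mult_right_mono[OF less_imp_le[OF elim], of "\<mu> ^ n"]
      by (simp add: power_one_over distrib_right)
  qed
qed

lemma (in projective_pmfs) prob_small_lr_le:
  "measure_pmf.prob (Q D) {x. \<exists>n\<in>{I..D}. lr n (proj n x) < exp (- real n)} \<le>
    exp (- 1) ^ I / (1 - exp (- 1))"
proof -
  have "{x. \<exists>n\<in>{I..D}. lr n (proj n x) < exp (- real n)} =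
      (\<Union>n\<in>{I..<Suc D}. proj n -` {x. lr n x < exp (- real n)})"
    by (auto simp: atLeastLessThanSuc_atLeastAtMost)
  also have "measure_pmf.prob (Q D) \<dots> \<le>
      (\<Sum>n\<in>{I..<Suc D}. measure_pmf.prob (Q D) (proj n -` {x. lr n x < exp (- real n)}))"
    by (rule measure_UNION_le) auto
  also have "\<dots> \<le> (\<Sum>n\<in>{I..<Suc D}. exp (- 1) ^ n)"
  proof (rule sum_mono)
    fix n assume "n \<in> {I..<Suc D}"
    then have "n \<le> D" by simp
    show "measure_pmf.prob (Q D) (proj n -` {x. lr n x < exp (- real n)}) \<le> exp (- 1) ^ n"
      unfolding prob_Q_vimage_proj[OF \<open>n \<le> D\<close>]
      using prob_lr_less_le[of "exp (- real n)" n] by (simp add: exp_of_nat_mult[symmetric])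
  qed
  also have "\<dots> \<le> exp (- 1) ^ I / (1 - exp (- 1))" by (rule sum_geometric_tail_le) auto
  finally show ?thesis .
qed

context correlated_trees
begin

lemma exp_le_lr_completion:
  assumes r: "r \<in> set_pmf root_degrees" and g: "\<And>i. i \<in> {1..fst r} \<Longrightarrow> g i \<in> ltrees \<times> ltrees"
    and z: "z \<in> set_pmf (pair_completion_pmf lam D r g)"
    and K: "\<bar>log_weight r\<bar> + real (fst r) \<le> K"
    and children: "\<And>i. i \<in> {1..fst r} \<Longrightarrow> exp (- real n) \<le> lr n (prune2 n (g i))"
    and i: "i \<in> {1..fst r}" "exp t \<le> lr n (prune2 n (g i))"
  shows "exp (t - (K + K * real n)) \<le> lr (Suc n) (prune2 (Suc n) z)"
proof -
  let ?lr = "\<lambda>i. lr n (prune2 n (g i))"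
  have "real (fst r - 1) * real n \<le> K * real n" using K by (intro mult_right_mono) auto
  then have "exp (t - (K + K * real n)) \<le> exp (log_weight r + (t - real (fst r - 1) * real n))"
    using K by simp
  also have "\<dots> = exp (log_weight r) * (exp t * (\<Prod>i\<in>{1..fst r} - {i}. exp (- real n)))"
    using i(1) by (simp add: exp_add exp_diff exp_minus field_simps card_Diff_singleton
        exp_of_nat_mult[symmetric])
  also have "\<dots> \<le> exp (log_weight r) * (?lr i * (\<Prod>i\<in>{1..fst r} - {i}. ?lr i))"
    using i(2) children
    by (intro mult_left_mono mult_mono prod_mono) (auto intro!: prod_nonneg likelihood_ratio_nonneg)
  also have "?lr i * (\<Prod>i\<in>{1..fst r} - {i}. ?lr i) = (\<Prod>i\<in>{1..fst r}. ?lr i)"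
    using i(1) by (subst prod.remove[of "{1..fst r}" i]) auto
  also have "exp (log_weight r) * \<dots> \<le> lr (Suc n) (prune2 (Suc n) z)"
    by (rule lr_completion_ge[OF r g z])
  finally show ?thesis .
qed

lemma ex_growth_margin:
  assumes "1 < \<mu>"
  shows "\<exists>I\<ge>N. \<forall>n\<ge>I. K + K * real n + rate (Suc I) * \<mu> ^ Suc n \<le> rate j * \<mu> ^ n"
proof -
  define b where "b = rate j / 2"
  have b: "rate j = 2 * b" "0 < b" by (auto simp: b_def)
  have "eventually (\<lambda>n. K + K * real n \<le> b * \<mu> ^ n) sequentially"
    using assms b(2) by (rule eventually_linear_le_power)
  then obtain M where M: "\<And>n. n \<ge> M \<Longrightarrow> K + K * real n \<le> b * \<mu> ^ n"
    by (auto simp: eventually_sequentially)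
  have "0 < b / \<mu>" using assms b(2) by (intro divide_pos_pos) auto
  then obtain I where I: "I \<ge> max N M" "rate I \<le> b / \<mu>" using ex_inverse_Suc_le by blast
  have "rate (Suc I) \<le> rate I" by (rule le_imp_inverse_le) auto
  then have "rate (Suc I) * \<mu> \<le> b / \<mu> * \<mu>"
    using I(2) by (intro mult_right_mono[OF _ mu_nonneg]) linarith
  also have "\<dots> = b" using assms by auto
  finally have "rate (Suc I) * \<mu> * \<mu> ^ n \<le> b * \<mu> ^ n" for n
    using mu_nonneg by (intro mult_right_mono zero_le_power)
  then have "rate (Suc I) * \<mu> ^ Suc n \<le> b * \<mu> ^ n" for n by (simp only: power_Suc mult.assoc)
  then have "K + K * real n + rate (Suc I) * \<mu> ^ Suc n \<le> b * \<mu> ^ n + b * \<mu> ^ n" if "n \<ge> I" for n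
    using M I(1) that by (intro add_mono) auto
  moreover have "N \<le> I" using I(1) by simp
  ultimately show ?thesis unfolding b(1) mult_2 distrib_right by blast
qed

lemma grows_upto_Suc:
  assumes r: "r \<in> set_pmf root_degrees" and g: "\<And>i. i \<in> {1..fst r} \<Longrightarrow> g i \<in> ltrees \<times> ltrees"
    and z: "z \<in> set_pmf (pair_completion_pmf lam D r g)"
    and K: "\<bar>log_weight r\<bar> + real (fst r) \<le> K"
    and children: "\<And>i n. i \<in> {1..fst r} \<Longrightarrow> n \<in> {I..D} \<Longrightarrow> exp (- real n) \<le> lr n (prune2 n (g i))"
    and i: "i \<in> {1..fst r}" "g i \<in> grows_upto j D" and j: "j \<le> I"
    and margin: "\<And>n. n \<ge> I \<Longrightarrow> K + K * real n + rate (Suc I) * \<mu> ^ Suc n \<le> rate j * \<mu> ^ n"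
  shows "z \<in> grows_upto (Suc I) (Suc D)"
  unfolding grows_upto_def mem_Collect_eq
proof
  fix m assume "m \<in> {Suc I..Suc D}"
  then obtain n where n: "m = Suc n" "I \<le> n" "n \<le> D" by (cases m) auto
  have "exp (rate (Suc I) * \<mu> ^ Suc n) \<le> exp (rate j * \<mu> ^ n - (K + K * real n))"
    using margin[OF n(2)] by (simp only: exp_le_cancel_iff)
  also have "\<dots> \<le> lr (Suc n) (prune2 (Suc n) z)"
    by (rule exp_le_lr_completion[OF r g z K children i(1)])
       (use i(2) j n in \<open>auto simp: grows_upto_def\<close>)
  finally show "exp (rate (Suc I) * \<mu> ^ m) \<le> lr m (prune2 m z)" by (simp only: n)
qed

lemma prob_no_child_in:
  "measure_pmf.prob (branch root_degrees fst d p) {(r, g). \<forall>i\<in>{1..fst r}. g i \<in> - A} =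
    exp (- \<mu> * measure_pmf.prob p A)"
proof -
  have "(\<integral>r. measure_pmf.prob p (- A) ^ fst r \<partial>root_degrees) =
      (\<integral>k. measure_pmf.prob p (- A) ^ k \<partial>map_pmf fst root_degrees)" by simp
  also have "\<dots> = exp (\<mu> * (measure_pmf.prob p (- A) - 1))"
    unfolding map_fst_root_degrees by (rule Poisson_pgf[OF mu_nonneg]) simp
  finally show ?thesis unfolding prob_branch_all by (simp add: prob_Compl_pmf)
qed

definition no_growth_pattern :: "real \<Rightarrow> nat \<Rightarrow> nat \<Rightarrow> nat \<Rightarrow>
    ((nat \<times> nat \<times> nat) \<times> (nat \<Rightarrow> ltree \<times> ltree)) set" where
  "no_growth_pattern K I j D = {(r, g). \<bar>log_weight r\<bar> + real (fst r) > K} \<union>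
     {(r, g). \<exists>i\<in>{1..fst r}. g i \<in> {z. \<exists>n\<in>{I..D}. lr n (prune2 n z) < exp (- real n)}} \<union>
     {(r, g). \<forall>i\<in>{1..fst r}. g i \<in> - grows_upto j D}"

lemma prob_no_growth_pattern_le:
  assumes K: "measure_pmf.prob root_degrees {r. \<bar>log_weight r\<bar> + real (fst r) > K} \<le> \<epsilon>"
    and small: "\<mu> * (exp (- 1) ^ I / (1 - exp (- 1))) \<le> \<epsilon>"
  shows "measure_pmf.prob (branch root_degrees fst ({[]}, {[]}) (p1 D))
      (no_growth_pattern K I j D) \<le>
    \<epsilon> + \<epsilon> + exp (- \<mu> * measure_pmf.prob (p1 D) (grows_upto j D))"
  unfolding no_growth_pattern_def
proof (intro order_trans[OF measure_Un_le] add_mono)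
  let ?J = "branch root_degrees fst ({[]}, {[]}) (p1 D)"
  let ?small = "{z. \<exists>n\<in>{I..D}. lr n (prune2 n z) < exp (- real n)}"
  have "map_pmf fst ?J = root_degrees"
    by (simp add: branch_def map_bind_pmf pmf.map_comp o_def map_pmf_const bind_return_pmf')
  then have "measure_pmf.prob ?J (fst -` {r. \<bar>log_weight r\<bar> + real (fst r) > K}) \<le> \<epsilon>"
    using K by (simp only: measure_map_pmf[symmetric])
  then show "measure_pmf.prob ?J {(r, g). \<bar>log_weight r\<bar> + real (fst r) > K} \<le> \<epsilon>"
    by (simp add: vimage_def case_prod_unfold)
  have "measure_pmf.prob ?J {(r, g). \<exists>i\<in>{1..fst r}. g i \<in> ?small} \<le>
      \<mu> * (exp (- 1) ^ I / (1 - exp (- 1)))"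
    using prob_branch_ex_le[OF mean_root_degrees(1)] prob_small_lr_le mu_nonneg
    unfolding mean_root_degrees(2) by (rule order_trans[OF _ mult_left_mono])
  then show "measure_pmf.prob ?J {(r, g). \<exists>i\<in>{1..fst r}. g i \<in> ?small} \<le> \<epsilon>"
    using small by linarith
  show "measure_pmf.prob ?J {(r, g). \<forall>i\<in>{1..fst r}. g i \<in> - grows_upto j D} \<le>
      exp (- \<mu> * measure_pmf.prob (p1 D) (grows_upto j D))"
    unfolding prob_no_child_in ..
qed auto

text \<open>The ratio at the root grows as soon as it grows at one child, provided that the root has few
  children and a moderate weight and that the ratios at the other children are not too small.\<close>

lemma prob_grows_upto_Suc:
  assumes j: "j \<le> I"
    and K: "measure_pmf.prob root_degrees {r. \<bar>log_weight r\<bar> + real (fst r) > K} \<le> \<epsilon>"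
    and small: "\<mu> * (exp (- 1) ^ I / (1 - exp (- 1))) \<le> \<epsilon>"
    and margin: "\<And>n. n \<ge> I \<Longrightarrow> K + K * real n + rate (Suc I) * \<mu> ^ Suc n \<le> rate j * \<mu> ^ n"
  shows "1 - (2 * \<epsilon> + exp (- \<mu> * measure_pmf.prob (p1 D) (grows_upto j D))) \<le>
    measure_pmf.prob (p1 (Suc D)) (grows_upto (Suc I) (Suc D))"
proof -
  let ?J = "branch root_degrees fst ({[]}, {[]}) (p1 D)"
  have grow: "set_pmf (pair_completion_pmf lam D r g) \<subseteq> grows_upto (Suc I) (Suc D)"
    if rg: "(r, g) \<in> set_pmf ?J" "(r, g) \<notin> no_growth_pattern K I j D" for r g
  proof
    fix z assume z: "z \<in> set_pmf (pair_completion_pmf lam D r g)"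
    from rg(2) obtain i where i: "i \<in> {1..fst r}" "g i \<in> grows_upto j D"
      by (auto simp: no_growth_pattern_def)
    have "g i \<in> ltrees \<times> ltrees" if "i \<in> {1..fst r}" for i
      using set_branch(2)[OF rg(1) that] P1.set_p[of lam s D] by (auto simp: ltrees_upto_def)
    then show "z \<in> grows_upto (Suc I) (Suc D)"
      by (rule grows_upto_Suc[OF set_branch(1)[OF rg(1)] _ z _ _ i j margin])
         (use rg(2) in \<open>auto simp: no_growth_pattern_def not_less\<close>)
  qed
  have "measure_pmf.prob (pair_completion_pmf lam D (fst x) (snd x))
      (- grows_upto (Suc I) (Suc D)) = 0"
    if "x \<in> set_pmf ?J" "x \<notin> no_growth_pattern K I j D" for x
    using grow[of "fst x" "snd x"] that unfolding measure_pmf_zero_iff prod.collapse by blast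
  then have "measure_pmf.prob (p1 (Suc D)) (- grows_upto (Suc I) (Suc D)) \<le>
      measure_pmf.prob ?J (no_growth_pattern K I j D) + 0"
    unfolding P1_pmf_Suc case_prod_unfold by (intro prob_bind_pmf_le) auto
  also have "\<dots> \<le> 2 * \<epsilon> + exp (- \<mu> * measure_pmf.prob (p1 D) (grows_upto j D))"
    using prob_no_growth_pattern_le[OF K small, of D j] by simp
  finally show ?thesis unfolding prob_Compl_pmf by linarith
qed

lemma growth_prob_amplification:
  assumes mu: "1 < \<mu>" and \<epsilon>: "0 < \<epsilon>"
  shows "1 - growth_prob \<le> exp (- \<mu> * (growth_prob - \<epsilon>)) + 2 * \<epsilon>"
proof -
  obtain j where j: "growth_prob - \<epsilon> < measure (P1 lam s) (growth_event j)"
    using ex_growth_event_ge[OF \<epsilon>] by blast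
  obtain K where K: "measure_pmf.prob root_degrees {r. \<bar>log_weight r\<bar> + real (fst r) > K} \<le> \<epsilon>"
    using ex_prob_gt_le[OF \<epsilon>, of root_degrees "\<lambda>r. \<bar>log_weight r\<bar> + real (fst r)"] by blast
  have "(\<lambda>I. \<mu> * (exp (- 1) ^ I / (1 - exp (- 1)))) \<longlonglongrightarrow> \<mu> * (0 / (1 - exp (- 1)))"
    by (intro tendsto_intros LIMSEQ_power_zero) auto
  then have "eventually (\<lambda>I. \<mu> * (exp (- 1) ^ I / (1 - exp (- 1))) < \<epsilon>) sequentially"
    using \<epsilon> by (intro order_tendstoD(2)) auto
  then obtain M where M: "\<And>I. I \<ge> M \<Longrightarrow> \<mu> * (exp (- 1) ^ I / (1 - exp (- 1))) < \<epsilon>"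
    by (auto simp: eventually_sequentially)
  obtain I where I: "I \<ge> max j M"
    "\<And>n. n \<ge> I \<Longrightarrow> K + K * real n + rate (Suc I) * \<mu> ^ Suc n \<le> rate j * \<mu> ^ n"
    using ex_growth_margin[OF mu] by blast
  have "1 - (2 * \<epsilon> + exp (- \<mu> * (growth_prob - \<epsilon>))) \<le>
      measure_pmf.prob (p1 (Suc D)) (grows_upto (Suc I) (Suc D))" for D
  proof -
    have "growth_prob - \<epsilon> \<le> measure_pmf.prob (p1 D) (grows_upto j D)"
      using j measure_growth_event_le[of j D] by linarith
    then have "\<mu> * (growth_prob - \<epsilon>) \<le> \<mu> * measure_pmf.prob (p1 D) (grows_upto j D)"
      using mu_nonneg by (rule mult_left_mono)
    then have "exp (- \<mu> * measure_pmf.prob (p1 D) (grows_upto j D)) \<le> exp (- \<mu> * (growth_prob - \<epsilon>))"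
      by simp
    moreover have "1 - (2 * \<epsilon> + exp (- \<mu> * measure_pmf.prob (p1 D) (grows_upto j D))) \<le>
        measure_pmf.prob (p1 (Suc D)) (grows_upto (Suc I) (Suc D))"
      by (rule prob_grows_upto_Suc[OF _ K _ I(2)]) (use I(1) M[of I] in auto)
    ultimately show ?thesis by linarith
  qed
  then have "1 - (2 * \<epsilon> + exp (- \<mu> * (growth_prob - \<epsilon>))) \<le>
      measure (P1 lam s) (growth_event (Suc I))"
    by (intro measure_growth_event_ge)
       (simp add: eventually_sequentially_Suc[symmetric, of "\<lambda>D. _ D \<le> _ D"])
  then show ?thesis using growth_prob_ge[of "Suc I"] by linarith
qed

lemma growth_prob_ge_survival:
  assumes mu: "1 < \<mu>" and KL: "filterlim (KL lam s) at_top sequentially"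
  shows "1 - p_ext \<mu> \<le> growth_prob"
proof -
  have "1 - growth_prob \<le> exp (- \<mu> * (growth_prob - 0)) + 2 * 0"
  proof (rule tendsto_lowerbound)
    show "((\<lambda>\<epsilon>. exp (- \<mu> * (growth_prob - \<epsilon>)) + 2 * \<epsilon>) \<longlongrightarrow> exp (- \<mu> * (growth_prob - 0)) + 2 * 0)
        (at_right 0)"
      by (intro tendsto_intros)
    show "eventually (\<lambda>\<epsilon>. 1 - growth_prob \<le> exp (- \<mu> * (growth_prob - \<epsilon>)) + 2 * \<epsilon>) (at_right 0)"
      using eventually_at_right_less[of 0]
      by eventually_elim (rule growth_prob_amplification[OF mu])
  qed simp
  then have "1 - growth_prob \<le> p_ext \<mu>" using growth_prob_pos[OF assms] mu
    by (intro le_p_extI) auto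
  then show ?thesis by simp
qed

end

section \<open>The subcritical regime\<close>

context correlated_trees
begin

lemma map_fst_p1: "map_pmf fst (p1 n) = gw n" and map_snd_p1: "map_pmf snd (p1 n) = gw n"
  using GW_pmf_bind_relabeled_augmentation_pmf[OF lam_pos s_nonneg s_le_1]
  by (simp_all add: P1_pmf_def map_bind_pmf map_fst_pair_pmf map_snd_pair_pmf)

end

lemma prune_eq_extinct_at_iff:
  assumes "t \<in> ltrees" "x \<in> extinct_at h" shows "prune h t = x \<longleftrightarrow> t = x"
proof -
  have "prune h u = u" if "u \<in> ltrees" "prune h u \<in> extinct_at h" for u
  proof -
    have "length m \<le> h" if "m \<in> u" for m
    proof (rule ccontr)
      assume "\<not> length m \<le> h"
      then have "take h m \<in> prune h u"
        using ltrees_prefix[OF \<open>u \<in> ltrees\<close>, of "take h m" "drop h m"] that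
        by (simp add: prune_def)
      then show False using \<open>prune h u \<in> extinct_at h\<close> \<open>\<not> length m \<le> h\<close>
        by (auto simp: extinct_at_def)
    qed
    then show ?thesis by (auto simp: prune_def)
  qed
  moreover have "prune h x \<in> extinct_at h" using assms(2) by (auto simp: extinct_at_def prune_def)
  ultimately show ?thesis using assms by metis
qed

lemma pmf_GW_pmf_extinct:
  assumes "x \<in> extinct_at h" "h \<le> n" shows "pmf (GW_pmf \<mu> n) x = pmf (GW_pmf \<mu> h) x"
proof -
  have "pmf (GW_pmf \<mu> h) x = measure_pmf.prob (GW_pmf \<mu> n) (prune h -` {x})"
    unfolding map_prune_GW_pmf[OF assms(2), symmetric] by (rule pmf_map)
  also have "\<dots> = measure_pmf.prob (GW_pmf \<mu> n) {x}"
  proof -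
    have "prune h -` {x} \<inter> set_pmf (GW_pmf \<mu> n) = {x} \<inter> set_pmf (GW_pmf \<mu> n)"
      using set_GW_pmf[of \<mu> n] prune_eq_extinct_at_iff[OF ltrees_upto_imp_ltrees assms(1)]
      by blast
    then show ?thesis by (metis measure_Int_set_pmf)
  qed
  finally show ?thesis by (simp add: measure_pmf_single)
qed

context correlated_trees
begin

text \<open>Averaged over the common tree, the law of the relabeled augmentation is \<open>gw n\<close>, and a single
  common tree \<open>x\<close> contributes its share to the average.\<close>

lemma pmf_relabeled_augmentation_le:
  assumes "x \<in> extinct_at h" "x \<in> set_pmf (GW_pmf \<mu> h)" "h \<le> n"
  shows "pmf (relabeled_augmentation_pmf lam s n x) y \<le> 1 / pmf (GW_pmf \<mu> h) x * pmf (gw n) y"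
proof -
  have "pmf (GW_pmf \<mu> h) x * pmf (relabeled_augmentation_pmf lam s n x) y \<le> pmf (gw n) y"
    unfolding pmf_GW_pmf_extinct[OF assms(1,3), symmetric]
      GW_pmf_bind_relabeled_augmentation_pmf[OF lam_pos s_nonneg s_le_1, symmetric]
    by (rule pmf_bind_ge)
  moreover have "0 < pmf (GW_pmf \<mu> h) x" using assms(2) by (simp add: pmf_positive)
  ultimately show ?thesis by (simp add: field_simps)
qed

lemma prob_pair_relabeled_augmentation_le:
  assumes "x \<in> extinct_at h" "x \<in> set_pmf (GW_pmf \<mu> h)" "h \<le> n"
  shows "measure_pmf.prob (pair_pmf (relabeled_augmentation_pmf lam s n x)
      (relabeled_augmentation_pmf lam s n x)) A \<le>
    (1 / pmf (GW_pmf \<mu> h) x)\<^sup>2 * measure_pmf.prob (p0 n) A"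
proof (rule prob_le_mult_prob)
  fix z :: "ltree \<times> ltree"
  obtain y y' where z: "z = (y, y')" by (cases z)
  have "pmf (relabeled_augmentation_pmf lam s n x) y *
      pmf (relabeled_augmentation_pmf lam s n x) y' \<le>
      (1 / pmf (GW_pmf \<mu> h) x * pmf (gw n) y) * (1 / pmf (GW_pmf \<mu> h) x * pmf (gw n) y')"
    by (intro mult_mono pmf_relabeled_augmentation_le[OF assms]) auto
  then show "pmf (pair_pmf (relabeled_augmentation_pmf lam s n x)
      (relabeled_augmentation_pmf lam s n x)) z \<le>
      (1 / pmf (GW_pmf \<mu> h) x)\<^sup>2 * pmf (p0 n) z"
    by (simp add: z pmf_pair P0_pmf_def power2_eq_square ac_simps)
qed simp

lemma uniformly_dominated_if_subcritical:
  assumes mu: "\<mu> \<le> 1" and \<epsilon>: "0 < \<epsilon>"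
  shows "\<exists>C\<ge>0. \<forall>n A. measure_pmf.prob (p1 n) A \<le> \<epsilon> + C * measure_pmf.prob (p0 n) A"
proof -
  have "eventually (\<lambda>n. extinction_prob \<mu> n > 1 - \<epsilon> / 2) sequentially"
    using extinction_prob_tendsto[of \<mu>] \<epsilon> p_ext_subcritical[OF mu_nonneg mu]
    by (intro order_tendstoD) auto
  then obtain h where h: "extinction_prob \<mu> h > 1 - \<epsilon> / 2" by (auto dest!: eventually_happens)
  obtain F where F: "F \<subseteq> extinct_at h \<inter> set_pmf (GW_pmf \<mu> h)" "finite F"
    "extinction_prob \<mu> h - \<epsilon> / 2 < measure_pmf.prob (GW_pmf \<mu> h) F"
    unfolding extinction_prob_def using finite_set_approx_prob[of "\<epsilon> / 2"] \<epsilon>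
    by (metis half_gt_zero)
  define C where "C = (\<Sum>x\<in>F. (1 / pmf (GW_pmf \<mu> h) x)\<^sup>2)"
  have C: "0 \<le> C" by (simp add: C_def sum_nonneg)
  have deep: "measure_pmf.prob (p1 n) A \<le> \<epsilon> + C * measure_pmf.prob (p0 n) A" if n: "h \<le> n" for n A
  proof -
    have "measure_pmf.prob (p1 n) A \<le>
        measure_pmf.prob (GW_pmf \<mu> n) (- F) + C * measure_pmf.prob (p0 n) A"
      unfolding P1_pmf_def
    proof (rule prob_bind_pmf_le)
      fix x assume "x \<notin> - F"
      then have x: "x \<in> F" by simp
      then have "(1 / pmf (GW_pmf \<mu> h) x)\<^sup>2 \<le> C" unfolding C_def using F(2)
        by (intro member_le_sum) auto
      from mult_right_mono[OF this measure_nonneg]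
      show "measure_pmf.prob (pair_pmf (relabeled_augmentation_pmf lam s n x)
          (relabeled_augmentation_pmf lam s n x)) A \<le> C * measure_pmf.prob (p0 n) A"
        using x F(1) n by (intro order_trans[OF prob_pair_relabeled_augmentation_le]) auto
    qed (use C in simp)
    moreover have "measure_pmf.prob (GW_pmf \<mu> n) F = measure_pmf.prob (GW_pmf \<mu> h) F"
      using F(1,2) n
      by (auto simp: measure_measure_pmf_finite intro!: sum.cong pmf_GW_pmf_extinct)
    ultimately show ?thesis using F(3) h unfolding prob_Compl_pmf by linarith
  qed
  have "measure_pmf.prob (p1 n) A \<le> \<epsilon> + C * measure_pmf.prob (p0 n) A" for n A
  proof (cases "h \<le> n")
    case False
    then have "n \<le> h" by simp
    from deep[OF order_refl, of "prune2 n -` A"] show ?thesis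
      unfolding prob_Q_vimage_proj[OF \<open>n \<le> h\<close>] prob_P_vimage_proj[OF \<open>n \<le> h\<close>] .
  qed (rule deep)
  then show ?thesis using C by blast
qed

lemma supercritical_if_ratio_test: "ratio_test a \<Longrightarrow> 1 < \<mu>"
  using not_ratio_test_if_uniformly_dominated[OF uniformly_dominated_if_subcritical] by force

end

section \<open>Divergence of the relative entropy\<close>

lemma integrable_branch_sum:
  fixes f :: "'s \<Rightarrow> real"
  assumes f: "integrable (measure_pmf p) f" and A: "integrable (measure_pmf \<rho>) A"
    and \<kappa>: "integrable (measure_pmf \<rho>) (\<lambda>r. real (\<kappa> r))"
  shows "integrable (branch \<rho> \<kappa> d p) (\<lambda>(r, G). A r + (\<Sum>i\<in>{1..\<kappa> r}. f (G i)))"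
proof (rule integrableI_bounded)
  let ?I = "\<integral>\<^sup>+x. ennreal \<bar>f x\<bar> \<partial>p"
  have inner: "(\<integral>\<^sup>+G. ennreal \<bar>A r + (\<Sum>i\<in>{1..k}. f (G i))\<bar> \<partial>Pi_pmf {1..k} d (\<lambda>_. p)) \<le>
      ennreal \<bar>A r\<bar> + ennreal (real k) * ?I" for r and k :: nat
  proof -
    have component: "(\<integral>\<^sup>+G. ennreal \<bar>f (G i)\<bar> \<partial>Pi_pmf {1..k} d (\<lambda>_. p)) = ?I"
        if "i \<in> {1..k}" for i
      using nn_integral_map_pmf[of "\<lambda>G. G i" "Pi_pmf {1..k} d (\<lambda>_. p)" "\<lambda>x. ennreal \<bar>f x\<bar>"] that
      by (simp add: Pi_pmf_component)
    have "\<bar>A r + (\<Sum>i\<in>{1..k}. f (G i))\<bar> \<le> \<bar>A r\<bar> + (\<Sum>i\<in>{1..k}. \<bar>f (G i)\<bar>)" for G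
      using sum_abs[of "\<lambda>i. f (G i)" "{1..k}"] by linarith
    then have "(\<integral>\<^sup>+G. ennreal \<bar>A r + (\<Sum>i\<in>{1..k}. f (G i))\<bar> \<partial>Pi_pmf {1..k} d (\<lambda>_. p)) \<le>
        (\<integral>\<^sup>+G. ennreal \<bar>A r\<bar> + (\<Sum>i\<in>{1..k}. ennreal \<bar>f (G i)\<bar>) \<partial>Pi_pmf {1..k} d (\<lambda>_. p))"
      by (intro nn_integral_mono) (simp add: sum_nonneg ennreal_leI flip: ennreal_plus)
    also have "\<dots> = ennreal \<bar>A r\<bar> + (\<Sum>i\<in>{1..k}. ?I)"
      by (simp add: nn_integral_add nn_integral_sum component
        measure_pmf.emeasure_space_1[simplified]
          del: sum_ennreal)
    finally show ?thesis by (simp add: ennreal_of_nat_eq_real_of_nat)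
  qed
  have "(\<integral>\<^sup>+y. ennreal (norm (case y of (r, G) \<Rightarrow> A r + (\<Sum>i\<in>{1..\<kappa> r}. f (G i)))) \<partial>branch \<rho> \<kappa> d p) \<le>
      (\<integral>\<^sup>+r. ennreal \<bar>A r\<bar> + ennreal (real (\<kappa> r)) * ?I \<partial>\<rho>)"
    using inner by (auto simp: branch_def intro!: nn_integral_mono)
  also have "\<dots> = (\<integral>\<^sup>+r. ennreal \<bar>A r\<bar> \<partial>\<rho>) + (\<integral>\<^sup>+r. ennreal (real (\<kappa> r)) \<partial>\<rho>) * ?I"
    by (simp add: nn_integral_add nn_integral_multc)
  also have "\<dots> < \<infinity>"
    using f A \<kappa> by (simp add: integrable_iff_bounded ennreal_mult_less_top)
  finally show "(\<integral>\<^sup>+y. ennreal (norm (case y of (r, G) \<Rightarrow> A r + (\<Sum>i\<in>{1..\<kappa> r}. f (G i))))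
      \<partial>branch \<rho> \<kappa> d p) < \<infinity>" .
qed simp

lemma integrable_ln_pmf_Poisson:
  assumes "0 < m" shows "integrable (Poisson m) (\<lambda>k. ln (pmf (Poisson m) k))"
proof (rule Bochner_Integration.integrable_bound)
  show "integrable (Poisson m) (\<lambda>k. m + (\<bar>ln m\<bar> + 2) * exp (1 * real k))"
    using integrable_Poisson_exp[of m 1] assms by simp
  have "\<bar>ln (pmf (Poisson m) k)\<bar> \<le> m + (\<bar>ln m\<bar> + 2) * exp (real k)" for k
  proof -
    have "pmf (Poisson m) k = exp (real k * ln m - ln (fact k) - m)"
      using assms by (intro pmf_Poisson_exp) (auto simp: set_pmf_eq pmf_Poisson)
    then show ?thesis using abs_mult_diff_ln_fact_le[of k "real k" "ln m"] assms by simp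
  qed
  then show "AE k in Poisson m. norm (ln (pmf (Poisson m) k)) \<le>
      norm (m + (\<bar>ln m\<bar> + 2) * exp (1 * real k))"
    using assms by (auto intro: order_trans[OF _ abs_ge_self])
qed simp

context correlated_trees
begin

lemma ln_pmf_gw_node:
  assumes F: "\<And>i. i \<in> {1..k} \<Longrightarrow> F i \<in> ltrees_upto n"
  shows "ln (pmf (gw (Suc n)) (node k F)) =
    ln (pmf (Poisson lam) k) + (\<Sum>i\<in>{1..k}. ln (pmf (gw n) (F i)))"
proof -
  have pos: "0 < (\<Prod>i\<in>{1..k}. pmf (gw n) (F i))" using pmf_gw_pos[OF F] by (rule prod_pos)
  have "pmf (gw (Suc n)) (node k F) = pmf (Poisson lam) k * (\<Prod>i\<in>{1..k}. pmf (gw n) (F i))"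
    by (rule pmf_GW_pmf_node[OF F])
  moreover have "0 < pmf (Poisson lam) k" using lam_pos by (simp add: pmf_Poisson)
  moreover have "ln (\<Prod>i\<in>{1..k}. pmf (gw n) (F i)) = (\<Sum>i\<in>{1..k}. ln (pmf (gw n) (F i)))"
    by (rule ln_prod) (use pmf_gw_pos[OF F] in \<open>auto simp: less_imp_neq[symmetric]\<close>)
  ultimately show ?thesis using pos by (simp only: ln_mult_pos)
qed

lemma integrable_ln_pmf_gw: "integrable (gw n) (\<lambda>x. ln (pmf (gw n) x))"
proof (induction n)
  case 0 show ?case by (simp add: integrable_measure_pmf_finite)
next
  case (Suc n)
  let ?J = "branch (Poisson lam) (\<lambda>k. k) {[]} (gw n)"
  let ?f = "\<lambda>(k, F). ln (pmf (Poisson lam) k) + (\<Sum>i\<in>{1..k}. ln (pmf (gw n) (F i)))"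
  have gw: "gw (Suc n) = map_pmf (\<lambda>(k, F). node k F) ?J"
    by (simp add: node_pmf_def branch_def map_bind_pmf pmf.map_comp o_def)
  have "integrable ?J ?f"
    using lam_pos
    by (intro integrable_branch_sum Suc.IH integrable_ln_pmf_Poisson Poisson_mean) auto
  moreover have "AE y in ?J. ln (pmf (gw (Suc n)) (case y of (k, F) \<Rightarrow> node k F)) = ?f y"
  proof (unfold AE_measure_pmf_iff, safe)
    fix k F assume "(k, F) \<in> set_pmf ?J"
    from set_branch(2)[OF this] have "F i \<in> ltrees_upto n" if "i \<in> {1..k}" for i
      using set_GW_pmf that by blast
    then show "ln (pmf (gw (Suc n)) (node k F)) =
        ln (pmf (Poisson lam) k) + (\<Sum>i\<in>{1..k}. ln (pmf (gw n) (F i)))"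
      by (rule ln_pmf_gw_node)
  qed
  ultimately have "integrable ?J (\<lambda>y. ln (pmf (gw (Suc n)) (case y of (k, F) \<Rightarrow> node k F)))"
    by (subst integrable_cong_AE) auto
  then show ?case by (subst gw) (simp add: integrable_map_pmf_eq)
qed

lemma lr_le_inverse_pmf_gw:
  assumes "z \<in> tree_pairs n" shows "lr n z \<le> 1 / pmf (gw n) (fst z)"
proof -
  obtain x y where z: "z = (x, y)" by (cases z)
  have pos: "pmf (gw n) x > 0" "pmf (gw n) y > 0" using assms z pmf_gw_pos by auto
  have "pmf (p1 n) (x, y) \<le> measure_pmf.prob (p1 n) (snd -` {y})"
    unfolding measure_pmf_single[symmetric] by (intro measure_pmf.finite_measure_mono) auto
  also have "\<dots> = pmf (gw n) y" unfolding map_snd_p1[symmetric] by (rule pmf_map[symmetric])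
  finally have "lr n (x, y) * (pmf (gw n) x * pmf (gw n) y) \<le> pmf (gw n) y"
    unfolding pmf_eq_lr_mult by (simp add: P0_pmf_def pmf_pair)
  then have "lr n (x, y) * pmf (gw n) x \<le> 1" using pos by (simp add: mult.assoc[symmetric])
  then show ?thesis using pos by (simp add: z pos_le_divide_eq)
qed

lemma abs_ln_lr_le:
  assumes z: "z \<in> set_pmf (p1 n)"
  shows "\<bar>ln (lr n z)\<bar> \<le> \<bar>ln (pmf (gw n) (fst z))\<bar> + (1 + neg_ln_lr_square n z)"
proof (cases "lr n z < 1")
  case True
  then show ?thesis using abs_le_1_add_square[of "ln (lr n z)"] by simp
next
  case False
  have "z \<in> tree_pairs n" using z P1.set_p by blast
  then have pos: "pmf (gw n) (fst z) > 0" using pmf_gw_pos by (auto simp: mem_Times_iff)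
  have "ln (lr n z) \<le> ln (1 / pmf (gw n) (fst z))"
    using lr_le_inverse_pmf_gw[OF \<open>z \<in> tree_pairs n\<close>] False pos by (subst ln_le_cancel_iff) auto
  also have "\<dots> = - ln (pmf (gw n) (fst z))" using pos by (simp add: ln_div)
  finally show ?thesis using False by simp
qed

lemma integrable_ln_lr: "integrable (p1 n) (\<lambda>z. ln (lr n z))"
proof (rule Bochner_Integration.integrable_bound)
  have "integrable (map_pmf fst (p1 n)) (\<lambda>x. ln (pmf (gw n) x))"
    unfolding map_fst_p1 by (rule integrable_ln_pmf_gw)
  then have "integrable (p1 n) (\<lambda>z. ln (pmf (gw n) (fst z)))" by (simp add: integrable_map_pmf_eq)
  then show "integrable (p1 n) (\<lambda>z. \<bar>ln (pmf (gw n) (fst z))\<bar> + (1 + neg_ln_lr_square n z))"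
    using integrable_neg_ln_lr_square by simp
  show "AE z in p1 n. norm (ln (lr n z)) \<le>
      norm (\<bar>ln (pmf (gw n) (fst z))\<bar> + (1 + neg_ln_lr_square n z))"
    using abs_ln_lr_le by (auto simp: AE_measure_pmf_iff intro: order_trans[OF _ abs_ge_self])
qed simp

section \<open>The equivalences\<close>

lemma ex_ratio_test_if_growth_prob_pos:
  assumes mu: "1 < \<mu>" and "0 < growth_prob" shows "\<exists>a. ratio_test a"
  unfolding ex_ratio_test_iff_not_tight_lr
proof
  assume tight_lr
  then obtain K where K: "\<And>n. measure_pmf.prob (p1 n) {x. lr n x > K} < growth_prob / 2"
    using half_gt_zero[OF assms(2)] by (rule tight_lrE) blast
  obtain j where j: "growth_prob - growth_prob / 2 < measure (P1 lam s) (growth_event j)"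
    using ex_growth_event_ge[of "growth_prob / 2"] assms(2) by auto
  have "eventually (\<lambda>n. K + 0 * real n \<le> rate j * \<mu> ^ n) sequentially"
    using mu by (intro eventually_linear_le_power) auto
  then have "eventually (\<lambda>n. K + 0 * real n \<le> rate j * \<mu> ^ n \<and> j \<le> n) sequentially"
    by (intro eventually_conj eventually_ge_at_top)
  then obtain n where n: "K \<le> rate j * \<mu> ^ n" "j \<le> n" by (auto dest!: eventually_happens)
  then have "K < exp (rate j * \<mu> ^ n)" using exp_gt_self[of "rate j * \<mu> ^ n"] by linarith
  then have "grows_upto j n \<subseteq> prune2 n -` {x. lr n x > K}"
    using n(2) by (auto simp: grows_upto_def simp del: of_nat_Suc dest!: bspec[of _ _ n])
  then have "measure_pmf.prob (p1 n) (grows_upto j n) \<le>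
      measure_pmf.prob (p1 n) (prune2 n -` {x. lr n x > K})"
    by (intro measure_pmf.finite_measure_mono) auto
  then show False
    using j measure_growth_event_le[of j n] K[of n] unfolding prob_Q_vimage_proj[OF order_refl]
    by linarith
qed

lemma KL_diverges_iff: "filterlim (KL lam s) at_top sequentially \<and> 1 < \<mu> \<longleftrightarrow> (\<exists>a. ratio_test a)"
proof
  assume "filterlim (KL lam s) at_top sequentially \<and> 1 < \<mu>"
  then show "\<exists>a. ratio_test a" using growth_prob_pos ex_ratio_test_if_growth_prob_pos by blast
next
  assume "\<exists>a. ratio_test a"
  then obtain a where a: "ratio_test a" ..
  have "KL lam s = (\<lambda>d. \<integral>x. ln (lr d x) \<partial>p1 d)" by (rule ext) (rule KL_eq_expectation)
  then show "filterlim (KL lam s) at_top sequentially \<and> 1 < \<mu>"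
    using filterlim_expectation_ln_lr[OF a integrable_ln_lr] supercritical_if_ratio_test[OF a]
    by simp
qed

lemma not_uniformly_integrable_iff:
  "martingale (P0 lam) pruned_filtration (\<lambda>d x. lr d (prune2 d x)) \<and>
     \<not> uniformly_integrable (P0 lam) (\<lambda>d x. lr d (prune2 d x)) \<longleftrightarrow> (\<exists>a. ratio_test a)"
  using martingale_lr uniformly_integrable_lr_iff by blast

lemma growth_iff:
  "1 < \<mu> \<and> 1 - p_ext \<mu> \<le> measure (P1 lam s)
     {x \<in> ltrees \<times> ltrees. liminf (\<lambda>d. ereal (ln (lr d (prune2 d x)) / \<mu> ^ d)) > 0} \<longleftrightarrow>
   (\<exists>a. ratio_test a)"
proof (cases "1 < \<mu>")
  case True
  then have "0 < \<mu>" by simp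
  have "1 - p_ext \<mu> \<le> growth_prob \<longleftrightarrow> (\<exists>a. ratio_test a)"
    using ex_ratio_test_if_growth_prob_pos[OF True] p_ext_supercritical[OF True]
      growth_prob_ge_survival[OF True] KL_diverges_iff by force
  then show ?thesis using True unfolding growth_event_Union[OF \<open>0 < \<mu>\<close>] growth_prob_def by blast
next
  case False
  then show ?thesis using supercritical_if_ratio_test by blast
qed

end

theorem theorem1:
  fixes lam s :: real
  assumes "lam > 0" and "s \<in> {0..1}"
  defines "Test \<equiv> (\<exists>T. one_sided_test (pruned_law (P0 lam)) (pruned_law (P1 lam s)) T)"
    and "KL_diverges \<equiv> filterlim (KL lam s) at_top sequentially \<and> lam * s > 1"
    and "Likelihood_test \<equiv> (\<exists>a :: nat \<Rightarrow> real. filterlim a at_top sequentially \<and>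
           (\<lambda>d. measure (pruned_law (P0 lam) d)
                  {x \<in> ltrees_upto d \<times> ltrees_upto d. L lam s d x > a d}) \<longlonglongrightarrow> 0 \<and>
           liminf (\<lambda>d. ereal (measure (pruned_law (P1 lam s) d)
                  {x \<in> ltrees_upto d \<times> ltrees_upto d. L lam s d x > a d})) > 0)"
    and "Not_UI \<equiv>
           martingale (P0 lam) pruned_filtration (\<lambda>d x. L lam s d (prune2 d x)) \<and>
           \<not> uniformly_integrable (P0 lam) (\<lambda>d x. L lam s d (prune2 d x))"
    and "Growth \<equiv> lam * s > 1 \<and>
           measure (P1 lam s) {x \<in> ltrees \<times> ltrees.
             liminf (\<lambda>d. ereal (ln (L lam s d (prune2 d x)) / (lam * s) ^ d)) > 0}
             \<ge> 1 - p_ext (lam * s)"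
  shows "(Test \<longleftrightarrow> KL_diverges) \<and> (Test \<longleftrightarrow> Likelihood_test) \<and>
         (Test \<longleftrightarrow> Not_UI) \<and> (Test \<longleftrightarrow> Growth)"
proof -
  interpret M: correlated_trees lam s using assms(1,2) by unfold_locales auto
  show ?thesis
    unfolding Test_def KL_diverges_def Likelihood_test_def Not_UI_def Growth_def M.L_eq_lr
      M.ex_one_sided_test_iff M.KL_diverges_iff M.likelihood_test_iff
      M.not_uniformly_integrable_iff M.growth_iff
    by simp
qed

end
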